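(* Let $\epsilon\ge0$ and let $\Phi$ be a Gibbs point process on $\mathbb X$ with temperature parameter $\theta>0$, partition function $C(\theta)$ and total potential energy $$U(x_1,\dots,x_k)=\sum_{i=1}^k\Psi_1(x_i)+\sum_{i=1}^{k-1}\sum_{j=i+1}^k\Psi_2(x_i,x_j),$$ such that $\int_{\mathbb X}e^{-\theta\Psi_1(x)}\,\ell(\mathrm dx)<+\infty$, $\Psi_2\ge0$ and $\|\Psi_2\|_\infty\le\epsilon$. Then $$\Delta_{TV}^*(\Phi,\zeta_M)\le(M(\mathbb X))^2\,\theta\,\epsilon,$$ where $\zeta_M$ is the Poisson point process on $\mathbb X$ with intensity measure $M(\mathrm dx)=e^{-\theta\Psi_1(x)}\,\ell(\mathrm dx)$.
   Context: $\mathbb X$ is a locally compact metric space with its Borel $\sigma$-algebra, and $\ell$ is a Radon measure on $\mathbb X$ (not necessarily diffuse). Configurations are nonnegative-integer-valued measures on $\mathbb X$ finite on relatively compact Borel sets (treated as multisets of points), with the smallest $\sigma$-algebra making $\phi\mapsto\phi(A)$ measurable for every relatively compact Borel $A$; $\widehat N_{\mathbb X}$ is the set of finite configurations; a point process is a random configuration. $\Psi_1:\mathbb X\to\mathbb R_+$ and $\Psi_2:\mathbb X^2\to\mathbb R_+$ are measurable, $\Psi_2$ is symmetric, and $\|\cdot\|_\infty$ is the supremum norm. A finite point process $\Phi$ has Janossy function $j:\widehat N_{\mathbb X}\to\mathbb R_+$ if $\mathbb E[u(\Phi)]=\sum_{k\ge0}\frac1{k!}\int_{\mathbb X^k}u(x_1,\dots,x_k)j(x_1,\dots,x_k)\,\ell(\mathrm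 dx_1)\cdots\ell(\mathrm dx_k)$ for all measurable $u:\widehat N_{\mathbb X}\to\mathbb R_+$. $\Phi$ is a Gibbs point process with temperature parameter $\theta$, energy $U$ and partition function $C(\theta)>0$ if it is a finite point process with Janossy function $j(\phi)=C(\theta)e^{-\theta U(\phi)}$. For measures $\nu_1,\nu_2$ on $\mathbb X$, $\Delta_{TV}(\nu_1,\nu_2)=\sup|\nu_1(A)-\nu_2(A)|$, the supremum being over Borel $A$ with $\nu_1(A),\nu_2(A)<\infty$. For point processes $\Phi_1,\Phi_2$ with laws $\mathbb P_1,\mathbb P_2$, $\Delta_{TV}^*(\Phi_1,\Phi_2)=\inf_{\mathbf C}\int\Delta_{TV}(\omega_1,\omega_2)\,\mathbf C(\mathrm d(\omega_1,\omega_2))$, the infimum being over all couplings $\mathbf C$ of $\mathbb P_1$ and $\mathbb P_2$. *)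

theory Defs
  imports "HOL-Probability.Probability"
begin

section \<open>Radon measures\<close>

definition radon_measure :: "'a::metric_space measure \<Rightarrow> bool" where
  "radon_measure \<mu> \<longleftrightarrow>
     sets \<mu> = sets borel \<and>
     (\<forall>x. \<exists>V. open V \<and> x \<in> V \<and> emeasure \<mu> V < \<infinity>) \<and>
     (\<forall>A\<in>sets borel. emeasure \<mu> A = (SUP K\<in>{K. compact K \<and> K \<subseteq> A}. emeasure \<mu> K))"


section \<open>Configurations and point processes\<close>

definition relcompact_borel :: "'a::metric_space set set" where
  "relcompact_borel = {A \<in> sets borel. compact (closure A)}"

definition configurations :: "'a::metric_space measure set" where
  "configurations =
     {\<phi>. sets \<phi> = sets borel \<and>
         (\<forall>A\<in>sets borel. emeasure \<phi> A \<in> range of_nat \<union> {\<infinity>}) \<and>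
         (\<forall>A\<in>relcompact_borel. emeasure \<phi> A < \<infinity>)}"

definition finite_configurations :: "'a::metric_space measure set" where
  "finite_configurations = {\<phi> \<in> configurations. emeasure \<phi> UNIV < \<infinity>}"

definition config_space :: "'a::metric_space measure measure" where
  "config_space =
     sigma configurations
       {{\<phi> \<in> configurations. emeasure \<phi> A \<in> B} | A B. A \<in> relcompact_borel \<and> B \<in> sets borel}"

text \<open>The configuration \<open>\<delta>\<^bsub>x 1\<^esub> + \<dots> + \<delta>\<^bsub>x k\<^esub>\<close> (the multiset of the points \<open>x 1, \<dots>, x k\<close>),
  obtained as the image of the counting measure on \<open>{1..k}\<close>.\<close>

definition tuple_config :: "nat \<Rightarrow> (nat \<Rightarrow> 'a::metric_space) \<Rightarrow> 'a measure" where
  "tuple_config k x = distr (count_space {1..k}) borel x"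

definition point_process :: "'w measure \<Rightarrow> ('w \<Rightarrow> 'a::metric_space measure) \<Rightarrow> bool" where
  "point_process \<Omega> \<Phi> \<longleftrightarrow> prob_space \<Omega> \<and> \<Phi> \<in> measurable \<Omega> config_space"

definition finite_point_process :: "'w measure \<Rightarrow> ('w \<Rightarrow> 'a::metric_space measure) \<Rightarrow> bool" where
  "finite_point_process \<Omega> \<Phi> \<longleftrightarrow>
     point_process \<Omega> \<Phi> \<and> (AE \<omega> in \<Omega>. \<Phi> \<omega> \<in> finite_configurations)"

definition law :: "'w measure \<Rightarrow> ('w \<Rightarrow> 'a::metric_space measure) \<Rightarrow> 'a measure measure" where
  "law \<Omega> \<Phi> = distr \<Omega> config_space \<Phi>"


section \<open>Gibbs and Poisson point processes\<close>

text \<open>The reference measure \<open>l\<close> is meant to be sigma-finite, so that \<open>\<Pi>\<^sub>M\<close> is the product measure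
  \<open>l(dx\<^sub>1) \<dots> l(dx\<^sub>k)\<close>; for \<open>k = 0\<close> it is the unit mass at the empty tuple.\<close>

definition has_janossy_function ::
    "'w measure \<Rightarrow> ('w \<Rightarrow> 'a::metric_space measure) \<Rightarrow> 'a measure \<Rightarrow> ('a measure \<Rightarrow> real) \<Rightarrow> bool" where
  "has_janossy_function \<Omega> \<Phi> l j \<longleftrightarrow>
     (\<forall>\<phi>\<in>finite_configurations. 0 \<le> j \<phi>) \<and>
     (\<forall>u :: 'a measure \<Rightarrow> real.
        u \<in> borel_measurable (restrict_space config_space finite_configurations) \<longrightarrow>
        (\<forall>\<phi>\<in>finite_configurations. 0 \<le> u \<phi>) \<longrightarrow>
        (\<integral>\<^sup>+\<omega>. ennreal (u (\<Phi> \<omega>)) \<partial>\<Omega>) =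
        (\<Sum>k. ennreal (1 / fact k) *
           (\<integral>\<^sup>+x. ennreal (u (tuple_config k x) * j (tuple_config k x)) \<partial>(\<Pi>\<^sub>M i\<in>{1..k}. l))))"

definition gibbs_point_process ::
    "'w measure \<Rightarrow> ('w \<Rightarrow> 'a::metric_space measure) \<Rightarrow> 'a measure \<Rightarrow>
     real \<Rightarrow> ('a measure \<Rightarrow> real) \<Rightarrow> real \<Rightarrow> bool" where
  "gibbs_point_process \<Omega> \<Phi> l \<theta> U C \<longleftrightarrow>
     C > 0 \<and> finite_point_process \<Omega> \<Phi> \<and>
     has_janossy_function \<Omega> \<Phi> l (\<lambda>\<phi>. C * exp (- \<theta> * U \<phi>))"

definition poisson_point_process ::
    "'w measure \<Rightarrow> ('w \<Rightarrow> 'a::metric_space measure) \<Rightarrow> 'a measure \<Rightarrow> bool" where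
  "poisson_point_process \<Omega> \<zeta> M \<longleftrightarrow>
     point_process \<Omega> \<zeta> \<and>
     (\<forall>A\<in>relcompact_borel. \<forall>n::nat.
        measure \<Omega> {\<omega> \<in> space \<Omega>. emeasure (\<zeta> \<omega>) A = of_nat n}
          = exp (- measure M A) * measure M A ^ n / fact n) \<and>
     (\<forall>(n::nat) A. (\<forall>i<n. A i \<in> relcompact_borel) \<longrightarrow> disjoint_family_on A {..<n} \<longrightarrow>
        prob_space.indep_vars \<Omega> (\<lambda>_. borel) (\<lambda>i \<omega>. emeasure (\<zeta> \<omega>) (A i)) {..<n})"


section \<open>Total variation and the associated transport distance\<close>

definition tv_dist :: "'a::metric_space measure \<Rightarrow> 'a measure \<Rightarrow> ennreal" where
  "tv_dist \<nu>1 \<nu>2 =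
     (SUP A\<in>{A \<in> sets borel. emeasure \<nu>1 A < \<infinity> \<and> emeasure \<nu>2 A < \<infinity>}.
        ennreal \<bar>measure \<nu>1 A - measure \<nu>2 A\<bar>)"

definition couplings :: "'b measure \<Rightarrow> 'b measure \<Rightarrow> ('b \<times> 'b) measure set" where
  "couplings P1 P2 =
     {Q. sets Q = sets (P1 \<Otimes>\<^sub>M P2) \<and> distr Q P1 fst = P1 \<and> distr Q P2 snd = P2}"

definition tv_transport_dist ::
    "'w measure \<Rightarrow> ('w \<Rightarrow> 'a::metric_space measure) \<Rightarrow>
     'v measure \<Rightarrow> ('v \<Rightarrow> 'a measure) \<Rightarrow> ennreal" where
  "tv_transport_dist \<Omega>1 \<Phi>1 \<Omega>2 \<Phi>2 =
     (INF Q\<in>couplings (law \<Omega>1 \<Phi>1) (law \<Omega>2 \<Phi>2). \<integral>\<^sup>+(\<omega>1, \<omega>2). tv_dist \<omega>1 \<omega>2 \<partial>Q)"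

end

theory Submission
  imports Defs
begin

text \<open>
  Write \<open>M = m N\<close> with \<open>N\<close> a probability measure, and let \<open>g\<close> be the
  Boltzmann factor of the pair energy, so that the Gibbs process has Janossy density \<open>C g\<close> with
  respect to \<open>M\<close>. Adding a point decreases \<open>g\<close>, and the Gibbs process is obtained
  from the Poisson process by deleting points. To find the deletion rates, interpolate: let \<open>D t\<close>
  be the law of the Gibbs process thinned with retention probability \<open>1 - t\<close>, superposed with an
  independent Poisson process of intensity \<open>t M\<close>. Then \<open>D 0\<close> is Gibbs, \<open>D
  1\<close> is Poisson, and the derivative of \<open>D t\<close> is the divergence of a nonnegative flow along
  the edges from \<open>\<phi> + y\<close> to \<open>\<phi>\<close>. Integrating over \<open>t\<close> turns
  the powers of \<open>t\<close> and \<open>1 - t\<close> into the beta weights and yields a flow whose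
  divergence is the difference of the two laws. The Markov chain that follows this flow carries the Poisson
  process to the Gibbs process and only deletes points, so it is a coupling whose cost is at most the mean
  number of deleted points, \<open>m\<close> minus the mean number of Gibbs points. By the equation of
  Georgii, Nguyen and Zessin, this difference is at most \<open>\<theta> \<epsilon> m\<^sup>2\<close>.
\<close>

section \<open>Beta weights and deleting entries of a list\<close>

text \<open>Why the flow has a sign: realise \<open>D t\<close> by letting every Gibbs point die at
  an independent uniform time in [0,1] while new points are born at unit rate with respect to
  \<open>M\<close>. A point still alive dies at rate 1 / (1 - t), which turns its survival factor 1
  - t into 1. Births on the edge from \<phi> to \<phi> + y and deaths on the reverse edge therefore
  carry the same powers of t and 1 - t, and differ only in that \<open>g\<close> is taken without or
  with y. Repulsion makes births prevail on every edge, so reversing the net flux moves mass by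
  deletions alone. The chain starts from configurations of any size, so a balance taken level by
  level leaves a remainder, the flux that enters a level of n points from above. It is controlled by
  2^n, the number of sublists, against m^n / n!. Since the reference measure may have atoms, points
  can coincide. Configurations are therefore handled as lists, deletions as positions, and integrals
  over n points as integrals over the first n entries of one independent sequence, whose
  exchangeability removes the choice of an order.\<close>

definition beta_weight :: "real \<Rightarrow> nat \<Rightarrow> nat \<Rightarrow> real" where
  "beta_weight m a b = integral {0..1} (\<lambda>t. exp (- m * t) * t ^ b * (1 - t) ^ a)"

lemma beta_weight_integrable:
  "(\<lambda>t::real. exp (- m * t) * t ^ b * (1 - t) ^ a) integrable_on {0..1}"
  by (intro integrable_continuous_real continuous_intros)

lemma beta_weight_nonneg: "0 \<le> beta_weight m a b"
  unfolding beta_weight_def by (rule integral_nonneg[OF beta_weight_integrable]) auto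

lemma beta_weight_le_1:
  assumes "0 \<le> m" shows "beta_weight m a b \<le> 1"
proof -
  have "beta_weight m a b \<le> integral {0..1} (\<lambda>t::real. 1)"
    unfolding beta_weight_def
  proof (rule integral_le[OF beta_weight_integrable])
    fix t :: real assume "t \<in> {0..1}"
    then show "exp (- m * t) * t ^ b * (1 - t) ^ a \<le> 1"
      using assms by (intro mult_le_one power_le_one mult_nonneg_nonneg) auto
  qed auto
  then show ?thesis by simp
qed

text \<open>Integration by parts over [0,1]. At t = 0 the boundary term survives only for
  \<open>b = 0\<close>, at t = 1 only for \<open>a = 0\<close>; these two values later produce the
  Gibbs and the Poisson density. The truncated \<open>b - 1\<close> and \<open>a - 1\<close> are
  harmless because of the factors \<open>real b\<close> and \<open>real a\<close>.\<close>

lemma beta_weight_recurrence: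
  "m * beta_weight m a b = (if b = 0 then 1 else 0) - (if a = 0 then exp (- m) else 0)
     + real b * beta_weight m a (b - 1) - real a * beta_weight m (a - 1) b"
proof -
  let ?f = "\<lambda>a b t. exp (- m * t) * t ^ b * (1 - t) ^ a :: real"
  have D: "((\<lambda>t. - ?f a b t) has_vector_derivative
      m * ?f a b t - real b * ?f a (b - 1) t + real a * ?f (a - 1) b t) (at t within {0..1})" for t
    unfolding has_real_derivative_iff_has_vector_derivative[symmetric]
    by (auto intro!: derivative_eq_intros simp: algebra_simps)
  have A: "((\<lambda>t. m * ?f a b t - real b * ?f a (b - 1) t + real a * ?f (a - 1) b t) has_integral
      (- ?f a b 1 - - ?f a b 0)) {0..1}"
    by (rule fundamental_theorem_of_calculus, simp, rule D)
  have B: "((\<lambda>t. m * ?f a b t - real b * ?f a (b - 1) t + real a * ?f (a - 1) b t) has_integral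
      (m * beta_weight m a b - real b * beta_weight m a (b - 1) + real a * beta_weight m (a - 1) b)) {0..1}"
    unfolding beta_weight_def
    by (intro has_integral_add has_integral_diff has_integral_mult_right integrable_integral
        beta_weight_integrable)
  have "m * beta_weight m a b - real b * beta_weight m a (b - 1) + real a * beta_weight m (a - 1) b
      = - ?f a b 1 - - ?f a b 0"
    by (rule has_integral_unique[OF B A])
  moreover have "?f a b 1 = (if a = 0 then exp (- m) else 0)" "?f a b 0 = (if b = 0 then 1 else 0)"
    by (simp_all add: power_0_left)
  ultimately show ?thesis by linarith
qed

section \<open>Deleting one entry and summing over sublists\<close>

definition remove_nth :: "nat \<Rightarrow> 'a list \<Rightarrow> 'a list" where
  "remove_nth i xs = take i xs @ drop (Suc i) xs"

lemma remove_nth_0 [simp]: "remove_nth 0 (x # xs) = xs"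
  and remove_nth_Suc [simp]: "remove_nth (Suc i) (x # xs) = x # remove_nth i xs"
  by (auto simp: remove_nth_def)

lemma length_remove_nth: "i < length xs \<Longrightarrow> length (remove_nth i xs) = length xs - 1"
  by (auto simp: remove_nth_def)

lemma remove_nth_map: "remove_nth i (map f xs) = map f (remove_nth i xs)"
  by (simp add: remove_nth_def take_map drop_map)

lemma mset_remove_nth: "i < length xs \<Longrightarrow> add_mset (xs ! i) (mset (remove_nth i xs)) = mset xs"
  by (metis id_take_nth_drop mset.simps(2) mset_append remove_nth_def union_mset_add_mset_right)

lemma distinct_remove_nth: "i < length xs \<Longrightarrow> distinct xs \<Longrightarrow> distinct (xs ! i # remove_nth i xs)"
  by (metis mset.simps(2) mset_eq_imp_distinct_iff mset_remove_nth)

lemma sum_subseqs_Cons: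
  "(\<Sum>ys\<leftarrow>List.subseqs (x # xs). f ys) = (\<Sum>ys\<leftarrow>List.subseqs xs. f (x # ys)) + (\<Sum>ys\<leftarrow>List.subseqs xs. f ys)"
  by (simp add: Let_def o_def)

text \<open>Double counting: as a set of positions, \<open>ys\<close> lies in the complement of
  \<open>i\<close> exactly when \<open>i\<close> is one of the positions that \<open>ys\<close>
  omits.\<close>

lemma sum_subseqs_remove:
  fixes f :: "'a list \<Rightarrow> real"
  shows "(\<Sum>i<length xs. \<Sum>ys\<leftarrow>List.subseqs (remove_nth i xs). f ys) =
    (\<Sum>ys\<leftarrow>List.subseqs xs. real (length xs - length ys) * f ys)"
proof (induction xs arbitrary: f)
  case (Cons x xs)
  have "(\<Sum>i<length xs. \<Sum>ys\<leftarrow>List.subseqs (remove_nth i xs). f (x # ys)) =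
    (\<Sum>ys\<leftarrow>List.subseqs xs. real (length xs - length ys) * f (x # ys))"
    by (rule Cons)
  moreover have "(\<Sum>ys\<leftarrow>List.subseqs xs. real (Suc (length xs) - length ys) * f ys) =
     (\<Sum>ys\<leftarrow>List.subseqs xs. f ys) + (\<Sum>ys\<leftarrow>List.subseqs xs. real (length xs - length ys) * f ys)"
    unfolding sum_list_addf[symmetric]
  proof (intro arg_cong[where f=sum_list] map_cong refl)
    fix ys assume "ys \<in> set (List.subseqs xs)"
    then have "length ys \<le> length xs" by (simp add: list_emb_length)
    then show "real (Suc (length xs) - length ys) * f ys = f ys + real (length xs - length ys) * f ys"
      by (simp add: Suc_diff_le algebra_simps)
  qed
  ultimately show ?case
    using Cons[of f]
    by (simp add: sum.lessThan_Suc_shift sum_subseqs_Cons sum.distrib del: List.subseqs.simps sum.lessThan_Suc)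
qed simp

text \<open>Double counting again: putting position \<open>i\<close> back gives a set of positions
  containing \<open>i\<close>, and a set of size j arises once for each of its j elements. The
  summand takes a multiset because the point put back is not at its place in the order.\<close>

lemma sum_subseqs_reinsert:
  fixes f :: "'a multiset \<Rightarrow> real"
  shows "(\<Sum>i<length xs. \<Sum>ys\<leftarrow>List.subseqs (remove_nth i xs). f (add_mset (xs ! i) (mset ys))) =
    (\<Sum>ys\<leftarrow>List.subseqs xs. real (length ys) * f (mset ys))"
proof (induction xs arbitrary: f)
  case (Cons x xs)
  have "(\<Sum>i<length xs. \<Sum>ys\<leftarrow>List.subseqs (remove_nth i xs). f (add_mset (xs ! i) (mset (x # ys)))) =
    (\<Sum>ys\<leftarrow>List.subseqs xs. real (length ys) * f (mset (x # ys)))"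
    using Cons[of "\<lambda>\<phi>. f (add_mset x \<phi>)"] by (simp add: add_mset_commute)
  moreover have "(\<Sum>ys\<leftarrow>List.subseqs xs. real (length (x # ys)) * f (mset (x # ys))) =
     (\<Sum>ys\<leftarrow>List.subseqs xs. f (mset (x # ys))) + (\<Sum>ys\<leftarrow>List.subseqs xs. real (length ys) * f (mset (x # ys)))"
    unfolding sum_list_addf[symmetric]
    by (intro arg_cong[where f=sum_list] map_cong refl) (simp add: algebra_simps)
  ultimately show ?case
    using Cons[of f]
    by (simp add: sum.lessThan_Suc_shift sum_subseqs_Cons sum.distrib del: List.subseqs.simps sum.lessThan_Suc)
qed simp

lemma sum_subseqs_Nil:
  fixes f :: "'a list \<Rightarrow> real"
  shows "(\<Sum>ys\<leftarrow>List.subseqs xs. if length ys = 0 then f ys else 0) = f []"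
  by (induction xs arbitrary: f) (simp_all add: sum_subseqs_Cons del: List.subseqs.simps(2))

lemma sum_subseqs_full:
  fixes f :: "'a list \<Rightarrow> real"
  shows "(\<Sum>ys\<leftarrow>List.subseqs xs. if length xs - length ys = 0 then f ys else 0) = f xs"
proof (induction xs arbitrary: f)
  case (Cons x xs)
  have "(\<Sum>ys\<leftarrow>List.subseqs xs. if length (x # xs) - length ys = 0 then f ys else 0) = (\<Sum>ys\<leftarrow>List.subseqs xs. 0)"
  proof (intro arg_cong[where f=sum_list] map_cong refl)
    fix ys assume "ys \<in> set (List.subseqs xs)"
    then have "length ys \<le> length xs" by (simp add: list_emb_length)
    then show "(if length (x # xs) - length ys = 0 then f ys else 0) = 0" by simp
  qed
  then show ?case
    using Cons[of "\<lambda>ys. f (x # ys)"] by (simp add: sum_subseqs_Cons del: List.subseqs.simps(2))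
qed simp

section \<open>Measurability of functions of lists\<close>

text \<open>Quantifying over all index lists, not only over prefixes, is what makes the notion stable
  under deleting and permuting entries.\<close>

definition list_measurable :: "'a measure \<Rightarrow> ('a list \<Rightarrow> 'b) \<Rightarrow> 'b measure \<Rightarrow> bool" where
  "list_measurable N F K \<longleftrightarrow> (\<forall>js. (\<lambda>s. F (map ((!!) s) js)) \<in> measurable (stream_space N) K)"

lemma list_measurableD:
  "list_measurable N F K \<Longrightarrow> (\<lambda>s. F (map ((!!) s) js)) \<in> measurable (stream_space N) K"
  by (simp add: list_measurable_def)

lemma stake_conv_map_snth: "stake n s = map ((!!) s) [0..<n]"
  by (rule nth_equalityI) auto

lemma list_measurable_stake:
  "list_measurable N F K \<Longrightarrow> (\<lambda>s. F (stake n s)) \<in> measurable (stream_space N) K"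
  unfolding stake_conv_map_snth by (rule list_measurableD)

lemma map_snth_Stream: "y # map ((!!) s) js = map ((!!) (y ## s)) (0 # map Suc js)"
  by simp

text \<open>A fresh point and a stream form the stream \<open>y ## s\<close>, so joint measurability
  is the defining property for the index list \<open>0 # map Suc js\<close>.\<close>

lemma list_measurable_Cons_pair:
  assumes F: "list_measurable N F K"
  shows "(\<lambda>(y, s). F (y # map ((!!) s) js)) \<in> measurable (N \<Otimes>\<^sub>M stream_space N) K"
proof -
  have "(\<lambda>p. F (map ((!!) (fst p ## snd p)) (0 # map Suc js))) \<in> measurable (N \<Otimes>\<^sub>M stream_space N) K"
    by (rule measurable_compose[OF _ list_measurableD[OF F]]) measurable
  then show ?thesis by (simp add: case_prod_unfold map_snth_Stream del: list.map)
qed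

lemma list_measurable_compose:
  "list_measurable N F K \<Longrightarrow> f \<in> measurable K L \<Longrightarrow> list_measurable N (\<lambda>xs. f (F xs)) L"
  unfolding list_measurable_def by (auto intro: measurable_compose)

lemma subseqs_map: "List.subseqs (map g xs) = map (map g) (List.subseqs xs)"
  by (induction xs) (simp_all add: Let_def)

lemma borel_measurable_sum_list:
  fixes F :: "'b \<Rightarrow> 'a \<Rightarrow> real"
  shows "(\<And>x. F x \<in> borel_measurable M) \<Longrightarrow> (\<lambda>s. \<Sum>x\<leftarrow>xs. F x s) \<in> borel_measurable M"
  by (induction xs) auto

text \<open>The n-point term in the expansion of a point process with respect to \<open>m\<close>
  times \<open>N\<close>: the n-fold product measure divided by n!, with the points read off one
  independent sequence so that all n share a single space.\<close>

definition level_integral :: "'a measure \<Rightarrow> real \<Rightarrow> nat \<Rightarrow> ('a list \<Rightarrow> ennreal) \<Rightarrow> ennreal" where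
  "level_integral N m n f = ennreal (m ^ n / fact n) * (\<integral>\<^sup>+s. f (stake n s) \<partial>stream_space N)"

section \<open>Functions of independent points: Tonelli and exchangeability\<close>

context prob_space
begin

interpretation stream: prob_space "stream_space M"
  by (rule prob_space_stream_space)

lemma list_measurable_nn_integral:
  assumes F: "list_measurable M F borel"
  shows "list_measurable M (\<lambda>xs. \<integral>\<^sup>+y. F (y # xs) \<partial>M) borel"
  unfolding list_measurable_def
proof
  fix js
  have [measurable]: "(\<lambda>(y, s). F (y # map ((!!) s) js)) \<in> borel_measurable (M \<Otimes>\<^sub>M stream_space M)"
    by (rule list_measurable_Cons_pair[OF F])
  show "(\<lambda>s. \<integral>\<^sup>+y. F (y # map ((!!) s) js) \<partial>M) \<in> borel_measurable (stream_space M)"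
    by measurable
qed

lemma list_measurable_integral:
  fixes F :: "'a list \<Rightarrow> real"
  assumes F: "list_measurable M F borel"
  shows "list_measurable M (\<lambda>xs. \<integral>y. F (y # xs) \<partial>M) borel"
  unfolding list_measurable_def
proof
  fix js
  have [measurable]: "(\<lambda>(y, s). F (y # map ((!!) s) js)) \<in> borel_measurable (M \<Otimes>\<^sub>M stream_space M)"
    by (rule list_measurable_Cons_pair[OF F])
  show "(\<lambda>s. \<integral>y. F (y # map ((!!) s) js) \<partial>M) \<in> borel_measurable (stream_space M)"
    by measurable
qed

lemma nn_integral_stake_Suc:
  assumes F: "list_measurable M F borel"
  shows "(\<integral>\<^sup>+s. F (stake (Suc n) s) \<partial>stream_space M) =
    (\<integral>\<^sup>+y. \<integral>\<^sup>+s. F (y # stake n s) \<partial>stream_space M \<partial>M)"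
  using nn_integral_stream_space[OF list_measurable_stake[OF F, of "Suc n"]] by simp

lemma nn_integral_stake_Suc':
  assumes F: "list_measurable M F borel"
  shows "(\<integral>\<^sup>+s. F (stake (Suc n) s) \<partial>stream_space M) =
    (\<integral>\<^sup>+s. \<integral>\<^sup>+y. F (y # stake n s) \<partial>M \<partial>stream_space M)"
proof -
  interpret P: pair_sigma_finite M "stream_space M" ..
  have "(\<lambda>(y, s). F (y # stake n s)) \<in> borel_measurable (M \<Otimes>\<^sub>M stream_space M)"
    unfolding stake_conv_map_snth by (rule list_measurable_Cons_pair[OF F])
  from P.Fubini'[OF this] show ?thesis
    unfolding nn_integral_stake_Suc[OF F] by simp
qed

text \<open>Exchangeability: an injective renaming of the coordinates preserves the law of an
  independent, identically distributed sequence.\<close>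

lemma nn_integral_stream_reindex:
  assumes F: "list_measurable M F borel" and js: "distinct js"
  shows "(\<integral>\<^sup>+s. F (map ((!!) s) js) \<partial>stream_space M) = (\<integral>\<^sup>+s. F (stake (length js) s) \<partial>stream_space M)"
proof -
  have "prob_space M" by (rule prob_space_axioms)
  let ?P = "\<Pi>\<^sub>M i\<in>(UNIV::nat set). M"
  obtain B where "\<forall>j\<in>set js. j < B"
    using finite_nat_set_iff_bounded[of "set js"] by auto
  then have B: "i < length js \<Longrightarrow> js ! i < B" for i by auto
  \<comment> \<open>Extends \<open>js\<close> to an injection of all indices: positions beyond the
    list are shifted past the bound \<open>B\<close> on its entries.\<close>
  define f where "f i = (if i < length js then js ! i else i + B)" for i
  have "inj f"
  proof (rule injI)
    fix i j assume "f i = f j"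
    then show "i = j"
      using B[of i] B[of j] nth_eq_iff_index_eq[OF js, of i j] by (auto simp: f_def split: if_splits)
  qed
  then have "distr ?P ?P (\<lambda>\<omega>. \<lambda>n\<in>UNIV. \<omega> (f n)) = ?P"
    by (intro distr_PiM_reindex) (auto simp: \<open>prob_space M\<close>)
  then have D: "distr ?P ?P (\<lambda>\<omega> n. \<omega> (f n)) = ?P" by (simp add: restrict_UNIV)
  have meas [measurable]: "(\<lambda>\<omega> n. \<omega> (f n)) \<in> measurable ?P ?P"
    by (rule measurable_PiM_single') (auto simp: space_PiM)
  note [measurable] = list_measurable_stake[OF F] list_measurableD[OF F]
  have "(\<integral>\<^sup>+s. F (stake (length js) s) \<partial>stream_space M) = (\<integral>\<^sup>+\<omega>. F (stake (length js) (to_stream \<omega>)) \<partial>?P)"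
    by (subst stream_space_eq_distr) (simp add: nn_integral_distr)
  also have "\<dots> = (\<integral>\<^sup>+\<omega>. F (stake (length js) (to_stream (\<lambda>n. \<omega> (f n)))) \<partial>?P)"
    by (subst D[symmetric]) (simp add: nn_integral_distr)
  also have "\<dots> = (\<integral>\<^sup>+\<omega>. F (map ((!!) (to_stream \<omega>)) js) \<partial>?P)"
  proof (intro nn_integral_cong arg_cong[where f=F])
    show "stake (length js) (to_stream (\<lambda>n. \<omega> (f n))) = map ((!!) (to_stream \<omega>)) js" for \<omega>
      by (rule nth_equalityI) (auto simp: f_def to_stream_def)
  qed
  also have "\<dots> = (\<integral>\<^sup>+s. F (map ((!!) s) js) \<partial>stream_space M)"
    by (subst stream_space_eq_distr) (simp add: nn_integral_distr)
  finally show ?thesis ..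
qed

text \<open>All n + 1 positions of a deleted point contribute equally; in
  \<open>level_Suc_chain\<close> the resulting factor n + 1 reduces (n + 1)! to n!.\<close>

lemma nn_integral_move_front:
  assumes F: "list_measurable M F borel" and i: "i < Suc n"
  shows "(\<integral>\<^sup>+s. F (stake (Suc n) s ! i # remove_nth i (stake (Suc n) s)) \<partial>stream_space M) =
    (\<integral>\<^sup>+s. F (stake (Suc n) s) \<partial>stream_space M)"
proof -
  let ?js = "[0..<Suc n] ! i # remove_nth i [0..<Suc n]"
  have "stake (Suc n) s ! i # remove_nth i (stake (Suc n) s) = map ((!!) s) ?js" for s :: "'a stream"
    using i unfolding stake_conv_map_snth remove_nth_map by (simp del: upt_Suc)
  moreover have "distinct ?js"
    using i by (intro distinct_remove_nth) (simp_all del: upt_Suc)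
  moreover have "length ?js = Suc n"
    using i by (simp add: length_remove_nth del: upt_Suc)
  ultimately show ?thesis
    using nn_integral_stream_reindex[OF F, of ?js] by simp
qed

end

section \<open>Correlation integrals of a repulsive weight\<close>

lemma list_measurable_tl:
  "list_measurable N F K \<Longrightarrow> list_measurable N (\<lambda>xs. F (tl xs)) K"
  unfolding list_measurable_def by (simp add: map_tl[symmetric])

lemma measurable_Cons_fixed:
  assumes F: "list_measurable N F K" and space: "space N = UNIV"
  shows "(\<lambda>y. F (y # xs)) \<in> measurable N K"
proof -
  \<comment> \<open>The fixed list becomes the prefix of some stream; any continuation will do, and
    \<open>space\<close> puts it into the stream space.\<close>
  let ?s = "xs @- sconst undefined"
  have "(\<lambda>y. (\<lambda>(y, s). F (y # map ((!!) s) [0..<length xs])) (y, ?s)) \<in> measurable N K"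
    by (rule measurable_compose[OF _ list_measurable_Cons_pair[OF F]])
      (auto intro!: measurable_Pair simp: space_stream_space space)
  moreover have "map ((!!) ?s) [0..<length xs] = xs"
    by (rule nth_equalityI) auto
  ultimately show ?thesis by simp
qed

lemma integral_sum_list:
  fixes f :: "'b \<Rightarrow> 'a \<Rightarrow> real"
  assumes "\<And>x. integrable M (f x)"
  shows "integrable M (\<lambda>y. \<Sum>x\<leftarrow>xs. f x y)"
    and "(\<integral>y. (\<Sum>x\<leftarrow>xs. f x y) \<partial>M) = (\<Sum>x\<leftarrow>xs. \<integral>y. f x y \<partial>M)"
proof -
  show i: "integrable M (\<lambda>y. \<Sum>x\<leftarrow>xs. f x y)" for xs
    by (induction xs) (use assms in auto)
  show "(\<integral>y. (\<Sum>x\<leftarrow>xs. f x y) \<partial>M) = (\<Sum>x\<leftarrow>xs. \<integral>y. f x y \<partial>M)"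
    by (induction xs) (use assms i in auto)
qed

text \<open>The integral of \<open>g\<close> over k extra points. Summed over k with factors C / k!,
  it is the correlation function of the Gibbs process; with the additional factors t^k and (1 - t)
  to the power \<open>size \<phi>\<close>, it is the Janossy density of the thinned process.\<close>

primrec correlation :: "'a measure \<Rightarrow> real \<Rightarrow> ('a multiset \<Rightarrow> real) \<Rightarrow> nat \<Rightarrow> 'a multiset \<Rightarrow> real" where
  "correlation N m g 0 \<phi> = g \<phi>"
| "correlation N m g (Suc k) \<phi> = m * (\<integral>y. correlation N m g k (add_mset y \<phi>) \<partial>N)"

text \<open>What the construction takes from the Boltzmann factor: values in [0,1] and the repulsion
  \<open>g_add_le\<close>. Stating it for multisets builds in the symmetry.\<close>

locale repulsive = prob_space N for N :: "'a measure" +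
  fixes m :: real and g :: "'a multiset \<Rightarrow> real"
  assumes space_N: "space N = UNIV"
    and m_nonneg: "0 \<le> m"
    and g_nonneg: "0 \<le> g \<phi>"
    and g_le_1: "g \<phi> \<le> 1"
    and g_add_le: "g (add_mset y \<phi>) \<le> g \<phi>"
    and g_measurable: "list_measurable N (\<lambda>xs. g (mset xs)) borel"
begin

sublocale stream: prob_space "stream_space N"
  by (rule prob_space_stream_space)

abbreviation "I \<equiv> correlation N m g"

lemma I_measurable: "list_measurable N (\<lambda>xs. I k (mset xs)) borel"
proof (induction k)
  case (Suc k)
  from list_measurable_integral[OF Suc] have "list_measurable N (\<lambda>xs. \<integral>y. I k (add_mset y (mset xs)) \<partial>N) borel"
    by simp
  then show ?case
    by (simp add: list_measurable_compose[where f="\<lambda>x. m * x"])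
qed (simp add: g_measurable)

lemma I_measurable_add: "(\<lambda>y. I k (add_mset y \<phi>)) \<in> borel_measurable N"
proof -
  obtain xs where "mset xs = \<phi>" using ex_mset by blast
  then show ?thesis
    using measurable_Cons_fixed[OF I_measurable space_N, of k xs] by simp
qed

lemma I_bounds: "0 \<le> I k \<phi> \<and> I k \<phi> \<le> m ^ k"
proof (induction k arbitrary: \<phi>)
  case (Suc k)
  then have "(\<integral>y. I k (add_mset y \<phi>) \<partial>N) \<le> m ^ k"
    by (intro integral_le_const integrable_const_bound[where B="m ^ k"] I_measurable_add AE_I2) auto
  moreover have "0 \<le> (\<integral>y. I k (add_mset y \<phi>) \<partial>N)"
    using Suc by (intro Bochner_Integration.integral_nonneg) auto
  ultimately show ?case
    using m_nonneg by (auto intro: mult_left_mono)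
qed (auto simp: g_nonneg g_le_1)

lemmas I_nonneg = I_bounds[THEN conjunct1]
lemmas I_le = I_bounds[THEN conjunct2]

lemma I_integrable: "integrable N (\<lambda>y. I k (add_mset y \<phi>))"
  by (intro integrable_const_bound[where B="m ^ k"] I_measurable_add AE_I2) (simp add: I_nonneg I_le)

text \<open>Repulsion survives integration over further points; this gives the flow its
  sign.\<close>

lemma I_add_le: "I k (add_mset y \<phi>) \<le> I k \<phi>"
proof (induction k arbitrary: \<phi>)
  case (Suc k)
  have "(\<integral>z. I k (add_mset z (add_mset y \<phi>)) \<partial>N) \<le> (\<integral>z. I k (add_mset z \<phi>) \<partial>N)"
  proof (rule integral_mono[OF I_integrable I_integrable])
    fix z
    show "I k (add_mset z (add_mset y \<phi>)) \<le> I k (add_mset z \<phi>)"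
      using Suc[of "add_mset z \<phi>"] by (simp add: add_mset_commute)
  qed
  then show ?case using m_nonneg by (simp add: mult_left_mono)
qed (simp add: g_add_le)

text \<open>Tonelli, one point at a time. The fixed part \<phi> is arbitrary so that the point
  peeled off the stream can be absorbed into it.\<close>

lemma nn_integral_g_stake:
  "ennreal (m ^ k) * (\<integral>\<^sup>+s. g (mset (stake k s) + \<phi>) \<partial>stream_space N) = I k \<phi>"
proof (induction k arbitrary: \<phi>)
  case 0 then show ?case by (simp add: stream.emeasure_space_1)
next
  case (Suc k)
  obtain xs where xs: "mset xs = \<phi>" using ex_mset by blast
  have meas: "(\<lambda>s. g (mset (stake (Suc k) s) + \<phi>)) \<in> borel_measurable (stream_space N)"
  proof -
    \<comment> \<open>Prepending the points of \<phi> to the stream makes the integrand a function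
      of a prefix.\<close>
    have shift: "(\<lambda>s. xs @- s) \<in> measurable (stream_space N) (stream_space N)"
    proof (rule measurable_stream_space2)
      show "(\<lambda>s. (xs @- s) !! n) \<in> measurable (stream_space N) N" for n
        by (cases "n < length xs") (simp_all add: space_N)
    qed
    have "(\<lambda>s. g (mset (stake (Suc k + length xs) (xs @- s)))) \<in> borel_measurable (stream_space N)"
      by (rule measurable_compose[OF shift list_measurable_stake[OF g_measurable]])
    then show ?thesis by (simp add: stake_shift xs add.commute del: stake.simps)
  qed
  have meas': "(\<lambda>y. \<integral>\<^sup>+s. g (mset (stake k s) + add_mset y \<phi>) \<partial>stream_space N) \<in> borel_measurable N"
  proof (rule stream.borel_measurable_nn_integral)
    have "(\<lambda>p. ennreal (g (mset (stake (Suc k) (fst p ## snd p)) + \<phi>))) \<in> borel_measurable (N \<Otimes>\<^sub>M stream_space N)"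
      by (rule measurable_compose[OF _ measurable_compose[OF meas measurable_ennreal]]) measurable
    then show "(\<lambda>(y, s). ennreal (g (mset (stake k s) + add_mset y \<phi>))) \<in> borel_measurable (N \<Otimes>\<^sub>M stream_space N)"
      by (simp add: case_prod_unfold)
  qed
  have "ennreal (m ^ Suc k) * (\<integral>\<^sup>+s. g (mset (stake (Suc k) s) + \<phi>) \<partial>stream_space N) =
    ennreal m * (ennreal (m ^ k) * (\<integral>\<^sup>+y. \<integral>\<^sup>+s. g (mset (stake k s) + add_mset y \<phi>) \<partial>stream_space N \<partial>N))"
    using m_nonneg by (subst nn_integral_stream_space) (use meas in \<open>simp_all add: ennreal_mult mult.assoc\<close>)
  also have "\<dots> = ennreal m * (\<integral>\<^sup>+y. I k (add_mset y \<phi>) \<partial>N)"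
    by (subst nn_integral_cmult[OF meas', symmetric]) (simp only: Suc)
  also have "\<dots> = ennreal m * ennreal (\<integral>y. I k (add_mset y \<phi>) \<partial>N)"
    by (simp add: nn_integral_eq_integral[OF I_integrable] I_nonneg)
  also have "\<dots> = I (Suc k) \<phi>"
    by (simp add: ennreal_mult' m_nonneg)
  finally show ?case .
qed

lemma summable_power_fact: "summable (\<lambda>k. m ^ k / fact k)"
  using summable_exp[of m] by (simp add: field_simps)

lemma suminf_power_fact: "(\<Sum>k. m ^ k / fact k) = exp m"
  unfolding exp_def by (simp add: scaleR_conv_of_real field_simps)

lemma summable_weighted_I:
  assumes "\<And>k. \<bar>v k\<bar> \<le> 1"
  shows "summable (\<lambda>k. v k / fact k * I k \<phi>)"
proof (rule summable_comparison_test'[OF summable_power_fact, of 0])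
  fix k
  have "\<bar>v k\<bar> * I k \<phi> \<le> 1 * m ^ k"
    by (rule mult_mono) (auto simp: assms I_nonneg I_le)
  then show "norm (v k / fact k * I k \<phi>) \<le> m ^ k / fact k"
    by (simp add: abs_mult I_nonneg divide_right_mono)
qed

lemma beta_weight_abs_le: "\<bar>beta_weight m a b\<bar> \<le> 1"
  using beta_weight_nonneg[of m a b] beta_weight_le_1[OF m_nonneg, of a b] by simp

text \<open>Share of the net birth rate at \<open>y\<close>, integrated over time, in which
  \<open>ys\<close> are the surviving Gibbs points, \<open>b\<close> further points are new and
  \<open>k\<close> Gibbs points have died. \<open>I k (mset ys)\<close> stands for a birth at
  \<open>y\<close>, \<open>I k (add_mset y (mset ys))\<close> for the death of a Gibbs point there.
  The death rate 1 / (1 - t) lowers the exponent of 1 - t from \<open>length ys + 1\<close> to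
  \<open>length ys\<close>, which is why one weight serves both.\<close>

definition flow_term :: "nat \<Rightarrow> 'a list \<Rightarrow> 'a \<Rightarrow> nat \<Rightarrow> real" where
  "flow_term b ys y k = beta_weight m (length ys) (b + k) / fact k * (I k (mset ys) - I k (add_mset y (mset ys)))"

lemma flow_term_bounds: "0 \<le> flow_term b ys y k" "flow_term b ys y k \<le> m ^ k / fact k"
proof -
  let ?d = "I k (mset ys) - I k (add_mset y (mset ys))"
  have d: "0 \<le> ?d" "?d \<le> m ^ k"
    using I_add_le[of k y "mset ys"] I_le[of k "mset ys"] I_nonneg[of k "add_mset y (mset ys)"] by auto
  show "0 \<le> flow_term b ys y k"
    using d by (simp add: flow_term_def beta_weight_nonneg)
  have "beta_weight m (length ys) (b + k) * ?d \<le> 1 * m ^ k"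
    using d m_nonneg by (intro mult_mono) (auto simp: beta_weight_le_1)
  then show "flow_term b ys y k \<le> m ^ k / fact k"
    by (simp add: flow_term_def divide_right_mono)
qed

lemma summable_flow_term: "summable (flow_term b ys y)"
  by (rule summable_comparison_test'[OF summable_power_fact, of 0])
    (simp add: flow_term_bounds)

lemma flow_term_measurable: "(\<lambda>y. flow_term b ys y k) \<in> borel_measurable N"
  unfolding flow_term_def using I_measurable_add by measurable

text \<open>Termwise integration, dominated by the exponential series of \<open>m\<close>.
  Integrating \<open>y\<close> out turns \<open>I k\<close> of the enlarged configuration into
  \<open>I (Suc k)\<close>, the shift that telescopes later.\<close>

lemma integral_flow_term:
  "integrable N (\<lambda>y. \<Sum>k. flow_term b ys y k)"
  "m * (\<integral>y. (\<Sum>k. flow_term b ys y k) \<partial>N) =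
     (\<Sum>k. beta_weight m (length ys) (b + k) / fact k * (m * I k (mset ys) - I (Suc k) (mset ys)))"
proof -
  have int: "integrable N (\<lambda>y. flow_term b ys y k)" for k
    by (intro integrable_const_bound[where B="m ^ k / fact k"] flow_term_measurable AE_I2)
      (simp add: flow_term_bounds)
  have AE: "AE y in N. summable (\<lambda>k. norm (flow_term b ys y k))"
    by (simp add: flow_term_bounds summable_flow_term)
  have "(\<integral>y. norm (flow_term b ys y k) \<partial>N) \<le> m ^ k / fact k" for k
    by (intro integral_le_const AE_I2 integrable_norm int) (simp add: flow_term_bounds)
  then have sum: "summable (\<lambda>k. \<integral>y. norm (flow_term b ys y k) \<partial>N)"
    by (intro summable_comparison_test'[OF summable_power_fact, of 0]) simp
  show "integrable N (\<lambda>y. \<Sum>k. flow_term b ys y k)"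
    by (rule integrable_suminf[OF int AE sum])
  have eq: "m * (\<integral>y. flow_term b ys y k \<partial>N) =
      beta_weight m (length ys) (b + k) / fact k * (m * I k (mset ys) - I (Suc k) (mset ys))" for k
    unfolding flow_term_def
    by (subst integral_mult_right_zero, subst Bochner_Integration.integral_diff)
      (auto simp: I_integrable prob_space algebra_simps)
  show "m * (\<integral>y. (\<Sum>k. flow_term b ys y k) \<partial>N) =
     (\<Sum>k. beta_weight m (length ys) (b + k) / fact k * (m * I k (mset ys) - I (Suc k) (mset ys)))"
    using summable_integral[OF int AE sum]
    by (simp add: integral_suminf[OF int AE sum] suminf_mult[symmetric] eq del: correlation.simps)
qed

end

section \<open>The flow and its balance equation\<close>

text \<open>\<open>I_sums\<close> expresses that the Gibbs density \<open>C * g\<close> has total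
  mass one.\<close>

locale normalized_repulsive = repulsive +
  fixes C :: real
  assumes C_pos: "0 < C"
    and I_sums: "(\<lambda>k. correlation N m g k {#} / fact k) sums (1 / C)"
begin

text \<open>The mass that the deletion of \<open>y\<close> carries into \<open>xs\<close>, as a
  density with respect to \<open>m\<close> times \<open>N\<close>. The sum runs over the positions
  of \<open>xs\<close> that hold surviving Gibbs points; the others hold Poisson points.\<close>

definition flow :: "'a list \<Rightarrow> 'a \<Rightarrow> real" where
  "flow xs y = C * (\<Sum>ys\<leftarrow>List.subseqs xs. \<Sum>k. flow_term (length xs - length ys) ys y k)"

text \<open>Poisson density of \<open>xs\<close> plus the flow into \<open>xs\<close> from
  configurations with one more point: the density of visits to \<open>xs\<close> by the deletion
  chain.\<close>

definition intensity :: "'a list \<Rightarrow> real" where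
  "intensity xs = exp (- m) + m * (\<integral>y. flow xs y \<partial>N)"

lemma suminf_flow_term_nonneg: "0 \<le> (\<Sum>k. flow_term b ys y k)"
  by (intro suminf_nonneg summable_flow_term flow_term_bounds)

lemma flow_nonneg: "0 \<le> flow xs y"
  unfolding flow_def using C_pos
  by (intro mult_nonneg_nonneg sum_list_nonneg) (auto simp: suminf_flow_term_nonneg)

text \<open>Each of the \<open>2 ^ length xs\<close> sublists contributes at most
  \<open>exp m\<close>. The factorial in \<open>level_integral\<close> will absorb this exponential
  growth.\<close>

lemma flow_le: "flow xs y \<le> C * (2 ^ length xs * exp m)"
proof -
  have "(\<Sum>k. flow_term b ys y k) \<le> exp m" for b ys
    unfolding suminf_power_fact[symmetric]
    by (intro suminf_le summable_flow_term summable_power_fact flow_term_bounds)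
  then have "(\<Sum>ys\<leftarrow>List.subseqs xs. \<Sum>k. flow_term (length xs - length ys) ys y k) \<le>
    (\<Sum>ys\<leftarrow>List.subseqs xs. exp m)"
    by (intro sum_list_mono)
  also have "\<dots> = 2 ^ length xs * exp m"
    by (simp add: sum_list_triv length_subseqs)
  finally show ?thesis
    unfolding flow_def using C_pos by (intro mult_left_mono) auto
qed

text \<open>Point and list are packed into one list, deleted point first, so that measurability is
  joint in both.\<close>

lemma flow_measurable: "list_measurable N (\<lambda>zs. flow (tl zs) (hd zs)) borel"
  unfolding list_measurable_def
proof
  fix js :: "nat list"
  show "(\<lambda>s. flow (tl (map ((!!) s) js)) (hd (map ((!!) s) js))) \<in> borel_measurable (stream_space N)"
  proof (cases js)
    case (Cons j js')
    have "(\<lambda>s. I k (mset (map ((!!) s) ks))) \<in> borel_measurable (stream_space N)" for ks k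
      by (rule list_measurableD[OF I_measurable])
    moreover have "(\<lambda>s. I k (add_mset (s !! j) (mset (map ((!!) s) ks)))) \<in> borel_measurable (stream_space N)" for ks k
      using list_measurableD[OF I_measurable, of k "j # ks"] by simp
    ultimately show ?thesis
      unfolding Cons flow_def flow_term_def list.map list.sel subseqs_map map_map o_def length_map
      by (intro borel_measurable_times borel_measurable_const borel_measurable_sum_list
          borel_measurable_suminf borel_measurable_diff)
  qed simp
qed

lemma flow_integrable: "integrable N (flow xs)"
  unfolding flow_def by (intro integrable_mult_right integral_sum_list integral_flow_term)

lemma intensity_pos: "0 < intensity xs"
  unfolding intensity_def using m_nonneg
  by (intro add_pos_nonneg mult_nonneg_nonneg Bochner_Integration.integral_nonneg) (auto simp: flow_nonneg)

lemma intensity_measurable: "list_measurable N intensity borel"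
proof -
  have "list_measurable N (\<lambda>xs. \<integral>y. flow xs y \<partial>N) borel"
    using list_measurable_integral[OF flow_measurable] by simp
  then show ?thesis
    unfolding intensity_def by (rule list_measurable_compose) simp
qed

text \<open>Share of the sublist \<open>ys\<close> in the total flow out of a list with
  \<open>b\<close> positions outside \<open>ys\<close>: deleting one of those gives the first sum,
  deleting an entry of \<open>ys\<close> itself the second.\<close>

definition outflow_sum :: "'a list \<Rightarrow> nat \<Rightarrow> real" where
  "outflow_sum ys b =
     real b * (\<Sum>k. beta_weight m (length ys) (b - 1 + k) / fact k * I k (mset ys)) -
     real (length ys) * (\<Sum>k. beta_weight m (length ys - 1) (b + k) / fact k * I k (mset ys))"

lemma summable_beta_I: "summable (\<lambda>k. beta_weight m a (b + k) / fact k * I k \<phi>)"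
  by (rule summable_weighted_I) (rule beta_weight_abs_le)

text \<open>Integrating by parts in the beta weights makes the sum over \<open>k\<close> telescope.\<close>

lemma inflow_minus_outflow:
  "(\<Sum>k. beta_weight m (length ys) (b + k) / fact k * (m * I k (mset ys) - I (Suc k) (mset ys))) - outflow_sum ys b =
     (if b = 0 then I 0 (mset ys) else 0) - (if length ys = 0 then exp (- m) * (\<Sum>k. I k (mset ys) / fact k) else 0)"
proof -
  define a i where "a = length ys" and "i k = I k (mset ys)" for k
  define w where "w = beta_weight m"
  have sI: "summable (\<lambda>k. i k / fact k)"
    unfolding i_def using summable_weighted_I[of "\<lambda>_. 1" "mset ys"] by simp
  have s: "summable (\<lambda>k. w a (b + k) / fact k * i k)" for a b
    unfolding w_def i_def by (rule summable_beta_I)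
  \<comment> \<open>The recurrence has the factor \<open>real (b + k)\<close>. Its part
    \<open>b\<close> cancels against the outflow; its part \<open>k\<close> is \<open>e k\<close>,
    which telescopes against the term with \<open>I (Suc k)\<close>. At \<open>k = 0\<close> the
    factor \<open>real k\<close> makes the truncated index harmless.\<close>
  define e where "e k = real k / fact k * w a (b + k - 1) * i k" for k
  \<comment> \<open>The boundary values of the integration by parts: at t = 0 only
    \<open>b = k = 0\<close> contributes, at t = 1 every \<open>k\<close> when
    \<open>a = 0\<close>.\<close>
  define d where "d k = (if k = 0 then (if b = 0 then i 0 else 0) else 0) -
    (if a = 0 then exp (- m) else 0) * (i k / fact k)" for k
  have e_Suc: "e (Suc k) = w a (b + k) / fact k * i (Suc k)" for k
  proof -
    have "real (Suc k) / fact (Suc k) = (1 / fact k :: real)" by (simp add: divide_simps)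
    then show ?thesis by (simp add: e_def)
  qed
  have "summable (\<lambda>k. e (Suc k))"
  proof (rule summable_comparison_test'[of "\<lambda>k. m * (m ^ k / fact k)" 0])
    fix k
    have "w a (b + k) * i (Suc k) \<le> 1 * m ^ Suc k"
      unfolding w_def i_def using m_nonneg
      by (intro mult_mono I_le) (auto simp: beta_weight_le_1 I_nonneg simp del: correlation.simps)
    then show "norm (e (Suc k)) \<le> m * (m ^ k / fact k)"
      unfolding e_Suc using divide_right_mono[of _ _ "fact k :: real"]
      by (simp add: w_def i_def beta_weight_nonneg I_nonneg abs_mult del: correlation.simps)
  qed (intro summable_mult summable_power_fact)
  then have "(\<lambda>k. e (Suc k)) \<longlonglongrightarrow> 0" by (rule summable_LIMSEQ_zero)
  then have "e \<longlonglongrightarrow> 0" by (simp only: filterlim_sequentially_Suc)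
  from telescope_sums'[OF this] have e_sums: "(\<lambda>k. e k - e (Suc k)) sums 0"
    by (simp add: e_def)
  have d_sums: "d sums ((if b = 0 then i 0 else 0) - (if a = 0 then exp (- m) else 0) * (\<Sum>k. i k / fact k))"
    unfolding d_def
    by (intro sums_diff sums_mult summable_sums sI sums_single)
  have split: "w a (b + k) / fact k * (m * i k - i (Suc k)) -
      (real b * (w a (b - 1 + k) / fact k * i k) - real a * (w (a - 1) (b + k) / fact k * i k)) =
      d k + (e k - e (Suc k))" for k
  proof -
    have rec: "m * w a (b + k) = (if b + k = 0 then 1 else 0) - (if a = 0 then exp (- m) else 0)
       + real (b + k) * w a (b + k - 1) - real a * w (a - 1) (b + k)"
      unfolding w_def by (rule beta_weight_recurrence)
    have b: "real b * w a (b - 1 + k) = real b * w a (b + k - 1)"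
      by (cases b) auto
    have "w a (b + k) / fact k * (m * i k - i (Suc k)) = m * w a (b + k) / fact k * i k - e (Suc k)"
      unfolding e_Suc by (simp add: algebra_simps diff_divide_distrib)
    also have "m * w a (b + k) / fact k * i k = d k + e k +
       (real b * w a (b - 1 + k) - real a * w (a - 1) (b + k)) / fact k * i k"
      unfolding rec b by (auto simp: d_def e_def field_simps)
    finally show ?thesis by (simp add: diff_divide_distrib left_diff_distrib)
  qed
  have out: "(\<lambda>k. real b * (w a (b - 1 + k) / fact k * i k) - real a * (w (a - 1) (b + k) / fact k * i k))
     sums outflow_sum ys b"
    unfolding outflow_sum_def a_def[symmetric] w_def[symmetric] i_def[symmetric]
    by (intro sums_diff sums_mult summable_sums s)
  have "(\<lambda>k. w a (b + k) / fact k * (m * i k - i (Suc k))) sums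
     ((if b = 0 then i 0 else 0) - (if a = 0 then exp (- m) else 0) * (\<Sum>k. i k / fact k) + 0 + outflow_sum ys b)"
    using sums_add[OF sums_add[OF d_sums e_sums] out] by (simp add: split[symmetric])
  then have "(\<Sum>k. w a (b + k) / fact k * (m * i k - i (Suc k))) - outflow_sum ys b =
     (if b = 0 then i 0 else 0) - (if a = 0 then exp (- m) * (\<Sum>k. i k / fact k) else 0)"
    by (cases "a = 0") (simp_all add: sums_iff)
  then show ?thesis
    unfolding w_def a_def i_def .
qed

text \<open>The birth terms \<open>f\<close> depend on the remaining sublist and are regrouped by
  omitted positions, the death terms \<open>h\<close> on the sublist with the deleted point put
  back.\<close>

lemma sum_flow_remove_nth:
  "(\<Sum>i<length xs. flow (remove_nth i xs) (xs ! i)) =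
    C * (\<Sum>ys\<leftarrow>List.subseqs xs. outflow_sum ys (length xs - length ys))"
proof -
  let ?n = "length xs"
  define f where "f ys = (\<Sum>k. beta_weight m (length ys) (?n - 1 - length ys + k) / fact k * I k (mset ys))" for ys
  \<comment> \<open>This multiset already contains the deleted point, hence
    \<open>size \<phi> - 1\<close> in the weight.\<close>
  define h where "h \<phi> = (\<Sum>k. beta_weight m (size \<phi> - 1) (?n - size \<phi> + k) / fact k * I k \<phi>)" for \<phi>
  have diff: "(\<Sum>k. flow_term b ys y k) = (\<Sum>k. beta_weight m (length ys) (b + k) / fact k * I k (mset ys)) -
      (\<Sum>k. beta_weight m (length ys) (b + k) / fact k * I k (add_mset y (mset ys)))" for b ys y
    unfolding flow_term_def right_diff_distrib
    by (rule suminf_diff[OF summable_beta_I summable_beta_I, symmetric])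
  have "flow (remove_nth i xs) (xs ! i) =
    C * (\<Sum>ys\<leftarrow>List.subseqs (remove_nth i xs). f ys - h (add_mset (xs ! i) (mset ys)))" if "i < ?n" for i
    unfolding flow_def f_def h_def diff using that by (simp add: length_remove_nth)
  then have "(\<Sum>i<?n. flow (remove_nth i xs) (xs ! i)) =
    C * ((\<Sum>i<?n. \<Sum>ys\<leftarrow>List.subseqs (remove_nth i xs). f ys) -
      (\<Sum>i<?n. \<Sum>ys\<leftarrow>List.subseqs (remove_nth i xs). h (add_mset (xs ! i) (mset ys))))"
    by (simp add: sum_distrib_left sum_list_subtractf sum_subtractf right_diff_distrib)
  also have "\<dots> = C * ((\<Sum>ys\<leftarrow>List.subseqs xs. real (?n - length ys) * f ys) -
      (\<Sum>ys\<leftarrow>List.subseqs xs. real (length ys) * h (mset ys)))"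
    unfolding sum_subseqs_remove sum_subseqs_reinsert ..
  also have "\<dots> = C * (\<Sum>ys\<leftarrow>List.subseqs xs. outflow_sum ys (?n - length ys))"
    unfolding sum_list_subtractf[symmetric] f_def h_def outflow_sum_def
    by (simp add: diff_commute)
  finally show ?thesis .
qed

text \<open>Kirchhoff's law at \<open>xs\<close>. Only boundary terms remain after summation by
  parts: at t = 0 they single out the full sublist, which yields the Gibbs density, and at t = 1 the
  empty one, which yields \<open>exp (- m)\<close> because the series in \<open>I_sums\<close> has
  the value 1 / \<open>C\<close>.\<close>

lemma intensity_balance:
  "intensity xs = C * g (mset xs) + (\<Sum>i<length xs. flow (remove_nth i xs) (xs ! i))"
proof -
  let ?n = "length xs"
  define X where "X ys = (\<Sum>k. beta_weight m (length ys) (?n - length ys + k) / fact k *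
    (m * I k (mset ys) - I (Suc k) (mset ys)))" for ys :: "'a list"
  have "m * (\<integral>y. flow xs y \<partial>N) = C * (\<Sum>ys\<leftarrow>List.subseqs xs. X ys)"
    unfolding flow_def X_def integral_flow_term(2)[symmetric] sum_list_const_mult
    by (simp add: integral_sum_list(2)[OF integral_flow_term(1)])
  then have "m * (\<integral>y. flow xs y \<partial>N) - (\<Sum>i<length xs. flow (remove_nth i xs) (xs ! i)) =
    C * (\<Sum>ys\<leftarrow>List.subseqs xs. X ys - outflow_sum ys (?n - length ys))"
    by (simp add: sum_flow_remove_nth sum_list_subtractf right_diff_distrib)
  also have "\<dots> = C * ((\<Sum>ys\<leftarrow>List.subseqs xs. if ?n - length ys = 0 then I 0 (mset ys) else 0) -
     (\<Sum>ys\<leftarrow>List.subseqs xs. if length ys = 0 then exp (- m) * (\<Sum>k. I k (mset ys) / fact k) else 0))"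
    unfolding X_def inflow_minus_outflow sum_list_subtractf ..
  also have "\<dots> = C * g (mset xs) - exp (- m)"
    unfolding sum_subseqs_full sum_subseqs_Nil using sums_unique[OF I_sums] C_pos
    by (simp add: field_simps)
  finally show ?thesis by (simp add: intensity_def)
qed

end

section \<open>The deletion chain\<close>

text \<open>Splits a path into its first step and the rest, for the first step analysis of the
  chain.\<close>

lemma nn_integral_count_space_list:
  fixes F :: "nat list \<Rightarrow> ennreal"
  shows "(\<integral>\<^sup>+p. F p \<partial>count_space UNIV) =
    F [] + (\<integral>\<^sup>+i. \<integral>\<^sup>+p. F (i # p) \<partial>count_space UNIV \<partial>count_space UNIV)"
proof -
  let ?R = "range (\<lambda>(i, p). i # p) :: nat list set"
  have bij: "bij_betw (\<lambda>(i, p). i # p) UNIV ?R"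
    by (auto simp: bij_betw_def inj_on_def)
  have "(\<integral>\<^sup>+p. F p \<partial>count_space UNIV) =
    (\<integral>\<^sup>+p. F p * indicator {[]} p + F p * indicator ?R p \<partial>count_space UNIV)"
  proof (rule nn_integral_cong)
    fix p show "F p = F p * indicator {[]} p + F p * indicator ?R p"
      by (cases p) (auto simp: image_iff)
  qed
  also have "\<dots> = (\<integral>\<^sup>+p. F p * indicator {[]} p \<partial>count_space UNIV) +
      (\<integral>\<^sup>+p. F p * indicator ?R p \<partial>count_space UNIV)"
    by (rule nn_integral_add) auto
  also have "(\<integral>\<^sup>+p. F p * indicator {[]} p \<partial>count_space UNIV) = F []"
    by (simp add: nn_integral_count_space_indicator[symmetric] nn_integral_count_space_finite)
  also have "(\<integral>\<^sup>+p. F p * indicator ?R p \<partial>count_space UNIV) = (\<integral>\<^sup>+p. F p \<partial>count_space ?R)"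
    by (simp add: nn_integral_count_space_indicator)
  also have "\<dots> = (\<integral>\<^sup>+x. F (case x of (i, p) \<Rightarrow> i # p) \<partial>count_space UNIV)"
    by (rule nn_integral_bij_count_space[OF bij, symmetric])
  also have "\<dots> = (\<integral>\<^sup>+i. \<integral>\<^sup>+p. F (i # p) \<partial>count_space UNIV \<partial>count_space UNIV)"
    by (subst nn_integral_fst_count_space[symmetric]) simp
  finally show ?thesis .
qed

primrec delete_path :: "nat list \<Rightarrow> 'a list \<Rightarrow> 'a list" where
  "delete_path [] xs = xs"
| "delete_path (i # p) xs = delete_path p (remove_nth i xs)"

lemma delete_path_map: "delete_path p (map f xs) = map f (delete_path p xs)"
  by (induction p arbitrary: xs) (simp_all add: remove_nth_map)

lemma list_measurable_delete_path:
  "list_measurable N F K \<Longrightarrow> list_measurable N (\<lambda>xs. F (delete_path p xs)) K"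
  unfolding list_measurable_def delete_path_map by blast

lemma list_measurable_divide:
  fixes F G :: "'a list \<Rightarrow> real"
  assumes "list_measurable N F borel" "list_measurable N G borel"
  shows "list_measurable N (\<lambda>xs. F xs / G xs) borel"
  using assms unfolding list_measurable_def by (auto intro: borel_measurable_divide)

lemma list_measurable_ennreal_mult:
  fixes F :: "'a list \<Rightarrow> real" and G :: "'a list \<Rightarrow> ennreal"
  assumes F: "list_measurable N F borel" and G: "list_measurable N G borel"
  shows "list_measurable N (\<lambda>xs. ennreal (F xs) * G xs) borel"
  unfolding list_measurable_def
proof
  fix js
  note [measurable] = list_measurableD[OF F, of js] list_measurableD[OF G, of js]
  show "(\<lambda>s. ennreal (F (map ((!!) s) js)) * G (map ((!!) s) js)) \<in> borel_measurable (stream_space N)"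
    by measurable
qed

context normalized_repulsive
begin

lemma Cg_measurable: "list_measurable N (\<lambda>xs. C * g (mset xs)) borel"
  by (rule list_measurable_compose[OF g_measurable]) simp

lemma inflow_measurable: "list_measurable N (\<lambda>xs. m * (\<integral>y. flow xs y \<partial>N)) borel"
  using list_measurable_compose[OF list_measurable_integral[OF flow_measurable], of "\<lambda>x. m * x"] by simp

text \<open>The Markov chain on finite configurations that keeps its state \<open>xs\<close> with probability
  \<open>C * g (mset xs) / intensity xs\<close> and otherwise deletes one of the points; a path lists the
  positions of the deleted points.\<close>

primrec path_weight :: "nat list \<Rightarrow> 'a list \<Rightarrow> real" where
  "path_weight [] xs = C * g (mset xs) / intensity xs"
| "path_weight (i # p) xs = (if i < length xs
     then flow (remove_nth i xs) (xs ! i) / intensity xs * path_weight p (remove_nth i xs) else 0)"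

lemma path_weight_measurable: "list_measurable N (path_weight p) borel"
proof (induction p)
  case Nil
  show ?case
    unfolding path_weight.simps
    by (rule list_measurable_divide[OF Cg_measurable intensity_measurable])
next
  case (Cons i p)
  show ?case
    unfolding list_measurable_def
  proof
    fix js
    have [measurable]: "(\<lambda>s. intensity (map ((!!) s) js)) \<in> borel_measurable (stream_space N)"
      "(\<lambda>s. path_weight p (map ((!!) s) (remove_nth i js))) \<in> borel_measurable (stream_space N)"
      "(\<lambda>s. flow (map ((!!) s) (remove_nth i js)) (s !! (js ! i))) \<in> borel_measurable (stream_space N)"
      using list_measurableD[OF intensity_measurable, of js] list_measurableD[OF Cons, of "remove_nth i js"]
        list_measurableD[OF flow_measurable, of "js ! i # remove_nth i js"] by simp_all
    show "(\<lambda>s. path_weight (i # p) (map ((!!) s) js)) \<in> borel_measurable (stream_space N)"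
      by (cases "i < length js") (simp_all add: remove_nth_map)
  qed
qed

text \<open>Expectation over the paths from \<open>xs\<close> of a quantity that may depend on the
  path itself; \<open>chain\<close> is the case that sees only the end point.\<close>

definition path_mean :: "(nat list \<Rightarrow> 'a list \<Rightarrow> ennreal) \<Rightarrow> 'a list \<Rightarrow> ennreal" where
  "path_mean h xs = (\<integral>\<^sup>+p. ennreal (path_weight p xs) * h p xs \<partial>count_space UNIV)"

definition chain :: "('a list \<Rightarrow> ennreal) \<Rightarrow> 'a list \<Rightarrow> ennreal" where
  "chain f xs = (\<integral>\<^sup>+p. ennreal (path_weight p xs) * f (delete_path p xs) \<partial>count_space UNIV)"

text \<open>There are countably many paths, so joint measurability in path and stream follows from
  measurability for each path.\<close>

lemma path_mean_measurable:
  assumes h: "\<And>p. list_measurable N (h p) borel"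
  shows "list_measurable N (path_mean h) borel"
  unfolding list_measurable_def
proof
  fix js
  interpret cs: sigma_finite_measure "count_space (UNIV :: nat list set)"
    by (rule sigma_finite_measure_count_space)
  have "(\<lambda>x. ennreal (path_weight (fst x) (map ((!!) (snd x)) js)) * h (fst x) (map ((!!) (snd x)) js))
      \<in> borel_measurable (count_space UNIV \<Otimes>\<^sub>M stream_space N)"
    using list_measurableD[OF list_measurable_ennreal_mult[OF path_weight_measurable h]]
    by (intro measurable_pair_measure_countable1) simp_all
  then have "(\<lambda>(s, p). ennreal (path_weight p (map ((!!) s) js)) * h p (map ((!!) s) js))
      \<in> borel_measurable (stream_space N \<Otimes>\<^sub>M count_space UNIV)"
    by (subst (asm) measurable_pair_swap_iff) (simp add: case_prod_unfold)
  then show "(\<lambda>s. path_mean h (map ((!!) s) js)) \<in> borel_measurable (stream_space N)"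
    unfolding path_mean_def by (rule cs.borel_measurable_nn_integral)
qed

lemma chain_conv_path_mean: "chain f = path_mean (\<lambda>p xs. f (delete_path p xs))"
  by (simp add: fun_eq_iff chain_def path_mean_def)

lemma chain_measurable: "list_measurable N f borel \<Longrightarrow> list_measurable N (chain f) borel"
  unfolding chain_conv_path_mean by (intro path_mean_measurable list_measurable_delete_path)

text \<open>First step analysis. Paths starting with an index outside \<open>xs\<close> have weight
  zero, so the sum over first steps is finite.\<close>

lemma chain_rec:
  "chain f xs = ennreal (C * g (mset xs) / intensity xs) * f xs +
    (\<Sum>i<length xs. ennreal (flow (remove_nth i xs) (xs ! i) / intensity xs) * chain f (remove_nth i xs))"
proof -
  define h where "h i = (\<integral>\<^sup>+p. ennreal (path_weight (i # p) xs) * f (delete_path (i # p) xs) \<partial>count_space UNIV)" for i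
  have h: "h i = (if i < length xs then ennreal (flow (remove_nth i xs) (xs ! i) / intensity xs) *
    chain f (remove_nth i xs) else 0)" for i
  proof (cases "i < length xs")
    case True
    have "0 \<le> flow (remove_nth i xs) (xs ! i) / intensity xs"
      by (simp add: flow_nonneg intensity_pos less_imp_le)
    from ennreal_mult'[OF this] True show ?thesis
      unfolding h_def chain_def path_weight.simps delete_path.simps
      by (simp only: if_True mult.assoc nn_integral_cmult borel_measurable_count_space)
  qed (simp add: h_def)
  have "chain f xs = ennreal (C * g (mset xs) / intensity xs) * f xs + (\<integral>\<^sup>+i. h i \<partial>count_space UNIV)"
    unfolding chain_def h_def by (subst nn_integral_count_space_list) simp
  also have "(\<integral>\<^sup>+i. h i \<partial>count_space UNIV) = (\<Sum>i<length xs. h i)"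
    by (rule nn_integral_count_space') (auto simp: h)
  finally show ?thesis by (simp add: h)
qed

text \<open>Clearing the denominators replaces transition probabilities by flows, which can be
  integrated over \<open>xs\<close>.\<close>

lemma chain_intensity:
  "ennreal (intensity xs) * chain f xs = ennreal (C * g (mset xs)) * f xs +
    (\<Sum>i<length xs. ennreal (flow (remove_nth i xs) (xs ! i)) * chain f (remove_nth i xs))"
proof -
  have "ennreal (intensity xs) * ennreal (r / intensity xs) = ennreal r" if "0 \<le> r" for r
    using intensity_pos[of xs] that by (simp add: ennreal_mult[symmetric])
  then show ?thesis
    using C_pos by (subst chain_rec)
      (simp add: distrib_left sum_distrib_left mult.assoc[symmetric] g_nonneg flow_nonneg)
qed

text \<open>Every path of nonzero weight ends after at most \<open>length xs\<close> deletions, and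
  at each state the balance equation makes the transition probabilities add up to one.\<close>

lemma chain_1: "chain (\<lambda>_. 1) xs = 1"
proof (induction "length xs" arbitrary: xs)
  case 0
  then show ?case
    using intensity_balance[of xs, symmetric] intensity_pos[of xs] by (subst chain_rec) simp
next
  case (Suc n)
  have "chain (\<lambda>_. 1) xs = ennreal (C * g (mset xs) / intensity xs) +
      (\<Sum>i<length xs. ennreal (flow (remove_nth i xs) (xs ! i) / intensity xs))"
    using Suc.hyps by (subst chain_rec) (simp add: length_remove_nth)
  also have "\<dots> = ennreal (C * g (mset xs) / intensity xs +
      (\<Sum>i<length xs. flow (remove_nth i xs) (xs ! i) / intensity xs))"
    using C_pos intensity_pos[of xs]
    by (subst ennreal_plus) (auto simp: g_nonneg flow_nonneg sum_nonneg less_imp_le sum_ennreal)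
  also have "C * g (mset xs) / intensity xs + (\<Sum>i<length xs. flow (remove_nth i xs) (xs ! i) / intensity xs) = 1"
    using intensity_balance[of xs] intensity_pos[of xs]
    by (simp add: sum_divide_distrib[symmetric] add_divide_distrib[symmetric])
  finally show ?case by simp
qed

lemma chain_mono: "(\<And>p. path_weight p xs \<noteq> 0 \<Longrightarrow> f (delete_path p xs) \<le> h (delete_path p xs)) \<Longrightarrow> chain f xs \<le> chain h xs"
  unfolding chain_def
proof (intro nn_integral_mono)
  fix p assume le: "\<And>p. path_weight p xs \<noteq> 0 \<Longrightarrow> f (delete_path p xs) \<le> h (delete_path p xs)"
  show "ennreal (path_weight p xs) * f (delete_path p xs) \<le> ennreal (path_weight p xs) * h (delete_path p xs)"
    using le[of p] by (cases "path_weight p xs = 0") (simp_all add: mult_left_mono)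
qed

lemma path_weight_length: "path_weight p xs \<noteq> 0 \<Longrightarrow> length p + length (delete_path p xs) = length xs"
proof (induction p arbitrary: xs)
  case (Cons i p)
  then have "i < length xs" "path_weight p (remove_nth i xs) \<noteq> 0" by (auto split: if_splits)
  with Cons.IH[of "remove_nth i xs"] show ?case by (auto simp: length_remove_nth)
qed simp

lemma chain_cmult_1: "chain (\<lambda>_. c) xs = c"
  using chain_1[of xs] unfolding chain_def by (simp add: nn_integral_multc)

section \<open>The image of the Poisson process under the chain\<close>

abbreviation "level \<equiv> level_integral N m"

lemma level_add:
  assumes "list_measurable N f borel" "list_measurable N h borel"
  shows "level n (\<lambda>xs. f xs + h xs) = level n f + level n h"
  unfolding level_integral_def
  by (simp add: nn_integral_add list_measurable_stake assms distrib_left)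

lemma level_mono: "(\<And>xs. length xs = n \<Longrightarrow> f xs \<le> h xs) \<Longrightarrow> level n f \<le> level n h"
  unfolding level_integral_def by (intro mult_left_mono nn_integral_mono) auto

lemma level_const: "level n (\<lambda>_. c) = ennreal (m ^ n / fact n) * c"
  by (simp add: level_integral_def stream.emeasure_space_1)

text \<open>Exchangeability moves each of the n + 1 possible deletions to the front, and the factor
  n + 1 turns m^(n + 1) / (n + 1)! into m times m^n / n!. What level n + 1 sends down is thus what
  level n receives.\<close>

lemma level_Suc_chain:
  assumes f: "list_measurable N f borel"
  shows "level (Suc n) (\<lambda>xs. ennreal (intensity xs) * chain f xs) =
    level (Suc n) (\<lambda>xs. ennreal (C * g (mset xs)) * f xs) +
    level n (\<lambda>xs. ennreal (m * (\<integral>y. flow xs y \<partial>N)) * chain f xs)"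
proof -
  \<comment> \<open>The head is the deleted point, the tail the configuration reached.\<close>
  define F where "F zs = ennreal (flow (tl zs) (hd zs)) * chain f (tl zs)" for zs
  have F: "list_measurable N F borel"
    unfolding F_def
    by (rule list_measurable_ennreal_mult[OF flow_measurable list_measurable_tl[OF chain_measurable[OF f]]])
  have F_move: "(\<lambda>s. F (stake (Suc n) s ! i # remove_nth i (stake (Suc n) s))) \<in> borel_measurable (stream_space N)"
    if "i < Suc n" for i
    using list_measurableD[OF F, of "[0..<Suc n] ! i # remove_nth i [0..<Suc n]"] that
    unfolding stake_conv_map_snth remove_nth_map by (simp del: upt_Suc)
  have [measurable]: "(\<lambda>s. ennreal (C * g (mset (stake (Suc n) s))) * f (stake (Suc n) s)) \<in> borel_measurable (stream_space N)"
    by (rule list_measurable_stake[OF list_measurable_ennreal_mult[OF Cg_measurable f]])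
  have "(\<integral>\<^sup>+s. ennreal (intensity (stake (Suc n) s)) * chain f (stake (Suc n) s) \<partial>stream_space N) =
    (\<integral>\<^sup>+s. ennreal (C * g (mset (stake (Suc n) s))) * f (stake (Suc n) s) +
       (\<Sum>i<Suc n. F (stake (Suc n) s ! i # remove_nth i (stake (Suc n) s))) \<partial>stream_space N)"
    unfolding chain_intensity F_def by (simp del: stake.simps sum.lessThan_Suc)
  also have "\<dots> = (\<integral>\<^sup>+s. ennreal (C * g (mset (stake (Suc n) s))) * f (stake (Suc n) s) \<partial>stream_space N) +
    (\<Sum>i<Suc n. \<integral>\<^sup>+s. F (stake (Suc n) s ! i # remove_nth i (stake (Suc n) s)) \<partial>stream_space N)"
    using F_move
    by (subst nn_integral_add, simp del: stake.simps, intro borel_measurable_sum, simp del: stake.simps,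
        subst nn_integral_sum) (simp_all del: stake.simps sum.lessThan_Suc)
  also have "(\<Sum>i<Suc n. \<integral>\<^sup>+s. F (stake (Suc n) s ! i # remove_nth i (stake (Suc n) s)) \<partial>stream_space N) =
    of_nat (Suc n) * (\<integral>\<^sup>+s. F (stake (Suc n) s) \<partial>stream_space N)"
    using nn_integral_move_front[OF F, of _ n] by (simp del: stake.simps sum.lessThan_Suc)
  also have "(\<integral>\<^sup>+s. F (stake (Suc n) s) \<partial>stream_space N) =
    (\<integral>\<^sup>+s. ennreal (\<integral>y. flow (stake n s) y \<partial>N) * chain f (stake n s) \<partial>stream_space N)"
  proof -
    have "(\<lambda>y. flow xs y) \<in> borel_measurable N" for xs
      using flow_integrable by blast
    then have "(\<integral>\<^sup>+y. F (y # xs) \<partial>N) = ennreal (\<integral>y. flow xs y \<partial>N) * chain f xs" for xs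
      unfolding F_def
      by (simp add: nn_integral_multc nn_integral_eq_integral[OF flow_integrable] flow_nonneg)
    then show ?thesis
      by (simp add: nn_integral_stake_Suc'[OF F] del: stake.simps)
  qed
  finally have "level (Suc n) (\<lambda>xs. ennreal (intensity xs) * chain f xs) =
    level (Suc n) (\<lambda>xs. ennreal (C * g (mset xs)) * f xs) +
    ennreal (m ^ Suc n / fact (Suc n)) * of_nat (Suc n) *
     (\<integral>\<^sup>+s. ennreal (\<integral>y. flow (stake n s) y \<partial>N) * chain f (stake n s) \<partial>stream_space N)"
    unfolding level_integral_def by (simp only: distrib_left mult.assoc)
  also have "ennreal (m ^ Suc n / fact (Suc n)) * of_nat (Suc n) = ennreal (m ^ n / fact n) * ennreal m"
  proof -
    have "m ^ Suc n / fact (Suc n) * real (Suc n) = m ^ n / fact n * m"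
      by (simp add: divide_simps)
    then show ?thesis
      using m_nonneg unfolding ennreal_of_nat_eq_real_of_nat
      by (simp only: ennreal_mult[symmetric] zero_le_power fact_ge_zero divide_nonneg_nonneg of_nat_0_le_iff)
  qed
  also have "\<dots> * (\<integral>\<^sup>+s. ennreal (\<integral>y. flow (stake n s) y \<partial>N) * chain f (stake n s) \<partial>stream_space N) =
    level n (\<lambda>xs. ennreal (m * (\<integral>y. flow xs y \<partial>N)) * chain f xs)"
  proof -
    have "list_measurable N (\<lambda>xs. \<integral>y. flow xs y \<partial>N) borel"
      using list_measurable_integral[OF flow_measurable] by simp
    then have "(\<lambda>s. ennreal (\<integral>y. flow (stake n s) y \<partial>N) * chain f (stake n s)) \<in> borel_measurable (stream_space N)"
      by (rule list_measurable_stake[OF list_measurable_ennreal_mult[OF _ chain_measurable[OF f]]])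
    then show ?thesis
      using m_nonneg unfolding level_integral_def
      by (simp add: ennreal_mult' mult.assoc nn_integral_cmult)
  qed
  finally show ?thesis .
qed

text \<open>Write A, B and V for the Poisson, Gibbs and flux terms. Then A n + V n = B n + V (n -
  1), without the last term for n = 0, and the fluxes telescope to V k, which enters level k from
  above.\<close>

lemma chain_partial_sums:
  assumes f: "list_measurable N f borel"
  shows "(\<Sum>n<Suc k. level n (\<lambda>xs. ennreal (exp (- m)) * chain f xs)) +
      level k (\<lambda>xs. ennreal (m * (\<integral>y. flow xs y \<partial>N)) * chain f xs) =
    (\<Sum>n<Suc k. level n (\<lambda>xs. ennreal (C * g (mset xs)) * f xs))"
proof (induction k)
  let ?A = "\<lambda>n. level n (\<lambda>xs. ennreal (exp (- m)) * chain f xs)"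
  let ?V = "\<lambda>n. level n (\<lambda>xs. ennreal (m * (\<integral>y. flow xs y \<partial>N)) * chain f xs)"
  have A_V: "?A n + ?V n = level n (\<lambda>xs. ennreal (intensity xs) * chain f xs)" for n
  proof -
    have "list_measurable N (\<lambda>xs. ennreal (exp (- m)) * chain f xs) borel"
      by (rule list_measurable_ennreal_mult[OF _ chain_measurable[OF f]]) (simp add: list_measurable_def)
    note add = level_add[OF this list_measurable_ennreal_mult[OF inflow_measurable chain_measurable[OF f]]]
    have "0 \<le> m * (\<integral>y. flow xs y \<partial>N)" for xs
      using m_nonneg by (intro mult_nonneg_nonneg Bochner_Integration.integral_nonneg) (auto simp: flow_nonneg)
    then show ?thesis
      unfolding add[symmetric] intensity_def by (simp add: ennreal_plus distrib_right)
  qed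
  {
    case 0
    show ?case
      using A_V[of 0] by (simp add: level_integral_def chain_intensity)
  next
    case (Suc k)
    have "(\<Sum>n<Suc (Suc k). ?A n) + ?V (Suc k) = (\<Sum>n<Suc k. ?A n) + (?A (Suc k) + ?V (Suc k))"
      by (simp only: sum.lessThan_Suc[of ?A "Suc k"] add.assoc)
    also have "\<dots> = ((\<Sum>n<Suc k. ?A n) + ?V k) + level (Suc k) (\<lambda>xs. ennreal (C * g (mset xs)) * f xs)"
      unfolding A_V level_Suc_chain[OF f] by (simp only: add_ac)
    finally show ?case
      unfolding Suc.IH by (simp only: sum.lessThan_Suc)
  }
qed

text \<open>The flux is at most a constant times (k + 1) (2m)^k / k!. The bound on \<open>f\<close>
  admits indicator functions as well as the number of points.\<close>

lemma remainder_tendsto_0: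
  assumes f: "\<And>xs. f xs \<le> of_nat (Suc (length xs))"
  shows "(\<lambda>k. level k (\<lambda>xs. ennreal (m * (\<integral>y. flow xs y \<partial>N)) * chain f xs)) \<longlonglongrightarrow> 0"
proof (rule tendsto_sandwich[OF _ _ tendsto_const])
  have "level k (\<lambda>xs. ennreal (m * (\<integral>y. flow xs y \<partial>N)) * chain f xs) \<le>
    ennreal (C * m * exp m * (real (Suc k) * ((2 * m) ^ k / fact k)))" for k
  proof -
    have "ennreal (m * (\<integral>y. flow xs y \<partial>N)) * chain f xs \<le>
      ennreal (m * (C * (2 ^ k * exp m))) * ennreal (real (Suc k))" if "length xs = k" for xs
    proof (rule mult_mono)
      have "(\<integral>y. flow xs y \<partial>N) \<le> C * (2 ^ k * exp m)"
        unfolding that[symmetric]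
        by (intro integral_le_const flow_integrable AE_I2 flow_le)
      then show "ennreal (m * (\<integral>y. flow xs y \<partial>N)) \<le> ennreal (m * (C * (2 ^ k * exp m)))"
        using m_nonneg by (intro ennreal_leI mult_left_mono)
      have "chain f xs \<le> chain (\<lambda>_. ennreal (real (Suc k))) xs"
      proof (rule chain_mono)
        fix p assume "path_weight p xs \<noteq> 0"
        from path_weight_length[OF this] have "length (delete_path p xs) \<le> k" using that by simp
        then show "f (delete_path p xs) \<le> ennreal (real (Suc k))"
          by (intro order_trans[OF f]) (simp add: ennreal_of_nat_eq_real_of_nat del: of_nat_Suc)
      qed
      then show "chain f xs \<le> ennreal (real (Suc k))" by (simp add: chain_cmult_1)
    qed auto
    then have "level k (\<lambda>xs. ennreal (m * (\<integral>y. flow xs y \<partial>N)) * chain f xs) \<le>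
      level k (\<lambda>_. ennreal (m * (C * (2 ^ k * exp m))) * ennreal (real (Suc k)))"
      by (rule level_mono)
    also have "\<dots> = ennreal (C * m * exp m * (real (Suc k) * ((2 * m) ^ k / fact k)))"
      using m_nonneg C_pos
      by (simp add: level_const ennreal_mult[symmetric] power_mult_distrib field_simps del: of_nat_Suc)
    finally show ?thesis .
  qed
  then show "\<forall>\<^sub>F k in sequentially. level k (\<lambda>xs. ennreal (m * (\<integral>y. flow xs y \<partial>N)) * chain f xs) \<le>
    ennreal (C * m * exp m * (real (Suc k) * ((2 * m) ^ k / fact k)))" by simp
  \<comment> \<open>The doubled base pays for the factor \<open>Suc k\<close>, which is at most
    \<open>2 ^ k\<close>.\<close>
  have "summable (\<lambda>k. (2 * (2 * m)) ^ k / fact k)"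
    using summable_exp[of "2 * (2 * m)"] by (simp add: field_simps)
  then have lim: "(\<lambda>k. (2 * (2 * m)) ^ k / fact k) \<longlonglongrightarrow> 0" by (rule summable_LIMSEQ_zero)
  have "(\<lambda>k. real (Suc k) * ((2 * m) ^ k / fact k)) \<longlonglongrightarrow> 0"
  proof (rule tendsto_sandwich[OF _ _ tendsto_const lim])
    have le: "real (Suc k) * ((2 * m) ^ k / fact k) \<le> 2 ^ k * ((2 * m) ^ k / fact k)" for k
    proof (rule mult_right_mono)
      have "Suc k \<le> 2 ^ k" by (induction k) auto
      then show "real (Suc k) \<le> 2 ^ k" by (metis of_nat_le_iff of_nat_numeral of_nat_power)
    qed (use m_nonneg in auto)
    then show "\<forall>\<^sub>F k in sequentially. real (Suc k) * ((2 * m) ^ k / fact k) \<le> (2 * (2 * m)) ^ k / fact k"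
      using le unfolding power_mult_distrib[of 2 "2 * m"] times_divide_eq_right by (intro always_eventually allI)
  qed (use m_nonneg in auto)
  from tendsto_ennrealI[OF tendsto_mult_left[OF this, of "C * m * exp m"]]
  show "(\<lambda>k. ennreal (C * m * exp m * (real (Suc k) * ((2 * m) ^ k / fact k)))) \<longlonglongrightarrow> 0"
    by simp
qed auto

text \<open>Started from the Poisson law, the chain ends in the Gibbs law. Indicators will give the
  marginal of the coupling, \<open>length\<close> the mean number of surviving points.\<close>

lemma chain_transports:
  assumes f: "list_measurable N f borel" and le: "\<And>xs. f xs \<le> of_nat (Suc (length xs))"
  shows "(\<Sum>n. level n (\<lambda>xs. ennreal (exp (- m)) * chain f xs)) =
    (\<Sum>n. level n (\<lambda>xs. ennreal (C * g (mset xs)) * f xs))"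
proof -
  let ?A = "\<lambda>n. level n (\<lambda>xs. ennreal (exp (- m)) * chain f xs)"
  have "(\<lambda>k. (\<Sum>n<Suc k. ?A n)) \<longlonglongrightarrow> (\<Sum>n. ?A n)"
    by (rule LIMSEQ_Suc[OF summable_LIMSEQ[OF summableI]])
  from tendsto_add[OF this remainder_tendsto_0[OF le]]
  have "(\<lambda>k. (\<Sum>n<Suc k. level n (\<lambda>xs. ennreal (C * g (mset xs)) * f xs))) \<longlonglongrightarrow> (\<Sum>n. ?A n)"
    unfolding chain_partial_sums[OF f] by simp
  moreover have "(\<lambda>k. (\<Sum>n<Suc k. level n (\<lambda>xs. ennreal (C * g (mset xs)) * f xs))) \<longlonglongrightarrow>
      (\<Sum>n. level n (\<lambda>xs. ennreal (C * g (mset xs)) * f xs))"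
    by (rule LIMSEQ_Suc[OF summable_LIMSEQ[OF summableI]])
  ultimately show ?thesis by (rule LIMSEQ_unique)
qed

end

section \<open>Mean number of deleted points\<close>

text \<open>Only an inequality: for non-measurable \<open>f\<close> the nonnegative integral is a lower integral.\<close>

lemma nn_integral_distr_le:
  assumes T: "T \<in> measurable M K"
  shows "(\<integral>\<^sup>+y. f y \<partial>distr M K T) \<le> (\<integral>\<^sup>+x. f (T x) \<partial>M)"
  unfolding nn_integral_def[of "distr M K T"]
proof (rule SUP_least)
  fix u assume "u \<in> {u. simple_function (distr M K T) u \<and> u \<le> f}"
  then have u: "simple_function (distr M K T) u" "u \<le> f" by auto
  then have [measurable]: "u \<in> borel_measurable K"
    using borel_measurable_simple_function by fastforce
  have "integral\<^sup>S (distr M K T) u = (\<integral>\<^sup>+x. u (T x) \<partial>M)"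
    using u T by (simp add: nn_integral_eq_simple_integral[symmetric] nn_integral_distr)
  also have "\<dots> \<le> (\<integral>\<^sup>+x. f (T x) \<partial>M)"
    using u by (intro nn_integral_mono) (simp add: le_fun_def)
  finally show "integral\<^sup>S (distr M K T) u \<le> (\<integral>\<^sup>+x. f (T x) \<partial>M)" .
qed

section \<open>The sample space of the coupling and its mean cost\<close>

context normalized_repulsive
begin

text \<open>Joint law of the number \<open>n\<close> of Poisson points, the deletion path
  \<open>p\<close> and a stream whose first \<open>n\<close> entries are the points.
  \<open>n\<close> and \<open>p\<close> are countable coordinates, so measurability can be checked
  for each value separately.\<close>

definition path_space :: "((nat \<times> nat list) \<times> 'a stream) measure" where
  "path_space = density (count_space UNIV \<Otimes>\<^sub>M stream_space N)
     (\<lambda>((n, p), s). ennreal (exp (- m)) * ennreal (m ^ n / fact n) * ennreal (path_weight p (stake n s)))"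

lemma measurable_path_space:
  fixes F :: "nat \<Rightarrow> nat list \<Rightarrow> 'a list \<Rightarrow> 'b"
  assumes "\<And>n p. list_measurable N (F n p) K"
  shows "(\<lambda>((n, p), s). F n p (stake n s)) \<in> measurable (count_space UNIV \<Otimes>\<^sub>M stream_space N) K"
proof -
  have "(\<lambda>x. F (fst (fst x)) (snd (fst x)) (stake (fst (fst x)) (snd x))) \<in> measurable (count_space UNIV \<Otimes>\<^sub>M stream_space N) K"
    by (rule measurable_pair_measure_countable1) (simp_all add: list_measurable_stake[OF assms] countableI_type)
  then show ?thesis by (simp add: case_prod_unfold)
qed

lemma path_density_measurable:
  "(\<lambda>((n, p), s). ennreal (exp (- m)) * ennreal (m ^ n / fact n) * ennreal (path_weight p (stake n s)))
     \<in> borel_measurable (count_space UNIV \<Otimes>\<^sub>M stream_space N)"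
proof (rule measurable_path_space)
  show "list_measurable N (\<lambda>xs. ennreal (exp (- m)) * ennreal (m ^ n / fact n) * ennreal (path_weight p xs)) borel" for n p
    by (rule list_measurable_compose[OF path_weight_measurable]) measurable
qed

text \<open>Tonelli: the sum over paths is moved inside the integral over the points, where it
  becomes \<open>path_mean\<close>.\<close>

lemma nn_integral_path_space:
  assumes h: "\<And>p. list_measurable N (h p) borel"
  shows "(\<integral>\<^sup>+((n, p), s). h p (stake n s) \<partial>path_space) =
    (\<Sum>n. level n (\<lambda>xs. ennreal (exp (- m)) * path_mean h xs))"
proof -
  let ?cs = "count_space (UNIV :: nat list set)"
  interpret cs: sigma_finite_measure ?cs by (rule sigma_finite_measure_count_space)
  interpret P: pair_sigma_finite "stream_space N" ?cs ..
  have lm: "list_measurable N (\<lambda>xs. ennreal (path_weight p xs) * h p xs) borel" for p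
    by (rule list_measurable_ennreal_mult[OF path_weight_measurable h])
  have "(\<integral>\<^sup>+((n, p), s). h p (stake n s) \<partial>path_space) =
    (\<integral>\<^sup>+((n, p), s). ennreal (exp (- m)) * ennreal (m ^ n / fact n) * (ennreal (path_weight p (stake n s)) * h p (stake n s))
      \<partial>(count_space UNIV \<Otimes>\<^sub>M stream_space N))"
    unfolding path_space_def
    by (subst nn_integral_density[OF path_density_measurable measurable_path_space[OF h]])
      (simp add: case_prod_unfold mult.assoc)
  also have "\<dots> = (\<integral>\<^sup>+x. \<integral>\<^sup>+s. ennreal (exp (- m)) * ennreal (m ^ fst x / fact (fst x)) *
     (ennreal (path_weight (snd x) (stake (fst x) s)) * h (snd x) (stake (fst x) s)) \<partial>stream_space N \<partial>count_space UNIV)"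
  proof (subst stream.nn_integral_fst[symmetric])
    have "list_measurable N (\<lambda>xs. ennreal (exp (- m)) * ennreal (m ^ n / fact n) * (ennreal (path_weight p xs) * h p xs)) borel" for n p
      by (rule list_measurable_compose[OF lm]) simp
    from measurable_path_space[OF this]
    show "(\<lambda>((n, p), s). ennreal (exp (- m)) * ennreal (m ^ n / fact n) * (ennreal (path_weight p (stake n s)) * h p (stake n s)))
      \<in> borel_measurable (count_space UNIV \<Otimes>\<^sub>M stream_space N)" .
  qed (simp add: case_prod_unfold)
  also have "\<dots> = (\<integral>\<^sup>+n. \<integral>\<^sup>+p. \<integral>\<^sup>+s. ennreal (exp (- m)) * ennreal (m ^ n / fact n) *
     (ennreal (path_weight p (stake n s)) * h p (stake n s)) \<partial>stream_space N \<partial>?cs \<partial>count_space UNIV)"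
    by (subst nn_integral_fst_count_space[symmetric]) simp
  also have "\<dots> = (\<integral>\<^sup>+n. level n (\<lambda>xs. ennreal (exp (- m)) * path_mean h xs) \<partial>count_space UNIV)"
  proof (rule nn_integral_cong)
    fix n :: nat
    have swap: "(\<lambda>(s, p). ennreal (path_weight p (stake n s)) * h p (stake n s))
        \<in> borel_measurable (stream_space N \<Otimes>\<^sub>M ?cs)"
    proof (subst measurable_pair_swap_iff)
      have "(\<lambda>x. ennreal (path_weight (fst x) (stake n (snd x))) * h (fst x) (stake n (snd x)))
        \<in> borel_measurable (?cs \<Otimes>\<^sub>M stream_space N)"
        using list_measurable_stake[OF lm] by (intro measurable_pair_measure_countable1) simp_all
      then show "(\<lambda>(x, y). case (y, x) of (s, p) \<Rightarrow> ennreal (path_weight p (stake n s)) * h p (stake n s))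
        \<in> borel_measurable (?cs \<Otimes>\<^sub>M stream_space N)"
        by (simp add: case_prod_unfold)
    qed
    have "(\<integral>\<^sup>+p. \<integral>\<^sup>+s. ennreal (exp (- m)) * ennreal (m ^ n / fact n) *
        (ennreal (path_weight p (stake n s)) * h p (stake n s)) \<partial>stream_space N \<partial>?cs) =
      ennreal (exp (- m)) * ennreal (m ^ n / fact n) *
        (\<integral>\<^sup>+p. \<integral>\<^sup>+s. ennreal (path_weight p (stake n s)) * h p (stake n s) \<partial>stream_space N \<partial>?cs)"
      using list_measurable_stake[OF lm, where n=n] by (simp add: nn_integral_cmult)
    also have "(\<integral>\<^sup>+p. \<integral>\<^sup>+s. ennreal (path_weight p (stake n s)) * h p (stake n s) \<partial>stream_space N \<partial>?cs) =
      (\<integral>\<^sup>+s. path_mean h (stake n s) \<partial>stream_space N)"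
      unfolding path_mean_def by (rule P.Fubini'[OF swap])
    finally show "(\<integral>\<^sup>+p. \<integral>\<^sup>+s. ennreal (exp (- m)) * ennreal (m ^ n / fact n) *
        (ennreal (path_weight p (stake n s)) * h p (stake n s)) \<partial>stream_space N \<partial>?cs) =
      level n (\<lambda>xs. ennreal (exp (- m)) * path_mean h xs)"
      unfolding level_integral_def
      using list_measurable_stake[OF path_mean_measurable[OF h], where n=n] by (simp add: nn_integral_cmult mult_ac)
  qed
  finally show ?thesis by (simp add: nn_integral_count_space_nat)
qed

text \<open>Lets the cost be estimated on genuine paths only, those that always delete an entry
  still present.\<close>

lemma AE_path_space: "AE x in path_space. case x of ((n, p), s) \<Rightarrow> path_weight p (stake n s) \<noteq> 0"
  unfolding path_space_def by (subst AE_density[OF path_density_measurable]) auto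

text \<open>Along each genuine path, deleted and surviving points add up to the initial ones. The
  additive form avoids subtraction in \<open>ennreal\<close>.\<close>

lemma path_mean_length:
  "path_mean (\<lambda>p xs. of_nat (length p)) xs + chain (\<lambda>xs. of_nat (length xs)) xs = of_nat (length xs)"
proof -
  have "path_mean (\<lambda>p xs. of_nat (length p)) xs + chain (\<lambda>xs. of_nat (length xs)) xs =
    (\<integral>\<^sup>+p. ennreal (path_weight p xs) * of_nat (length p) + ennreal (path_weight p xs) * of_nat (length (delete_path p xs)) \<partial>count_space UNIV)"
    unfolding path_mean_def chain_def by (subst nn_integral_add) auto
  also have "\<dots> = chain (\<lambda>_. of_nat (length xs)) xs"
    unfolding chain_def
  proof (rule nn_integral_cong)
    fix p
    show "ennreal (path_weight p xs) * of_nat (length p) + ennreal (path_weight p xs) * of_nat (length (delete_path p xs)) =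
      ennreal (path_weight p xs) * of_nat (length xs)"
      using path_weight_length[of p xs]
      by (cases "path_weight p xs = 0") (auto simp: distrib_left[symmetric] of_nat_add[symmetric] simp del: of_nat_add)
  qed
  finally show ?thesis by (simp add: chain_cmult_1)
qed

text \<open>\<open>size \<phi> + k\<close> is the number of points that \<open>y\<close> meets once
  the k integrated ones are included; the induction moves one unit from k into the size.\<close>

lemma I_decrement:
  fixes \<delta> :: real
  assumes g: "\<And>y \<phi>. g \<phi> - g (add_mset y \<phi>) \<le> \<delta> * size \<phi> * g \<phi>"
  shows "I k \<phi> - I k (add_mset y \<phi>) \<le> \<delta> * (size \<phi> + k) * I k \<phi>"
proof (induction k arbitrary: \<phi>)
  case (Suc k)
  have "(\<integral>z. I k (add_mset z \<phi>) - I k (add_mset z (add_mset y \<phi>)) \<partial>N) \<le>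
      (\<integral>z. \<delta> * (size \<phi> + Suc k) * I k (add_mset z \<phi>) \<partial>N)"
  proof (rule integral_mono)
    fix z
    show "I k (add_mset z \<phi>) - I k (add_mset z (add_mset y \<phi>)) \<le> \<delta> * (size \<phi> + Suc k) * I k (add_mset z \<phi>)"
      using Suc[of "add_mset z \<phi>"] by (simp add: add_mset_commute)
  qed (auto intro: I_integrable)
  then have "(\<integral>z. I k (add_mset z \<phi>) \<partial>N) - (\<integral>z. I k (add_mset z (add_mset y \<phi>)) \<partial>N) \<le>
      \<delta> * (size \<phi> + Suc k) * (\<integral>z. I k (add_mset z \<phi>) \<partial>N)"
    by (simp add: Bochner_Integration.integral_diff I_integrable)
  from mult_left_mono[OF this m_nonneg] show ?case by (simp add: algebra_simps)
qed (simp add: g)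

text \<open>The mean number of deletions is \<open>m - r\<close>, with \<open>r\<close> the mean
  number of Gibbs points. Termwise comparison of two series gives m - r \<le> m \<delta> r, and r
  \<le> m by repulsion: one factor m comes from the added point, the other from the points it
  meets.\<close>

lemma mean_path_length_le:
  fixes \<delta> :: real
  assumes g: "\<And>y \<phi>. g \<phi> - g (add_mset y \<phi>) \<le> \<delta> * size \<phi> * g \<phi>" and \<delta>: "0 \<le> \<delta>"
  shows "(\<Sum>n. level n (\<lambda>xs. ennreal (exp (- m)) * path_mean (\<lambda>p xs. of_nat (length p)) xs)) \<le> ennreal (m\<^sup>2 * \<delta>)"
    (is "?D \<le> _")
proof -
  define i where "i k = I k {#}" for k
  have lm: "list_measurable N (\<lambda>xs. c (length xs) :: ennreal) borel" for c
    by (simp add: list_measurable_def)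
  have i_le: "i (Suc k) \<le> m * i k" for k
    using mult_left_mono[OF integral_le_const[OF I_integrable AE_I2[OF I_add_le]] m_nonneg, of k "{#}"]
    by (simp add: i_def)
  have i_nonneg: "0 \<le> i k" for k unfolding i_def by (rule I_nonneg)
  have i_ge: "m * i k - i (Suc k) \<le> m * \<delta> * (k * i k)" for k
  proof -
    have "(\<integral>y. I k {#} - I k {#y#} \<partial>N) \<le> \<delta> * k * I k {#}"
    proof (rule integral_le_const)
      show "AE y in N. I k {#} - I k {#y#} \<le> \<delta> * k * I k {#}"
        using I_decrement[OF g, of k "{#}"] by (intro AE_I2) simp
    qed (use I_integrable[of k "{#}"] in simp)
    then have "I k {#} - (\<integral>y. I k {#y#} \<partial>N) \<le> \<delta> * k * I k {#}"
      using I_integrable[of k "{#}"] by (simp add: Bochner_Integration.integral_diff prob_space)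
    from mult_left_mono[OF this m_nonneg] show ?thesis by (simp add: i_def algebra_simps)
  qed
  have S0: "summable (\<lambda>k. i k / fact k)" "(\<Sum>k. i k / fact k) = 1 / C"
    using I_sums unfolding i_def by (simp_all add: sums_iff)
  have S1: "summable (\<lambda>k. i (Suc k) / fact k)"
    by (rule summable_comparison_test'[OF summable_mult[OF S0(1), of m], of 0])
      (use i_le i_nonneg in \<open>simp add: divide_right_mono\<close>)
  \<comment> \<open>The Gibbs mean with one of k + 1 points singled out, the form comparable with
    \<open>m\<close>; the index shift below turns it into the mean of the number of points.\<close>
  define r where "r = C * (\<Sum>k. i (Suc k) / fact k)"
  have shift: "real (Suc k) * i (Suc k) / fact (Suc k) = i (Suc k) / fact k" for k
    by (simp add: divide_simps)
  have S2: "summable (\<lambda>k. real k * i k / fact k)"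
    using S1 by (subst summable_Suc_iff[symmetric]) (simp only: shift)
  have r: "r = C * (\<Sum>k. real k * i k / fact k)"
    unfolding r_def using suminf_split_head[OF S2] by (simp only: shift) simp
  have r_nonneg: "0 \<le> r"
    unfolding r_def using C_pos by (intro mult_nonneg_nonneg suminf_nonneg S1) (auto simp: i_nonneg)
  \<comment> \<open>\<open>m\<close> is multiplied by the total mass one, so that it becomes a
    series to compare with \<open>r\<close> term by term.\<close>
  have m_eq: "m = C * (\<Sum>k. m * (i k / fact k))"
    using C_pos unfolding suminf_mult[OF S0(1)] S0(2) by simp
  have "r \<le> m"
    unfolding r_def by (subst m_eq, intro mult_left_mono suminf_le S1 summable_mult S0)
      (use C_pos i_le in \<open>auto simp: divide_right_mono\<close>)
  have "m - r = C * (\<Sum>k. m * (i k / fact k) - i (Suc k) / fact k)"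
    unfolding r_def by (subst m_eq, subst suminf_diff[OF summable_mult[OF S0(1)] S1, symmetric])
      (simp add: right_diff_distrib)
  also have "\<dots> \<le> C * (\<Sum>k. m * \<delta> * (real k * i k / fact k))"
  proof (intro mult_left_mono suminf_le summable_diff summable_mult S0 S1 S2)
    show "m * (i k / fact k) - i (Suc k) / fact k \<le> m * \<delta> * (real k * i k / fact k)" for k
      using divide_right_mono[OF i_ge[of k], of "fact k"] by (simp add: diff_divide_distrib)
  qed (use C_pos in auto)
  also have "\<dots> = m * \<delta> * r"
    unfolding r by (subst suminf_mult[OF S2]) simp
  also have "\<dots> \<le> m * \<delta> * m"
    using \<open>r \<le> m\<close> m_nonneg \<delta> by (intro mult_left_mono) auto
  finally have le: "m - r \<le> m\<^sup>2 * \<delta>" by (simp add: power2_eq_square mult_ac)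
  have "(\<Sum>n. level n (\<lambda>xs. ennreal (exp (- m)) * chain (\<lambda>xs. of_nat (length xs)) xs)) =
    (\<Sum>n. level n (\<lambda>xs. ennreal (C * g (mset xs)) * of_nat (length xs)))"
    by (rule chain_transports[OF lm]) (simp add: of_nat_mono)
  also have "\<dots> = (\<Sum>n. ennreal (C * (real n * i n / fact n)))"
  proof (intro suminf_cong)
    fix n
    have [measurable]: "(\<lambda>s. g (mset (stake n s))) \<in> borel_measurable (stream_space N)"
      by (rule list_measurable_stake[OF g_measurable])
    have "level n (\<lambda>xs. ennreal (C * g (mset xs)) * of_nat (length xs)) =
      ennreal (m ^ n / fact n) * (ennreal (C * real n) * (\<integral>\<^sup>+s. g (mset (stake n s)) \<partial>stream_space N))"
      unfolding level_integral_def using C_pos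
      by (simp add: ennreal_mult' nn_integral_cmult nn_integral_multc ennreal_of_nat_eq_real_of_nat mult_ac)
    also have "\<dots> = ennreal (C * real n / fact n) * (ennreal (m ^ n) * (\<integral>\<^sup>+s. g (mset (stake n s)) \<partial>stream_space N))"
    proof -
      have "ennreal (m ^ n / fact n) * ennreal (C * real n) = ennreal (C * real n / fact n) * ennreal (m ^ n)"
        using C_pos m_nonneg by (simp add: ennreal_mult[symmetric] mult_ac)
      then show ?thesis by (simp only: mult.assoc[symmetric])
    qed
    also have "\<dots> = ennreal (C * real n / fact n * i n)"
      using nn_integral_g_stake[of n "{#}"]
      by (simp only: add_0_right i_def[symmetric] ennreal_mult''[OF i_nonneg])
    finally show "level n (\<lambda>xs. ennreal (C * g (mset xs)) * of_nat (length xs)) = ennreal (C * (real n * i n / fact n))"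
      by (simp add: mult_ac)
  qed
  also have "\<dots> = ennreal r"
  proof -
    have "(\<Sum>n. ennreal (C * (real n * i n / fact n))) = ennreal (\<Sum>n. C * (real n * i n / fact n))"
      by (rule suminf_ennreal2[OF _ summable_mult[OF S2]]) (use C_pos i_nonneg in simp)
    also have "(\<Sum>n. C * (real n * i n / fact n)) = r"
      unfolding r by (rule suminf_mult[OF S2])
    finally show ?thesis .
  qed
  finally have chain_len: "(\<Sum>n. level n (\<lambda>xs. ennreal (exp (- m)) * chain (\<lambda>xs. of_nat (length xs)) xs)) = ennreal r" .
  have "?D + ennreal r = (\<Sum>n. level n (\<lambda>xs. ennreal (exp (- m)) * path_mean (\<lambda>p xs. of_nat (length p)) xs) +
      level n (\<lambda>xs. ennreal (exp (- m)) * chain (\<lambda>xs. of_nat (length xs)) xs))"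
    unfolding chain_len[symmetric] by (rule suminf_add) auto
  also have "\<dots> = (\<Sum>n. ennreal (exp (- m) * (real n * m ^ n / fact n)))"
  proof (intro suminf_cong)
    fix n
    have "list_measurable N (\<lambda>xs. ennreal (exp (- m)) * path_mean (\<lambda>p xs. of_nat (length p)) xs) borel"
      "list_measurable N (\<lambda>xs. ennreal (exp (- m)) * chain (\<lambda>xs. of_nat (length xs)) xs) borel"
      by (rule list_measurable_ennreal_mult, simp add: list_measurable_def,
          intro path_mean_measurable chain_measurable lm)+
    from level_add[OF this, symmetric]
    show "level n (\<lambda>xs. ennreal (exp (- m)) * path_mean (\<lambda>p xs. of_nat (length p)) xs) +
      level n (\<lambda>xs. ennreal (exp (- m)) * chain (\<lambda>xs. of_nat (length xs)) xs) =
      ennreal (exp (- m) * (real n * m ^ n / fact n))"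
      unfolding distrib_left[symmetric] path_mean_length
      using m_nonneg
      by (simp add: level_integral_def stream.emeasure_space_1 ennreal_of_nat_eq_real_of_nat ennreal_mult[symmetric] mult_ac)
  qed
  also have "\<dots> = ennreal m"
  proof -
    have sh: "real (Suc k) * m ^ Suc k / fact (Suc k) = m * (m ^ k / fact k)" for k
      by (simp add: divide_simps)
    have S3: "summable (\<lambda>n. real n * m ^ n / fact n)"
      using summable_mult[OF summable_power_fact, of m] by (subst summable_Suc_iff[symmetric]) (simp only: sh)
    have "(\<Sum>n. real n * m ^ n / fact n) = m * exp m"
      using suminf_split_head[OF S3] suminf_mult[OF summable_power_fact, of m]
      by (simp only: sh suminf_power_fact)
    then have "(\<Sum>n. exp (- m) * (real n * m ^ n / fact n)) = m"
      unfolding suminf_mult[OF S3] by (simp add: exp_minus field_simps)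
    then show ?thesis
      using m_nonneg summable_mult[OF S3, of "exp (- m)"] by (subst suminf_ennreal2) auto
  qed
  finally have "?D + ennreal r = ennreal (m - r) + ennreal r"
    using \<open>r \<le> m\<close> r_nonneg by (simp add: ennreal_plus[symmetric] del: ennreal_plus)
  then have "?D = ennreal (m - r)"
    unfolding add.commute[of _ "ennreal r"] ennreal_add_left_cancel by simp
  then show ?thesis using le by (simp add: ennreal_leI)
qed

end

section \<open>Configurations\<close>

lemma space_config_space: "space config_space = configurations"
  and sets_config_space: "sets config_space = sigma_sets configurations
       {{\<phi> \<in> configurations. emeasure \<phi> A \<in> B} | A B. A \<in> relcompact_borel \<and> B \<in> sets borel}"
  unfolding config_space_def by (auto intro!: space_measure_of sets_measure_of)

lemma measurable_emeasure_config:
  assumes "A \<in> relcompact_borel"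
  shows "(\<lambda>\<phi>. emeasure \<phi> A) \<in> borel_measurable config_space"
proof (rule measurableI)
  fix B :: "ennreal set" assume "B \<in> sets borel"
  then have "{\<phi> \<in> configurations. emeasure \<phi> A \<in> B} \<in> sets config_space"
    using assms unfolding sets_config_space by (intro sigma_sets.Basic) blast
  then show "(\<lambda>\<phi>. emeasure \<phi> A) -` B \<inter> space config_space \<in> sets config_space"
    by (simp add: space_config_space vimage_def Int_def conj_commute)
qed simp

lemma measurable_config_spaceI:
  fixes X :: "'x \<Rightarrow> 'a::metric_space measure"
  assumes "\<And>x. x \<in> space M \<Longrightarrow> X x \<in> configurations"
    and A: "\<And>A. A \<in> relcompact_borel \<Longrightarrow> (\<lambda>x. emeasure (X x) A) \<in> borel_measurable M"
  shows "X \<in> measurable M config_space"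
  unfolding config_space_def
proof (rule measurable_measure_of)
  fix S :: "'a measure set"
  assume "S \<in> {{\<phi> \<in> configurations. emeasure \<phi> A \<in> B} | A B. A \<in> relcompact_borel \<and> B \<in> sets borel}"
  then obtain A B where S: "S = {\<phi> \<in> configurations. emeasure \<phi> A \<in> B}"
    and AB: "A \<in> relcompact_borel" "B \<in> sets borel" by blast
  have "X -` S \<inter> space M = (\<lambda>x. emeasure (X x) A) -` B \<inter> space M"
    using assms(1) by (auto simp: S)
  then show "X -` S \<inter> space M \<in> sets M"
    using measurable_sets[OF A[OF AB(1)] AB(2)] by simp
qed (use assms(1) in auto)

lemma relcompact_borel_subset:
  assumes "A \<in> relcompact_borel" "B \<in> sets borel" "B \<subseteq> A"
  shows "B \<in> relcompact_borel"
proof -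
  have "compact (closure A \<inter> closure B)"
    using assms(1) by (intro compact_Int_closed closed_closure) (simp add: relcompact_borel_def)
  moreover have "closure A \<inter> closure B = closure B"
    using closure_mono[OF assms(3)] by auto
  ultimately have "compact (closure B)" by simp
  with assms(2) show ?thesis by (simp add: relcompact_borel_def)
qed

lemma sets_relcompact_borel: "A \<in> relcompact_borel \<Longrightarrow> A \<in> sets borel"
  by (simp add: relcompact_borel_def)

section \<open>Configurations given by lists of points\<close>

definition list_config :: "'a::metric_space list \<Rightarrow> 'a measure" where
  "list_config xs = distr (count_space {..<length xs}) borel ((!) xs)"

lemma emeasure_list_config:
  assumes "A \<in> sets borel"
  shows "emeasure (list_config xs) A = of_nat (length (filter (\<lambda>x. x \<in> A) xs))"
proof -
  have "(!) xs -` A \<inter> {..<length xs} = {i. i < length xs \<and> xs ! i \<in> A}" by auto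
  then show ?thesis
    using assms unfolding list_config_def
    by (subst emeasure_distr, simp, simp, simp, subst emeasure_count_space_finite) (auto simp: length_filter_conv_card)
qed

lemma list_config_in_finite: "list_config xs \<in> finite_configurations"
  unfolding finite_configurations_def configurations_def
  by (auto simp: emeasure_list_config ennreal_of_nat_eq_real_of_nat relcompact_borel_def list_config_def[THEN arg_cong[where f=sets]])

lemma list_config_in: "list_config xs \<in> configurations"
  using list_config_in_finite by (auto simp: finite_configurations_def)

lemma tuple_config_conv_list_config: "tuple_config k x = list_config (map x [1..<Suc k])"
proof (rule measure_eqI)
  show "sets (tuple_config k x) = sets (list_config (map x [1..<Suc k]))"
    by (simp add: tuple_config_def list_config_def)
  fix A assume "A \<in> sets (tuple_config k x)"
  then have A: "A \<in> sets borel" by (simp add: tuple_config_def)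
  have "length (filter (\<lambda>x. x \<in> A) (map x [1..<Suc k])) = card (set (filter (\<lambda>i. x i \<in> A) [1..<Suc k]))"
    by (subst distinct_card) (simp_all add: filter_map o_def)
  also have "set (filter (\<lambda>i. x i \<in> A) [1..<Suc k]) = x -` A \<inter> {1..k}" by auto
  finally show "emeasure (tuple_config k x) A = emeasure (list_config (map x [1..<Suc k])) A"
    unfolding emeasure_list_config[OF A] using A
    by (simp add: tuple_config_def emeasure_distr emeasure_count_space)
qed

lemma list_measurable_list_config:
  assumes N: "sets N = sets borel"
  shows "list_measurable N list_config config_space"
  unfolding list_measurable_def
proof
  fix js
  show "(\<lambda>s. list_config (map ((!!) s) js)) \<in> measurable (stream_space N) config_space"
  proof (rule measurable_config_spaceI)
    fix A :: "'a set" assume "A \<in> relcompact_borel"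
    then have A: "A \<in> sets borel" by (rule sets_relcompact_borel)
    then have [measurable]: "A \<in> sets N" by (simp add: N)
    have eq: "of_nat (length (filter (\<lambda>x. x \<in> A) (map ((!!) s) js))) = (\<Sum>j\<leftarrow>js. indicator A (s !! j) :: ennreal)" for s
      by (induction js) auto
    have "(\<lambda>s. \<Sum>j\<leftarrow>js. indicator A (s !! j) :: ennreal) \<in> borel_measurable (stream_space N)"
      by (induction js) simp_all
    then show "(\<lambda>s. emeasure (list_config (map ((!!) s) js)) A) \<in> borel_measurable (stream_space N)"
      by (simp only: emeasure_list_config[OF A] eq)
  qed (rule list_config_in)
qed

text \<open>The two counts of a set differ by the number of deleted points in it, which is at most
  \<open>k\<close>.\<close>

lemma tv_dist_list_config_le:
  assumes sub: "mset ys \<subseteq># mset xs" and len: "k + length ys = length xs"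
  shows "tv_dist (list_config ys) (list_config xs) \<le> of_nat k"
  unfolding tv_dist_def
proof (rule SUP_least)
  fix A assume "A \<in> {A \<in> sets borel. emeasure (list_config ys) A < \<infinity> \<and> emeasure (list_config xs) A < \<infinity>}"
  then have A: "A \<in> sets borel" by simp
  let ?n = "\<lambda>zs. length (filter (\<lambda>x. x \<in> A) zs)"
  have m: "measure (list_config zs) A = real (?n zs)" for zs
    by (simp add: measure_def emeasure_list_config[OF A])
  obtain D where D: "mset xs = mset ys + D" using sub unfolding mset_subset_eq_exists_conv by blast
  then have "size D = k"
    using len by (metis add.commute add_left_cancel size_mset size_union)
  have "?n xs = size (filter_mset (\<lambda>x. x \<in> A) (mset xs))"
    by (simp flip: mset_filter)
  also have "\<dots> = ?n ys + size (filter_mset (\<lambda>x. x \<in> A) D)"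
    unfolding D filter_union_mset size_union by (simp flip: mset_filter)
  finally have n: "?n xs = ?n ys + size (filter_mset (\<lambda>x. x \<in> A) D)" .
  have "size (filter_mset (\<lambda>x. x \<in> A) D) \<le> k"
    using \<open>size D = k\<close> size_mset_mono[OF multiset_filter_subset] by metis
  then have "\<bar>measure (list_config ys) A - measure (list_config xs) A\<bar> \<le> real k"
    unfolding m n by simp
  then show "ennreal \<bar>measure (list_config ys) A - measure (list_config xs) A\<bar> \<le> of_nat k"
    by (simp add: ennreal_of_nat_eq_real_of_nat ennreal_leI)
qed

text \<open>Finitely many relatively compact sets split into disjoint atoms. Since the counts of
  atoms are natural numbers, every generating event is a countable disjoint union of events that fix
  the counts of all atoms.\<close>

lemma config_space_eqI:
  fixes \<mu> \<nu> :: "'a::metric_space measure measure"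
  assumes sets: "sets \<mu> = sets config_space" "sets \<nu> = sets config_space"
    and fin: "finite_measure \<mu>"
    and eq: "\<And>(q::nat) A n. (\<And>i. i < q \<Longrightarrow> A i \<in> relcompact_borel) \<Longrightarrow> disjoint_family_on A {..<q} \<Longrightarrow>
      emeasure \<mu> {\<phi> \<in> configurations. \<forall>i<q. emeasure \<phi> (A i) = of_nat (n i)} =
      emeasure \<nu> {\<phi> \<in> configurations. \<forall>i<q. emeasure \<phi> (A i) = of_nat (n i)}"
  shows "\<mu> = \<nu>"
proof -
  \<comment> \<open>A generator closed under intersection: constraints on finitely many counts at
    once.\<close>
  define G :: "'a measure set set" where
    "G = {{\<phi> \<in> configurations. \<forall>A\<in>F. emeasure \<phi> A \<in> B A} | F B.
      finite F \<and> F \<subseteq> relcompact_borel \<and> (\<forall>A\<in>F. B A \<in> sets borel)}"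
  have meas: "{\<phi> \<in> configurations. \<forall>A\<in>F. emeasure \<phi> A \<in> B A} \<in> sets config_space"
    if F: "finite F" "F \<subseteq> relcompact_borel" "\<And>A. A \<in> F \<Longrightarrow> B A \<in> sets borel" for F :: "'a set set" and B :: "'a set \<Rightarrow> ennreal set"
  proof -
    have "{\<phi> \<in> space config_space. \<forall>A\<in>F. emeasure \<phi> A \<in> B A} \<in> sets config_space"
    proof (intro sets.sets_Collect_finite_All F(1))
      fix A assume "A \<in> F"
      then have "(\<lambda>\<phi>. emeasure \<phi> A) -` B A \<inter> space config_space \<in> sets config_space"
        using F by (intro measurable_sets[OF measurable_emeasure_config]) auto
      then show "{\<phi> \<in> space config_space. emeasure \<phi> A \<in> B A} \<in> sets config_space"
        by (simp add: vimage_def Int_def conj_commute)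
    qed
    then show ?thesis by (simp add: space_config_space)
  qed
  have sets_G: "sets config_space = sigma_sets configurations G"
  proof
    show "sets config_space \<subseteq> sigma_sets configurations G"
      unfolding sets_config_space
    proof (rule sigma_sets_mono')
      show "{{\<phi> \<in> configurations. emeasure \<phi> A \<in> B} | A B. A \<in> relcompact_borel \<and> B \<in> sets borel} \<subseteq> G"
      proof
        fix S :: "'a measure set"
        assume "S \<in> {{\<phi> \<in> configurations. emeasure \<phi> A \<in> B} | A B. A \<in> relcompact_borel \<and> B \<in> sets borel}"
        then obtain A B where S: "S = {\<phi> \<in> configurations. \<forall>A'\<in>{A}. emeasure \<phi> A' \<in> B}"
          "A \<in> relcompact_borel" "B \<in> sets borel" by auto
        then show "S \<in> G" unfolding G_def by (intro CollectI exI[of _ "{A}"] exI[of _ "\<lambda>_. B"]) simp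
      qed
    qed
    show "sigma_sets configurations G \<subseteq> sets config_space"
      unfolding space_config_space[symmetric]
      by (rule sets.sigma_sets_subset) (auto simp: G_def intro!: meas)
  qed
  have eq_G: "emeasure \<mu> S = emeasure \<nu> S" if S: "S \<in> G" for S
  proof -
    obtain F B where S_eq: "S = {\<phi> \<in> configurations. \<forall>A\<in>F. emeasure \<phi> A \<in> B A}"
      and F: "finite F" "F \<subseteq> relcompact_borel" and B: "\<And>A. A \<in> F \<Longrightarrow> B A \<in> sets borel"
      using S unfolding G_def by blast
    \<comment> \<open>For \<open>T \<subseteq> F\<close>, the points that lie in every set of
      \<open>T\<close> and in no other set of \<open>F\<close>. For nonempty \<open>T\<close> the
      atom lies inside a member of \<open>F\<close> and is therefore relatively compact.\<close>
    define atom where "atom T = (\<Inter>A\<in>T. A) - \<Union>(F - T)" for T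
    obtain e where e: "bij_betw e {..<card (Pow F - {{}})} (Pow F - {{}})"
      using ex_bij_betw_nat_finite[of "Pow F - {{}}"] F(1) by (auto simp: atLeast0LessThan)
    define q where "q = card (Pow F - {{}})"
    have e_in: "e i \<in> Pow F - {{}}" if "i < q" for i
      using bij_betwE[OF e] that by (auto simp: q_def)
    have atom_rel: "atom T \<in> relcompact_borel" if "T \<in> Pow F - {{}}" for T
    proof -
      have T: "T \<subseteq> F" "finite T" "T \<noteq> {}"
        using that finite_subset[OF _ F(1)] by auto
      then obtain A where A: "A \<in> T" by blast
      have borel: "A' \<in> sets borel" if "A' \<in> F" for A'
        using that F(2) sets_relcompact_borel by blast
      have "(\<Inter>A\<in>T. A) \<in> sets borel"
        by (rule sets.finite_INT[OF T(2,3)]) (use T(1) borel in blast)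
      moreover have "\<Union>(F - T) \<in> sets borel"
        by (rule sets.finite_Union) (use F(1) borel in \<open>simp_all add: subset_iff\<close>)
      ultimately have "atom T \<in> sets borel"
        unfolding atom_def by (rule sets.Diff)
      moreover have "atom T \<subseteq> A" using A unfolding atom_def by blast
      ultimately show ?thesis
        using A T(1) F(2) relcompact_borel_subset[of A "atom T"] by blast
    qed
    have atom_disj1: "atom T \<inter> atom T' = {}" if "A \<in> T" "A \<in> F" "A \<notin> T'" for T T' A
    proof -
      have "atom T \<subseteq> A" using that by (auto simp: atom_def)
      moreover have "A \<inter> atom T' = {}" using that by (auto simp: atom_def)
      ultimately show ?thesis by blast
    qed
    have atom_disj: "atom T \<inter> atom T' = {}" if T: "T \<subseteq> F" "T' \<subseteq> F" "T \<noteq> T'" for T T'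
    proof (cases "T \<subseteq> T'")
      case True
      then obtain A where "A \<in> T'" "A \<notin> T" using T by auto
      then show ?thesis using atom_disj1[of A T' T] T by auto
    next
      case False
      then obtain A where "A \<in> T" "A \<notin> T'" by auto
      then show ?thesis using atom_disj1[of A T T'] T by auto
    qed
    have disj: "disjoint_family_on (\<lambda>i. atom (e i)) {..<q}"
      unfolding disjoint_family_on_def
    proof (intro ballI impI)
      fix i j assume ij: "i \<in> {..<q}" "j \<in> {..<q}" "i \<noteq> j"
      then have "e i \<noteq> e j"
        using inj_onD[OF bij_betw_imp_inj_on[OF e], of i j] by (auto simp: q_def)
      moreover have "e i \<subseteq> F" "e j \<subseteq> F"
        using ij e_in[of i] e_in[of j] by simp_all
      ultimately show "atom (e i) \<inter> atom (e j) = {}" by (intro atom_disj)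
    qed
    have A_union: "A = (\<Union>i\<in>{i. i < q \<and> A \<in> e i}. atom (e i))" if A: "A \<in> F" for A
    proof
      show "A \<subseteq> (\<Union>i\<in>{i. i < q \<and> A \<in> e i}. atom (e i))"
      proof
        fix x assume x: "x \<in> A"
        let ?T = "{A \<in> F. x \<in> A}"
        have T: "?T \<in> Pow F - {{}}" using x A by auto
        then have "?T \<in> e ` {..<q}"
          unfolding q_def bij_betw_imp_surj_on[OF e] .
        then obtain i where i: "i < q" "e i = ?T" by (metis (lifting) imageE lessThan_iff)
        then show "x \<in> (\<Union>i\<in>{i. i < q \<and> A \<in> e i}. atom (e i))"
          using x A by (auto simp: atom_def)
      qed
    qed (auto simp: atom_def)
    have emeasure_A: "emeasure \<phi> A = (\<Sum>i | i < q \<and> A \<in> e i. emeasure \<phi> (atom (e i)))"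
      if "\<phi> \<in> configurations" "A \<in> F" for \<phi> A
    proof -
      have "sets \<phi> = sets borel" using that by (simp add: configurations_def)
      moreover have "atom (e i) \<in> sets borel" if "i < q" for i
        using atom_rel[OF e_in[OF that]] by (rule sets_relcompact_borel)
      moreover have "disjoint_family_on (\<lambda>i. atom (e i)) {i. i < q \<and> A \<in> e i}"
        using disj by (auto simp: disjoint_family_on_def)
      ultimately show ?thesis
        by (subst A_union[OF that(2)], subst sum_emeasure) auto
    qed
    \<comment> \<open>The count vectors compatible with the constraints. Taking functions
      extensional on \<open>{..<q}\<close> keeps them countable and makes distinct vectors differ at
      some \<open>i < q\<close>.\<close>
    define V where "V = {n \<in> {..<q} \<rightarrow>\<^sub>E (UNIV::nat set). \<forall>A\<in>F. of_nat (\<Sum>i | i < q \<and> A \<in> e i. n i) \<in> B A}"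
    define X where "X n = {\<phi> \<in> configurations. \<forall>i<q. emeasure \<phi> (atom (e i)) = of_nat (n i)}" for n :: "nat \<Rightarrow> nat"
    have "countable ({..<q} \<rightarrow>\<^sub>E (UNIV::nat set))" by (intro countable_PiE) auto
    then have V: "countable V" by (rule countable_subset[rotated]) (auto simp: V_def)
    have X_meas: "X n \<in> sets config_space" for n
    proof -
      have "X n = {\<phi> \<in> space config_space. \<forall>i\<in>{..<q}. emeasure \<phi> (atom (e i)) = of_nat (n i)}"
        by (auto simp: X_def space_config_space)
      also have "\<dots> \<in> sets config_space"
      proof (intro sets.sets_Collect_finite_All)
        fix i assume "i \<in> {..<q}"
        then have "(\<lambda>\<phi>. emeasure \<phi> (atom (e i))) \<in> borel_measurable config_space"
          by (intro measurable_emeasure_config atom_rel e_in) simp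
        then show "{\<phi> \<in> space config_space. emeasure \<phi> (atom (e i)) = of_nat (n i)} \<in> sets config_space"
          by measurable
      qed auto
      finally show ?thesis .
    qed
    have X_disj: "disjoint_family_on X V"
      unfolding disjoint_family_on_def
    proof (intro ballI impI)
      fix n n' assume n: "n \<in> V" "n' \<in> V" "n \<noteq> n'"
      then obtain i where i: "i < q" "n i \<noteq> n' i"
        unfolding V_def by (metis (mono_tags, lifting) PiE_ext lessThan_iff mem_Collect_eq)
      then have "(of_nat (n i) :: ennreal) \<noteq> of_nat (n' i)" by (simp add: ennreal_of_nat_eq_real_of_nat)
      with i(1) show "X n \<inter> X n' = {}" unfolding X_def by force
    qed
    have S_X: "S = (\<Union>n\<in>V. X n)"
    proof (intro set_eqI iffI)
      fix \<phi> assume \<phi>: "\<phi> \<in> S"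
      then have conf: "\<phi> \<in> configurations" by (simp add: S_eq)
      have "\<exists>k::nat. emeasure \<phi> (atom (e i)) = of_nat k" if "i < q" for i
      proof -
        have "atom (e i) \<in> relcompact_borel" by (rule atom_rel[OF e_in[OF that]])
        then have "emeasure \<phi> (atom (e i)) \<in> range of_nat \<union> {\<infinity>}" "emeasure \<phi> (atom (e i)) < \<infinity>"
          using conf by (auto simp: configurations_def relcompact_borel_def)
        then show ?thesis by auto
      qed
      then obtain n' where n': "\<And>i. i < q \<Longrightarrow> emeasure \<phi> (atom (e i)) = of_nat (n' i)" by metis
      define n where "n = restrict n' {..<q}"
      have n: "emeasure \<phi> (atom (e i)) = of_nat (n i)" if "i < q" for i
        using n' that by (simp add: n_def)
      have "of_nat (\<Sum>i | i < q \<and> A \<in> e i. n i) = emeasure \<phi> A" if "A \<in> F" for A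
        unfolding emeasure_A[OF conf that] by (simp add: n)
      then have "n \<in> V" using \<phi> by (auto simp: V_def S_eq n_def)
      then show "\<phi> \<in> (\<Union>n\<in>V. X n)" using n conf by (auto simp: X_def)
    next
      fix \<phi> assume "\<phi> \<in> (\<Union>n\<in>V. X n)"
      then obtain n where n: "n \<in> V" "\<phi> \<in> X n" by auto
      then have conf: "\<phi> \<in> configurations" by (simp add: X_def)
      have "of_nat (\<Sum>i | i < q \<and> A \<in> e i. n i) = emeasure \<phi> A" if "A \<in> F" for A
        unfolding emeasure_A[OF conf that] using n by (simp add: X_def)
      then show "\<phi> \<in> S" using n conf by (auto simp: S_eq V_def)
    qed
    have "emeasure \<mu> (X n) = emeasure \<nu> (X n)" for n
      unfolding X_def using atom_rel[OF e_in] disj by (intro eq)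
    then show ?thesis
      unfolding S_X using X_meas V X_disj sets by (simp add: emeasure_UN_countable)
  qed
  show ?thesis
  proof (rule measure_eqI_generator_eq[where E=G and \<Omega>=configurations and A="\<lambda>_. configurations"])
    show "Int_stable G"
    proof (rule Int_stableI)
      fix S T assume "S \<in> G" "T \<in> G"
      then obtain F1 B1 F2 B2 where
        S: "S = {\<phi> \<in> configurations. \<forall>A\<in>F1. emeasure \<phi> A \<in> B1 A}" "finite F1" "F1 \<subseteq> relcompact_borel" "\<forall>A\<in>F1. B1 A \<in> sets borel" and
        T: "T = {\<phi> \<in> configurations. \<forall>A\<in>F2. emeasure \<phi> A \<in> B2 A}" "finite F2" "F2 \<subseteq> relcompact_borel" "\<forall>A\<in>F2. B2 A \<in> sets borel"
        unfolding G_def by blast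
      let ?B = "\<lambda>A. (if A \<in> F1 then B1 A else UNIV) \<inter> (if A \<in> F2 then B2 A else UNIV)"
      have "S \<inter> T = {\<phi> \<in> configurations. \<forall>A\<in>F1 \<union> F2. emeasure \<phi> A \<in> ?B A}"
        unfolding S T by auto
      then show "S \<inter> T \<in> G"
        unfolding G_def using S T by (intro CollectI exI[of _ "F1 \<union> F2"] exI[of _ ?B]) auto
    qed
    show "G \<subseteq> Pow configurations" by (auto simp: G_def)
    show "sets \<mu> = sigma_sets configurations G" "sets \<nu> = sigma_sets configurations G"
      using sets sets_G by simp_all
    have "configurations \<in> G"
      unfolding G_def by (intro CollectI exI[of _ "{}"] exI[of _ "\<lambda>_. {}"]) simp
    then show "range (\<lambda>_::nat. configurations) \<subseteq> G" by auto
    show "emeasure \<mu> configurations \<noteq> \<infinity>" for i :: nat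
      using finite_measure.emeasure_finite[OF fin] by simp
  qed (use eq_G in auto)
qed

section \<open>Poisson counts\<close>

lemma level_integral_cong:
  "(\<And>xs. length xs = k \<Longrightarrow> f xs = h xs) \<Longrightarrow> level_integral N m k f = level_integral N m k h"
  unfolding level_integral_def by (intro arg_cong2[where f="(*)"] refl nn_integral_cong) simp

lemma level_integral_0: "level_integral N m k (\<lambda>_. 0) = 0"
  by (simp add: level_integral_def)

context prob_space
begin

lemma level_integral_Suc:
  assumes f: "list_measurable M f borel" and m: "0 \<le> m"
  shows "level_integral M m (Suc k) f =
    ennreal (m / Suc k) * (\<integral>\<^sup>+y. level_integral M m k (\<lambda>xs. f (y # xs)) \<partial>M)"
proof -
  have meas: "(\<lambda>y. \<integral>\<^sup>+s. f (y # stake k s) \<partial>stream_space M) \<in> borel_measurable M"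
  proof -
    interpret stream: prob_space "stream_space M" by (rule prob_space_stream_space)
    show ?thesis
      using list_measurable_Cons_pair[OF f, of "[0..<k]"] unfolding stake_conv_map_snth
      by (rule stream.borel_measurable_nn_integral)
  qed
  have "m ^ Suc k / fact (Suc k) = m / Suc k * (m ^ k / fact k)"
    by (simp add: divide_simps)
  then have "ennreal (m ^ Suc k / fact (Suc k)) = ennreal (m / Suc k) * ennreal (m ^ k / fact k)"
    using m by (simp only: ennreal_mult[symmetric] divide_nonneg_nonneg of_nat_0_le_iff zero_le_power fact_ge_zero)
  then show ?thesis
    unfolding level_integral_def nn_integral_stake_Suc[OF f]
    by (simp only: mult.assoc nn_integral_cmult[OF meas])
qed

text \<open>Multinomial splitting: every point has one of the classes 0, ..., \<open>q\<close>. The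
  induction removes the first point, and the required count of its class drops by one.\<close>

lemma level_integral_counts:
  fixes cl :: "'a \<Rightarrow> nat"
  assumes m: "0 \<le> m" and cl_le: "\<And>y. cl y \<le> q" and cl_meas: "cl \<in> measurable M (count_space UNIV)"
  shows "level_integral M m k (\<lambda>xs. if \<forall>i\<le>q. length (filter (\<lambda>y. cl y = i) xs) = n i then 1 else 0) =
    ennreal (if k = (\<Sum>i\<le>q. n i) then \<Prod>i\<le>q. (m * prob {y \<in> space M. cl y = i}) ^ n i / fact (n i) else 0)"
proof (induction k arbitrary: n)
  case 0
  interpret stream: prob_space "stream_space M" by (rule prob_space_stream_space)
  show ?case
    by (auto simp: level_integral_def stream.emeasure_space_1)
next
  case (Suc k)
  define E where "E n xs = (if \<forall>i\<le>q. length (filter (\<lambda>y. cl y = i) xs) = n i then 1 else 0 :: ennreal)" for n xs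
  define a where "a i = m * prob {y \<in> space M. cl y = i}" for i
  define W where "W n = (\<Prod>i\<le>q. a i ^ n i / fact (n i))" for n
  have a: "0 \<le> a i" for i using m by (simp add: a_def)
  have W: "0 \<le> W n" for n unfolding W_def by (intro prod_nonneg) (simp add: a)
  have E_meas: "list_measurable M (E n) borel" for n
    unfolding list_measurable_def E_def
  proof
    fix js
    have "(\<lambda>s. length (filter (\<lambda>y. cl y = i) (map ((!!) s) js))) \<in> measurable (stream_space M) (count_space UNIV)" for i
    proof (induction js)
      case (Cons j js)
      have eq: "(\<lambda>s. length (filter (\<lambda>y. cl y = i) (map ((!!) s) (j # js)))) =
        (\<lambda>s. (if cl (s !! j) = i then Suc (length (filter (\<lambda>y. cl y = i) (map ((!!) s) js)))
          else length (filter (\<lambda>y. cl y = i) (map ((!!) s) js))))"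
        by auto
      note [measurable] = Cons cl_meas
      show ?case unfolding eq by measurable
    qed simp
    note [measurable] = this
    show "(\<lambda>s. if \<forall>i\<le>q. length (filter (\<lambda>y. cl y = i) (map ((!!) s) js)) = n i then 1 else 0 :: ennreal)
      \<in> borel_measurable (stream_space M)"
      unfolding Ball_def[symmetric] atMost_iff[symmetric] by measurable
  qed
  \<comment> \<open>A point in a class that must stay empty contributes nothing; the truncated
    \<open>n i - 1\<close> would leave \<open>n\<close> unchanged there and give a wrong
    term.\<close>
  define h where "h i = (if 0 < n i then level_integral M m k (E (n(i := n i - 1))) else 0)" for i
  have E_Cons: "level_integral M m k (\<lambda>xs. E n (y # xs)) = h (cl y)" for y
  proof (cases "0 < n (cl y)")
    case True
    have "E n (y # xs) = E (n(cl y := n (cl y) - 1)) xs" for xs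
      unfolding E_def using True cl_le[of y] by (intro if_cong all_cong refl) auto
    then show ?thesis using True by (simp add: h_def)
  next
    case False
    then have "E n (y # xs) = 0" for xs
      unfolding E_def using cl_le[of y] by (auto intro!: exI[of _ "cl y"])
    then show ?thesis using False by (simp add: h_def level_integral_0)
  qed
  have "(\<integral>\<^sup>+y. h (cl y) \<partial>M) = (\<integral>\<^sup>+y. (\<Sum>i\<le>q. h i * indicator {y \<in> space M. cl y = i} y) \<partial>M)"
  proof (rule nn_integral_cong)
    fix y assume "y \<in> space M"
    then show "h (cl y) = (\<Sum>i\<le>q. h i * indicator {y \<in> space M. cl y = i} y)"
      using cl_le[of y] by (subst sum.remove[of _ "cl y"]) (auto intro!: sum.neutral)
  qed
  also have "\<dots> = (\<Sum>i\<le>q. h i * ennreal (prob {y \<in> space M. cl y = i}))"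
    using cl_meas by (subst nn_integral_sum) (auto simp: nn_integral_cmult_indicator emeasure_eq_measure)
  finally have "level_integral M m (Suc k) (E n) =
    ennreal (m / Suc k) * (\<Sum>i\<le>q. h i * ennreal (prob {y \<in> space M. cl y = i}))"
    unfolding level_integral_Suc[OF E_meas m] E_Cons by simp
  also have "\<dots> = ennreal ((\<Sum>i\<le>q. if Suc k = (\<Sum>i\<le>q. n i) then n i * W n else 0) / Suc k)"
  proof -
    have "ennreal m * (h i * ennreal (prob {y \<in> space M. cl y = i})) =
      ennreal (if Suc k = (\<Sum>i\<le>q. n i) then n i * W n else 0)" if i: "i \<le> q" for i
    proof (cases "0 < n i")
      case True
      let ?n = "n(i := n i - 1)"
      have "(\<Sum>j\<le>q. n j) = n i + (\<Sum>j\<in>{..q} - {i}. n j)" "(\<Sum>j\<le>q. ?n j) = n i - 1 + (\<Sum>j\<in>{..q} - {i}. n j)"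
        using i by (simp_all add: sum.remove[of "{..q}" i])
      then have k: "k = (\<Sum>j\<le>q. ?n j) \<longleftrightarrow> Suc k = (\<Sum>j\<le>q. n j)" using True by arith
      have "W n = a i ^ n i / fact (n i) * (\<Prod>j\<in>{..q} - {i}. a j ^ n j / fact (n j))"
        "W ?n = a i ^ (n i - 1) / fact (n i - 1) * (\<Prod>j\<in>{..q} - {i}. a j ^ n j / fact (n j))"
        unfolding W_def using i by (simp_all add: prod.remove[of "{..q}" i])
      moreover have "a i * (a i ^ (n i - 1) / fact (n i - 1)) = n i * (a i ^ n i / fact (n i))"
        using True by (cases "n i") (simp_all add: divide_simps)
      \<comment> \<open>The factor \<open>a i\<close> of a point in class \<open>i\<close> restores
        \<open>W n\<close> up to the factor \<open>n i\<close>; over all classes these factors add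
        up to \<open>Suc k\<close>, which cancels the denominator.\<close>
      ultimately have Wn: "a i * W ?n = n i * W n"
        by (metis (no_types, lifting) mult.assoc)
      have hi: "h i = ennreal (if k = (\<Sum>j\<le>q. ?n j) then W ?n else 0)"
        unfolding h_def E_def Suc.IH W_def a_def using True by (simp only: if_True)
      have "ennreal m * (h i * ennreal (prob {y \<in> space M. cl y = i})) =
        ennreal (a i * (if Suc k = (\<Sum>i\<le>q. n i) then W ?n else 0))"
        unfolding hi k a_def mult.assoc ennreal_mult'[OF m] ennreal_mult'[OF measure_nonneg]
        by (simp only: mult_ac)
      also have "a i * (if Suc k = (\<Sum>i\<le>q. n i) then W ?n else 0) = (if Suc k = (\<Sum>i\<le>q. n i) then n i * W n else 0)"
        using Wn by auto
      finally show ?thesis .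
    qed (simp add: h_def)
    then have "ennreal m * (\<Sum>i\<le>q. h i * ennreal (prob {y \<in> space M. cl y = i})) =
      ennreal (\<Sum>i\<le>q. if Suc k = (\<Sum>i\<le>q. n i) then n i * W n else 0)"
      unfolding sum_distrib_left using W by (subst sum_ennreal[symmetric]) auto
    moreover have "ennreal (m / Suc k) = ennreal (1 / Suc k) * ennreal m"
      using m by (simp add: ennreal_mult[symmetric])
    ultimately show ?thesis
      using W by (simp add: mult.assoc ennreal_mult[symmetric] sum_nonneg)
  qed
  also have "(\<Sum>i\<le>q. if Suc k = (\<Sum>i\<le>q. n i) then n i * W n else 0) / Suc k =
    (if Suc k = (\<Sum>i\<le>q. n i) then W n else 0)"
  proof (cases "Suc k = (\<Sum>i\<le>q. n i)")
    case True
    then have eq: "(\<Sum>i\<le>q. n i * W n) = real (Suc k) * W n" by (simp add: sum_distrib_right)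
    show ?thesis unfolding if_P[OF True] eq by simp
  qed simp
  finally show ?case unfolding E_def W_def a_def .
qed

text \<open>The sets are completed by a remainder class \<open>q\<close>. For a fixed total k its
  count must be k - \<sigma>, and summing over k frees it: the series \<open>exp r\<close> appears
  and reduces \<open>exp (- m)\<close> to the product of the \<open>exp (- a i)\<close>.\<close>

lemma level_integral_poisson_counts:
  fixes q :: nat
  assumes m: "0 \<le> m" and space: "space M = UNIV"
    and A: "\<And>i. i < q \<Longrightarrow> A i \<in> sets M" and disj: "disjoint_family_on A {..<q}"
  shows "(\<Sum>k. level_integral M m k (\<lambda>xs. ennreal (exp (- m)) *
      (if \<forall>i<q. length (filter (\<lambda>y. y \<in> A i) xs) = n i then 1 else 0))) =
    ennreal (\<Prod>i<q. exp (- (m * prob (A i))) * (m * prob (A i)) ^ n i / fact (n i))"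
proof -
  \<comment> \<open>Index of the set containing \<open>y\<close>; the alternative
    \<open>q \<le> i\<close> yields the value \<open>q\<close> outside all the sets.\<close>
  define cl where "cl y = (LEAST i. q \<le> i \<or> y \<in> A i)" for y
  have cl_le: "cl y \<le> q" for y
    unfolding cl_def by (rule Least_le) simp
  have cl_eq: "cl y = i \<longleftrightarrow> y \<in> A i" if "i < q" for y i
  proof
    assume "cl y = i"
    moreover have "q \<le> cl y \<or> y \<in> A (cl y)"
      unfolding cl_def by (rule LeastI[where k=q]) simp
    ultimately show "y \<in> A i" using that by auto
  next
    assume y: "y \<in> A i"
    show "cl y = i"
      unfolding cl_def
    proof (rule Least_equality)
      show "q \<le> i \<or> y \<in> A i" using y by simp
      fix j assume j: "q \<le> j \<or> y \<in> A j"
      show "i \<le> j"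
      proof (cases "j < q")
        case True
        then have "y \<in> A i \<inter> A j" using j y by auto
        then show ?thesis
          using disjoint_family_onD[OF disj, of i j] that True by force
      qed (use that in simp)
    qed
  qed
  have cl_q: "cl y = q \<longleftrightarrow> y \<notin> (\<Union>i<q. A i)" for y
  proof
    assume "cl y = q"
    then show "y \<notin> (\<Union>i<q. A i)" using cl_eq[of _ y] by fastforce
  next
    assume "y \<notin> (\<Union>i<q. A i)"
    then show "cl y = q" using cl_le[of y] cl_eq[of "cl y" y] by (auto simp: le_less)
  qed
  define R where "R = space M - (\<Union>i<q. A i)"
  have R: "R \<in> sets M" unfolding R_def using A by auto
  have cl_set: "{y \<in> space M. cl y = i} = (if i < q then A i else if i = q then R else {})" for i
  proof -
    consider "i < q" | "i = q" | "q < i" by linarith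
    then show ?thesis
    proof cases
      case 1 then show ?thesis using cl_eq[of i] by (simp add: space)
    next
      case 2 then show ?thesis using cl_q by (auto simp: R_def space)
    next
      case 3 then show ?thesis using cl_le by (auto simp: space not_le[symmetric])
    qed
  qed
  have cl_meas: "cl \<in> measurable M (count_space UNIV)"
  proof (subst measurable_count_space_eq2_countable)
    show "cl \<in> space M \<rightarrow> UNIV \<and> (\<forall>i\<in>UNIV. cl -` {i} \<inter> space M \<in> sets M)"
      using A R cl_set by (auto simp: vimage_def Int_def conj_commute)
  qed
  define a where "a i = m * prob (A i)" for i
  define r where "r = m * prob R"
  define \<sigma> where "\<sigma> = (\<Sum>i<q. n i)"
  define P where "P = (\<Prod>i<q. a i ^ n i / fact (n i))"
  have P: "0 \<le> P" unfolding P_def a_def using m by (intro prod_nonneg) simp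
  have r: "0 \<le> r" using m by (simp add: r_def)
  have total: "(\<Sum>i\<le>q. length (filter (\<lambda>y. cl y = i) xs)) = length xs" for xs
  proof (induction xs)
    case (Cons x xs)
    have "(\<Sum>i\<le>q. length (filter (\<lambda>y. cl y = i) (x # xs))) =
      (\<Sum>i\<le>q. (if cl x = i then 1 else 0) + length (filter (\<lambda>y. cl y = i) xs))"
      by (intro sum.cong) auto
    then show ?case using Cons cl_le[of x] by (simp add: sum.distrib)
  qed simp
  have level: "level_integral M m k (\<lambda>xs. if \<forall>i<q. length (filter (\<lambda>y. y \<in> A i) xs) = n i then 1 else 0) =
    ennreal (if \<sigma> \<le> k then P * (r ^ (k - \<sigma>) / fact (k - \<sigma>)) else 0)" for k
  proof -
    let ?n = "n(q := k - \<sigma>)"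
    have sum_lt: "(\<Sum>i<q. ?n i) = \<sigma>" unfolding \<sigma>_def by (intro sum.cong) auto
    have split: "(\<Sum>i\<le>q. f i) = (\<Sum>i<q. f i) + f q" for f :: "nat \<Rightarrow> nat"
      by (simp add: lessThan_Suc_atMost[symmetric])
    have "level_integral M m k (\<lambda>xs. if \<forall>i<q. length (filter (\<lambda>y. y \<in> A i) xs) = n i then 1 else 0) =
      level_integral M m k (\<lambda>xs. if \<forall>i\<le>q. length (filter (\<lambda>y. cl y = i) xs) = ?n i then 1 else 0)"
    proof (intro level_integral_cong if_cong refl iffI)
      fix xs :: "'a list" assume len: "length xs = k"
      let ?c = "\<lambda>i. length (filter (\<lambda>y. cl y = i) xs)"
      assume A_eq: "\<forall>i<q. length (filter (\<lambda>y. y \<in> A i) xs) = n i"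
      have lt: "?c i = n i" if "i < q" for i
        using A_eq that unfolding cl_eq[OF that] by blast
      have "(\<Sum>i<q. ?c i) = \<sigma>"
        unfolding \<sigma>_def by (intro sum.cong refl lt) simp
      then have q: "?c q = k - \<sigma>"
        using total[of xs] len split[of ?c] by linarith
      show "\<forall>i\<le>q. ?c i = ?n i"
      proof (intro allI impI)
        fix i assume "i \<le> q"
        then show "?c i = ?n i" using lt[of i] q by (cases "i = q") simp_all
      qed
    next
      fix xs assume c: "\<forall>i\<le>q. length (filter (\<lambda>y. cl y = i) xs) = ?n i"
      show "\<forall>i<q. length (filter (\<lambda>y. y \<in> A i) xs) = n i"
      proof (intro allI impI)
        fix i assume i: "i < q"
        then show "length (filter (\<lambda>y. y \<in> A i) xs) = n i"
          using c[rule_format, of i] unfolding cl_eq[OF i] by simp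
      qed
    qed
    also have "\<dots> = ennreal (if k = (\<Sum>i\<le>q. ?n i) then \<Prod>i\<le>q. (m * prob {y \<in> space M. cl y = i}) ^ ?n i / fact (?n i) else 0)"
      by (rule level_integral_counts[OF m cl_le cl_meas])
    also have "k = (\<Sum>i\<le>q. ?n i) \<longleftrightarrow> \<sigma> \<le> k"
      unfolding split sum_lt by auto
    also have "(\<Prod>i\<le>q. (m * prob {y \<in> space M. cl y = i}) ^ ?n i / fact (?n i)) =
      P * (r ^ (k - \<sigma>) / fact (k - \<sigma>))"
      unfolding lessThan_Suc_atMost[symmetric] cl_set P_def a_def r_def by simp
    finally show ?thesis .
  qed
  have m_eq: "m = (\<Sum>i<q. a i) + r"
  proof -
    have "prob (\<Union>i\<in>{..<q}. A i) = (\<Sum>i<q. prob (A i))"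
      using A disj by (intro finite_measure_finite_Union) auto
    moreover have "prob R = 1 - prob (\<Union>i\<in>{..<q}. A i)"
      unfolding R_def using A by (intro prob_compl) auto
    ultimately show ?thesis
      unfolding a_def r_def by (simp add: sum_distrib_left[symmetric] distrib_left[symmetric])
  qed
  have "(\<lambda>j. exp (- m) * P * (r ^ j / fact j)) sums (exp (- m) * P * exp r)"
    using exp_converges[of r] by (intro sums_mult) (simp add: field_simps)
  \<comment> \<open>Fewer than \<sigma> points cannot fill the prescribed counts, hence an
    exponential series shifted by \<sigma>.\<close>
  define F where "F k = (if \<sigma> \<le> k then exp (- m) * P * (r ^ (k - \<sigma>) / fact (k - \<sigma>)) else 0)" for k
  have "(\<lambda>j. F (j + \<sigma>)) sums (exp (- m) * P * exp r)"
    using \<open>(\<lambda>j. exp (- m) * P * (r ^ j / fact j)) sums _\<close> by (simp add: F_def)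
  then have "F sums (exp (- m) * P * exp r + (\<Sum>k<\<sigma>. F k))"
    by (rule iffD1[OF sums_iff_shift])
  moreover have "(\<Sum>k<\<sigma>. F k) = 0" by (intro sum.neutral) (simp add: F_def)
  ultimately have sums: "F sums (exp (- m) * P * exp r)" by simp
  have scale: "level_integral M m k (\<lambda>xs. ennreal (exp (- m)) * f xs) = ennreal (exp (- m)) * level_integral M m k f"
    if "list_measurable M f borel" for k f
    unfolding level_integral_def by (simp add: nn_integral_cmult list_measurable_stake[OF that] mult_ac)
  have ind: "list_measurable M (\<lambda>xs. if \<forall>i<q. length (filter (\<lambda>y. y \<in> A i) xs) = n i then 1 else 0 :: ennreal) borel"
    unfolding list_measurable_def
  proof
    fix js
    have "(\<lambda>s. length (filter (\<lambda>y. y \<in> A i) (map ((!!) s) js))) \<in> measurable (stream_space M) (count_space UNIV)"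
      if "i \<in> {..<q}" for i
    proof (induction js)
      case (Cons j js)
      have eq: "(\<lambda>s. length (filter (\<lambda>y. y \<in> A i) (map ((!!) s) (j # js)))) =
        (\<lambda>s. (if s !! j \<in> A i then Suc (length (filter (\<lambda>y. y \<in> A i) (map ((!!) s) js)))
          else length (filter (\<lambda>y. y \<in> A i) (map ((!!) s) js))))"
        by auto
      have [measurable]: "A i \<in> sets M" using A that by simp
      note [measurable] = Cons
      show ?case unfolding eq by measurable
    qed simp
    then have "Measurable.pred (stream_space M) (\<lambda>s. length (filter (\<lambda>y. y \<in> A i) (map ((!!) s) js)) = n i)"
      if "i \<in> {..<q}" for i
      using that by measurable
    then have "{s \<in> space (stream_space M). \<forall>i\<in>{..<q}. length (filter (\<lambda>y. y \<in> A i) (map ((!!) s) js)) = n i} \<in> sets (stream_space M)"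
      unfolding pred_def by (intro sets.sets_Collect_finite_All) blast+
    then have S: "{s \<in> space (stream_space M). \<forall>i<q. length (filter (\<lambda>y. y \<in> A i) (map ((!!) s) js)) = n i} \<in> sets (stream_space M)"
      unfolding Ball_def lessThan_iff .
    show "(\<lambda>s. if \<forall>i<q. length (filter (\<lambda>y. y \<in> A i) (map ((!!) s) js)) = n i then 1 else 0 :: ennreal)
      \<in> borel_measurable (stream_space M)"
      by (rule measurable_If[OF measurable_const measurable_const S]) simp_all
  qed
  have "level_integral M m k (\<lambda>xs. ennreal (exp (- m)) *
      (if \<forall>i<q. length (filter (\<lambda>y. y \<in> A i) xs) = n i then 1 else 0)) = ennreal (F k)" for k
    unfolding scale[OF ind] level by (subst ennreal_mult'[symmetric]) (auto simp: F_def mult.assoc)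
  then have "(\<Sum>k. level_integral M m k (\<lambda>xs. ennreal (exp (- m)) *
      (if \<forall>i<q. length (filter (\<lambda>y. y \<in> A i) xs) = n i then 1 else 0))) = (\<Sum>k. ennreal (F k))"
    by (simp only:)
  also have "\<dots> = ennreal (exp (- m) * P * exp r)"
    using sums P r by (subst suminf_ennreal2) (auto simp: sums_iff F_def)
  also have "exp (- m) * P * exp r = exp (- (\<Sum>i<q. a i)) * P"
    unfolding exp_minus by (subst m_eq) (simp add: exp_add field_simps)
  also have "\<dots> = (\<Prod>i<q. exp (- a i) * a i ^ n i / fact (n i))"
    unfolding P_def sum_negf[symmetric] by (simp add: exp_sum prod.distrib[symmetric])
  finally show ?thesis unfolding a_def .
qed

end

section \<open>Laws of the two processes\<close>

text \<open>The definition of a Poisson process prescribes counts only. By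
  \<open>config_space_eqI\<close> they determine the law, and the measure giving k independent
  points the weight exp (- m) m^k / k! has the same counts.\<close>

lemma poisson_law_eqI:
  fixes N :: "'a::metric_space measure" and \<mu> :: "'a measure measure"
  assumes Z: "poisson_point_process \<Omega> \<zeta> M"
    and N: "prob_space N" "sets N = sets borel" and m: "0 \<le> m"
    and M: "\<And>A. A \<in> sets borel \<Longrightarrow> measure M A = m * measure N A"
    and sets_\<mu>: "sets \<mu> = sets config_space"
    and \<mu>: "\<And>S. S \<in> sets config_space \<Longrightarrow> emeasure \<mu> S =
      (\<Sum>k. level_integral N m k (\<lambda>xs. ennreal (exp (- m)) * indicator S (list_config xs)))"
  shows "\<mu> = law \<Omega> \<zeta>"
proof (rule config_space_eqI)
  interpret N: prob_space N by fact
  have pp: "point_process \<Omega> \<zeta>" using Z by (simp add: poisson_point_process_def)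
  then interpret P: prob_space \<Omega> by (simp add: point_process_def)
  have \<zeta>: "\<zeta> \<in> measurable \<Omega> config_space" using pp by (simp add: point_process_def)
  have space_N: "space N = UNIV" using N(2) sets_eq_imp_space_eq by fastforce
  show "sets \<mu> = sets config_space" by fact
  show "sets (law \<Omega> \<zeta>) = sets config_space" by (simp add: law_def)
  have fdd: "emeasure \<mu> {\<phi> \<in> configurations. \<forall>i<q. emeasure \<phi> (A i) = of_nat (n i)} =
      ennreal (\<Prod>i<q. exp (- measure M (A i)) * measure M (A i) ^ n i / fact (n i))"
    and fdd_meas: "{\<phi> \<in> configurations. \<forall>i<q. emeasure \<phi> (A i) = of_nat (n i)} \<in> sets config_space"
    if A: "\<And>i. i < q \<Longrightarrow> A i \<in> relcompact_borel" and disj: "disjoint_family_on A {..<q}"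
    for q :: nat and A :: "nat \<Rightarrow> 'a set" and n :: "nat \<Rightarrow> nat"
  proof -
    let ?X = "{\<phi> \<in> configurations. \<forall>i<q. emeasure \<phi> (A i) = of_nat (n i)}"
    have "{\<phi> \<in> space config_space. \<forall>i\<in>{..<q}. emeasure \<phi> (A i) = of_nat (n i)} \<in> sets config_space"
    proof (intro sets.sets_Collect_finite_All)
      fix i assume "i \<in> {..<q}"
      then have [measurable]: "(\<lambda>\<phi>. emeasure \<phi> (A i)) \<in> borel_measurable config_space"
        by (intro measurable_emeasure_config A) simp
      show "{\<phi> \<in> space config_space. emeasure \<phi> (A i) = of_nat (n i)} \<in> sets config_space"
        by measurable
    qed simp
    then show X: "?X \<in> sets config_space"
      unfolding Ball_def lessThan_iff space_config_space .
    have borel: "A i \<in> sets borel" if "i < q" for i using A[OF that] by (rule sets_relcompact_borel)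
    have "indicator ?X (list_config xs) = (if \<forall>i<q. length (filter (\<lambda>y. y \<in> A i) xs) = n i then 1 else 0 :: ennreal)" for xs
    proof -
      have "emeasure (list_config xs) (A i) = of_nat (n i) \<longleftrightarrow> length (filter (\<lambda>y. y \<in> A i) xs) = n i" if "i < q" for i
        unfolding emeasure_list_config[OF borel[OF that]] ennreal_of_nat_eq_real_of_nat by simp
      then show ?thesis by (auto simp: indicator_def list_config_in)
    qed
    then have "emeasure \<mu> ?X = (\<Sum>k. level_integral N m k (\<lambda>xs. ennreal (exp (- m)) *
        (if \<forall>i<q. length (filter (\<lambda>y. y \<in> A i) xs) = n i then 1 else 0)))"
      by (simp only: \<mu>[OF X])
    also have "\<dots> = ennreal (\<Prod>i<q. exp (- (m * measure N (A i))) * (m * measure N (A i)) ^ n i / fact (n i))"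
      by (rule N.level_integral_poisson_counts[OF m space_N _ disj]) (simp add: N borel)
    finally show "emeasure \<mu> ?X = ennreal (\<Prod>i<q. exp (- measure M (A i)) * measure M (A i) ^ n i / fact (n i))"
      by (simp add: M borel)
  qed
  show "finite_measure \<mu>"
  proof
    \<comment> \<open>The case of no sets at all: the empty product is the total mass.\<close>
    have "emeasure \<mu> configurations = 1"
      using fdd[of 0 "\<lambda>_. {}" "\<lambda>_. 0"] by (simp add: disjoint_family_on_def)
    then show "emeasure \<mu> (space \<mu>) \<noteq> \<infinity>"
      using sets_eq_imp_space_eq[OF sets_\<mu>] by (simp add: space_config_space)
  qed
  fix q :: nat and A :: "nat \<Rightarrow> 'a set" and n :: "nat \<Rightarrow> nat"
  assume A: "\<And>i. i < q \<Longrightarrow> A i \<in> relcompact_borel" and disj: "disjoint_family_on A {..<q}"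
  let ?X = "{\<phi> \<in> configurations. \<forall>i<q. emeasure \<phi> (A i) = of_nat (n i)}"
  let ?S = "\<lambda>i. (\<lambda>\<omega>. emeasure (\<zeta> \<omega>) (A i)) -` {of_nat (n i)} \<inter> space \<Omega>"
  have "emeasure (law \<Omega> \<zeta>) ?X = emeasure \<Omega> (\<zeta> -` ?X \<inter> space \<Omega>)"
    unfolding law_def by (rule emeasure_distr[OF \<zeta> fdd_meas[OF A disj]])
  also have "\<dots> = ennreal (\<Prod>i<q. exp (- measure M (A i)) * measure M (A i) ^ n i / fact (n i))"
  \<comment> \<open>The product rule for independent variables is applied to a nonempty index set;
    with no sets the event is the whole space.\<close>
  proof (cases "q = 0")
    case True
    then have "\<zeta> -` ?X \<inter> space \<Omega> = space \<Omega>"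
      using measurable_space[OF \<zeta>] by (auto simp: space_config_space)
    then show ?thesis using True by (simp add: P.emeasure_space_1)
  next
    case False
    then have eq: "\<zeta> -` ?X \<inter> space \<Omega> = (\<Inter>i\<in>{..<q}. ?S i)"
      using measurable_space[OF \<zeta>] by (auto simp: space_config_space)
    have "P.indep_vars (\<lambda>_. borel) (\<lambda>i \<omega>. emeasure (\<zeta> \<omega>) (A i)) {..<q}"
      using Z A disj unfolding poisson_point_process_def by blast
    from P.indep_varsD[OF this, of "{..<q}" "\<lambda>i. {of_nat (n i)}"]
    have "P.prob (\<Inter>i\<in>{..<q}. ?S i) = (\<Prod>i<q. P.prob (?S i))"
      using False by (simp add: lessThan_empty_iff)
    also have "\<dots> = (\<Prod>i<q. exp (- measure M (A i)) * measure M (A i) ^ n i / fact (n i))"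
    proof (intro prod.cong refl)
      fix i assume "i \<in> {..<q}"
      then have "A i \<in> relcompact_borel" using A by simp
      moreover have "?S i = {\<omega> \<in> space \<Omega>. emeasure (\<zeta> \<omega>) (A i) = of_nat (n i)}" by auto
      ultimately show "P.prob (?S i) = exp (- measure M (A i)) * measure M (A i) ^ n i / fact (n i)"
        using Z unfolding poisson_point_process_def by simp
    qed
    finally show ?thesis
      unfolding eq P.emeasure_eq_measure by simp
  qed
  finally show "emeasure \<mu> ?X = emeasure (law \<Omega> \<zeta>) ?X"
    by (simp only: fdd[OF A disj])
qed

section \<open>Passing from product measures to independent sequences\<close>

lemma (in prob_space) list_measurable_PiM:
  assumes F: "list_measurable M F K" and l: "sets l = sets M"
  shows "(\<lambda>x. F (map x [1..<Suc k])) \<in> measurable (\<Pi>\<^sub>M i\<in>{1..k}. l) K"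
proof -
  \<comment> \<open>The tuple is filled up to a sequence by a constant; only the coordinates 1, ...,
    k are read.\<close>
  obtain c where c: "c \<in> space M" using not_empty by blast
  define s where "s x = to_stream (\<lambda>i. if i \<in> {1..k} then x i else c)" for x :: "nat \<Rightarrow> 'a"
  have "s \<in> measurable (\<Pi>\<^sub>M i\<in>{1..k}. l) (stream_space M)"
  proof (rule measurable_stream_space2)
    fix i
    show "(\<lambda>x. s x !! i) \<in> measurable (\<Pi>\<^sub>M i\<in>{1..k}. l) M"
    proof (cases "i \<in> {1..k}")
      case True
      then have "(\<lambda>x. x i) \<in> measurable (\<Pi>\<^sub>M i\<in>{1..k}. l) l"
        by (rule measurable_component_singleton)
      then show ?thesis
        using True by (simp add: s_def to_stream_def measurable_cong_sets[OF refl l])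
    next
      case False
      then have "(\<lambda>x. s x !! i) = (\<lambda>x. c)" by (auto simp: s_def to_stream_def)
      then show ?thesis using c by simp
    qed
  qed
  from measurable_compose[OF this list_measurableD[OF F, of "[1..<Suc k]"]]
  have "(\<lambda>x. F (map ((!!) (s x)) [1..<Suc k])) \<in> measurable (\<Pi>\<^sub>M i\<in>{1..k}. l) K" .
  moreover have "map ((!!) (s x)) [1..<Suc k] = map x [1..<Suc k]" for x
    by (intro map_cong refl) (auto simp: s_def to_stream_def)
  ultimately show ?thesis by (simp only:)
qed

lemma list_measurable_rotate1:
  "list_measurable N F K \<Longrightarrow> list_measurable N (\<lambda>xs. F (rotate1 xs)) K"
  unfolding list_measurable_def by (simp add: rotate1_map)

text \<open>The density \<rho> turns each factor of the product into \<open>m\<close> times a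
  probability measure. Coordinates are split off at the last index, streams at the head:
  \<open>rotate1\<close> passes between the two, and exchangeability removes it again.\<close>

lemma (in prob_space) nn_integral_PiM_stream:
  fixes \<rho> :: "'a \<Rightarrow> ennreal"
  assumes l: "sigma_finite_measure l" "sets l = sets M"
    and \<rho>: "\<rho> \<in> borel_measurable l" and m: "0 \<le> m"
    and M: "\<And>h. h \<in> borel_measurable M \<Longrightarrow> (\<integral>\<^sup>+y. \<rho> y * h y \<partial>l) = ennreal m * (\<integral>\<^sup>+y. h y \<partial>M)"
    and F: "list_measurable M F borel"
  shows "(\<integral>\<^sup>+x. (\<Prod>i\<in>{1..k}. \<rho> (x i)) * F (map x [1..<Suc k]) \<partial>(\<Pi>\<^sub>M i\<in>{1..k}. l)) =
    ennreal (m ^ k) * (\<integral>\<^sup>+s. F (stake k s) \<partial>stream_space M)"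
  using F
proof (induction k arbitrary: F)
  case 0
  interpret stream: prob_space "stream_space M" by (rule prob_space_stream_space)
  interpret product_sigma_finite "\<lambda>_::nat. l" by (simp add: product_sigma_finite_def l)
  show ?case by (simp add: space_PiM stream.emeasure_space_1)
next
  case (Suc k)
  interpret product_sigma_finite "\<lambda>_::nat. l" by (simp add: product_sigma_finite_def l)
  define G where "G zs = F (rotate1 zs)" for zs
  have G: "list_measurable M G borel" unfolding G_def by (rule list_measurable_rotate1[OF Suc.prems])
  have set: "{1..Suc k} = insert (Suc k) {1..k}" by auto
  have meas: "(\<lambda>x. (\<Prod>i\<in>{1..Suc k}. \<rho> (x i)) * F (map x [1..<Suc (Suc k)]))
      \<in> borel_measurable (\<Pi>\<^sub>M i\<in>{1..Suc k}. l)"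
  proof (intro borel_measurable_times_ennreal borel_measurable_prod_ennreal list_measurable_PiM[OF Suc.prems l(2)])
    fix i assume "i \<in> {1..Suc k}"
    then show "(\<lambda>x. \<rho> (x i)) \<in> borel_measurable (\<Pi>\<^sub>M i\<in>{1..Suc k}. l)"
      by (intro measurable_compose[OF _ \<rho>] measurable_component_singleton)
  qed
  have meas_G: "(\<lambda>y. G (y # map x [1..<Suc k])) \<in> borel_measurable M" if x: "x \<in> space (\<Pi>\<^sub>M i\<in>{1..k}. l)" for x
  proof -
    obtain c where c: "c \<in> space M" using not_empty by blast
    let ?s = "map x [1..<Suc k] @- sconst c"
    have "set (map x [1..<Suc k]) \<subseteq> space M"
      using x sets_eq_imp_space_eq[OF l(2)] by (auto simp: space_PiM PiE_iff)
    then have s: "?s \<in> space (stream_space M)"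
      using c by (auto simp: space_stream_space streams_iff_sset)
    have "(\<lambda>y. (\<lambda>(y, s). G (y # map ((!!) s) [0..<k])) (y, ?s)) \<in> borel_measurable M"
      by (rule measurable_compose[OF _ list_measurable_Cons_pair[OF G]]) (use s in simp)
    moreover have "map ((!!) ?s) [0..<k] = map x [1..<Suc k]"
      by (rule nth_equalityI) (auto simp del: upt_Suc)
    ultimately show ?thesis by simp
  qed
  have "(\<integral>\<^sup>+x. (\<Prod>i\<in>{1..Suc k}. \<rho> (x i)) * F (map x [1..<Suc (Suc k)]) \<partial>(\<Pi>\<^sub>M i\<in>{1..Suc k}. l)) =
    (\<integral>\<^sup>+x. \<integral>\<^sup>+y. (\<Prod>i\<in>{1..Suc k}. \<rho> ((x(Suc k := y)) i)) * F (map (x(Suc k := y)) [1..<Suc (Suc k)]) \<partial>l \<partial>(\<Pi>\<^sub>M i\<in>{1..k}. l))"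
    using meas unfolding set by (intro product_nn_integral_insert) auto
  also have "\<dots> = (\<integral>\<^sup>+x. (\<Prod>i\<in>{1..k}. \<rho> (x i)) * (ennreal m * (\<integral>\<^sup>+y. G (y # map x [1..<Suc k]) \<partial>M)) \<partial>(\<Pi>\<^sub>M i\<in>{1..k}. l))"
  proof (rule nn_integral_cong)
    fix x assume x: "x \<in> space (\<Pi>\<^sub>M i\<in>{1..k}. l)"
    have "(\<Prod>i\<in>{1..Suc k}. \<rho> ((x(Suc k := y)) i)) = (\<Prod>i\<in>{1..k}. \<rho> (x i)) * \<rho> y" for y
      unfolding set by (subst prod.insert) (auto simp: mult.commute intro!: prod.cong)
    moreover have "map (x(Suc k := y)) [1..<Suc (Suc k)] = map x [1..<Suc k] @ [y]" for y
      by simp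
    ultimately have "(\<integral>\<^sup>+y. (\<Prod>i\<in>{1..Suc k}. \<rho> ((x(Suc k := y)) i)) * F (map (x(Suc k := y)) [1..<Suc (Suc k)]) \<partial>l) =
      (\<integral>\<^sup>+y. (\<Prod>i\<in>{1..k}. \<rho> (x i)) * (\<rho> y * G (y # map x [1..<Suc k])) \<partial>l)"
      unfolding G_def by (simp only: rotate1.simps mult.assoc)
    also have "\<dots> = (\<Prod>i\<in>{1..k}. \<rho> (x i)) * (\<integral>\<^sup>+y. \<rho> y * G (y # map x [1..<Suc k]) \<partial>l)"
      using \<rho> meas_G[OF x] by (intro nn_integral_cmult borel_measurable_times_ennreal) (simp_all add: measurable_cong_sets[OF l(2) refl])
    finally show "(\<integral>\<^sup>+y. (\<Prod>i\<in>{1..Suc k}. \<rho> ((x(Suc k := y)) i)) * F (map (x(Suc k := y)) [1..<Suc (Suc k)]) \<partial>l) =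
      (\<Prod>i\<in>{1..k}. \<rho> (x i)) * (ennreal m * (\<integral>\<^sup>+y. G (y # map x [1..<Suc k]) \<partial>M))"
      by (simp only: M[OF meas_G[OF x]])
  qed
  also have "\<dots> = ennreal (m ^ k) * (\<integral>\<^sup>+s. ennreal m * (\<integral>\<^sup>+y. G (y # stake k s) \<partial>M) \<partial>stream_space M)"
    by (rule Suc.IH[of "\<lambda>xs. ennreal m * (\<integral>\<^sup>+y. G (y # xs) \<partial>M)"])
      (rule list_measurable_compose[OF list_measurable_nn_integral[OF G]], simp)
  also have "\<dots> = ennreal (m ^ k) * (ennreal m * (\<integral>\<^sup>+s. G (stake (Suc k) s) \<partial>stream_space M))"
    unfolding nn_integral_stake_Suc'[OF G]
    by (subst nn_integral_cmult) (simp_all add: list_measurable_stake[OF list_measurable_nn_integral[OF G]])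
  also have "(\<integral>\<^sup>+s. G (stake (Suc k) s) \<partial>stream_space M) = (\<integral>\<^sup>+s. F (stake (Suc k) s) \<partial>stream_space M)"
    using nn_integral_stream_reindex[OF Suc.prems, of "rotate1 [0..<Suc k]"]
    unfolding G_def stake_conv_map_snth rotate1_map by (simp del: upt_Suc)
  also have "ennreal (m ^ k) * (ennreal m * (\<integral>\<^sup>+s. F (stake (Suc k) s) \<partial>stream_space M)) =
      ennreal (m ^ Suc k) * (\<integral>\<^sup>+s. F (stake (Suc k) s) \<partial>stream_space M)"
    using m by (simp add: ennreal_mult mult_ac)
  finally show ?case .
qed

lemma normalize_finite_measure:
  assumes fin: "finite_measure M" and ne: "space M \<noteq> {}"
  shows "\<exists>N. prob_space N \<and> sets N = sets M \<and>
    (\<forall>h\<in>borel_measurable M. (\<integral>\<^sup>+y. h y \<partial>M) = ennreal (measure M (space M)) * (\<integral>\<^sup>+y. h y \<partial>N))"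
proof -
  interpret finite_measure M by fact
  define m where "m = measure M (space M)"
  show ?thesis
  proof (cases "m = 0")
    \<comment> \<open>For the zero measure any probability measure serves; a Dirac measure is
      taken.\<close>
    case True
    obtain x where x: "x \<in> space M" using ne by blast
    have "emeasure M (space M) = 0" using True by (simp add: m_def emeasure_eq_measure)
    then have "AE y in M. False" by (intro AE_I[of _ _ "space M"]) auto
    then have "(\<integral>\<^sup>+y. h y \<partial>M) = 0" for h
      by (subst nn_integral_cong_AE[where v="\<lambda>_. 0"]) auto
    then show ?thesis
      using x True by (intro exI[of _ "return M x"]) (auto simp: prob_space_return m_def)
  next
    case False
    then have m: "0 < m" by (simp add: m_def zero_less_measure_iff)
    let ?N = "density M (\<lambda>_. ennreal (1 / m))"
    have "ennreal (1 / m) * ennreal m = 1" using m by (simp add: ennreal_mult[symmetric])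
    then have *: "ennreal m * ennreal (1 / m) = 1" by (simp add: mult.commute)
    show ?thesis
    proof (intro exI[of _ ?N] conjI ballI)
      show "prob_space ?N"
      proof
        have "emeasure ?N (space ?N) = ennreal (1 / m) * ennreal m"
          by (simp add: emeasure_density nn_integral_cmult_indicator emeasure_eq_measure m_def)
        then show "emeasure ?N (space ?N) = 1" using * by (simp add: mult.commute)
      qed
      show "(\<integral>\<^sup>+y. h y \<partial>M) = ennreal (measure M (space M)) * (\<integral>\<^sup>+y. h y \<partial>?N)"
        if [measurable]: "h \<in> borel_measurable M" for h
        using * by (simp add: nn_integral_density nn_integral_cmult m_def[symmetric] mult.assoc[symmetric])
    qed simp
  qed
qed

section \<open>The coupling\<close>

lemma emeasure_distr_eq_nn_integral:
  assumes "T \<in> measurable M K" "S \<in> sets K"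
  shows "emeasure (distr M K T) S = (\<integral>\<^sup>+x. indicator S (T x) \<partial>M)"
proof -
  have "emeasure (distr M K T) S = (\<integral>\<^sup>+y. indicator S y \<partial>distr M K T)"
    using assms by simp
  also have "\<dots> = (\<integral>\<^sup>+x. indicator S (T x) \<partial>M)"
    using assms by (intro nn_integral_distr) simp_all
  finally show ?thesis .
qed

context normalized_repulsive
begin

lemma mset_delete_path_subset: "path_weight p xs \<noteq> 0 \<Longrightarrow> mset (delete_path p xs) \<subseteq># mset xs"
proof (induction p arbitrary: xs)
  case (Cons i p)
  then have i: "i < length xs" and "path_weight p (remove_nth i xs) \<noteq> 0" by (auto split: if_splits)
  then have "mset (delete_path (i # p) xs) \<subseteq># mset (remove_nth i xs)"
    using Cons.IH by simp
  also have "\<dots> \<subseteq># mset xs"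
    unfolding mset_remove_nth[OF i, symmetric] by simp
  finally show ?case .
qed simp

lemma measurable_delete_path_pair:
  assumes c: "list_measurable N c K"
  shows "(\<lambda>((n, p), s). (c (delete_path p (stake n s)), c (stake n s))) \<in> measurable path_space (K \<Otimes>\<^sub>M K)"
proof -
  have "(\<lambda>((n, p), s). c (delete_path p (stake n s))) \<in> measurable (count_space UNIV \<Otimes>\<^sub>M stream_space N) K"
    "(\<lambda>((n::nat, p::nat list), s). c (stake n s)) \<in> measurable (count_space UNIV \<Otimes>\<^sub>M stream_space N) K"
    by (rule measurable_path_space, intro list_measurable_delete_path c)+
  from measurable_Pair[OF this] show ?thesis
    unfolding path_space_def by (simp add: case_prod_unfold)
qed

text \<open>The first marginal is the transport property for indicators. In the second the path is
  ignored, and its weights sum to one.\<close>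

lemma emeasure_path_space_marginals:
  assumes c: "list_measurable N c K" and S: "S \<in> sets K"
  shows "emeasure (distr path_space K (\<lambda>((n, p), s). c (delete_path p (stake n s)))) S =
      (\<Sum>n. level n (\<lambda>xs. ennreal (C * g (mset xs)) * indicator S (c xs)))" (is ?first)
    and "emeasure (distr path_space K (\<lambda>((n, p), s). c (stake n s))) S =
      (\<Sum>n. level n (\<lambda>xs. ennreal (exp (- m)) * indicator S (c xs)))" (is ?second)
proof -
  have T: "(\<lambda>((n, p), s). c (delete_path p (stake n s))) \<in> measurable path_space K"
    "(\<lambda>((n, p), s). c (stake n s)) \<in> measurable path_space K"
    using measurable_compose[OF measurable_delete_path_pair[OF c] measurable_fst]
      measurable_compose[OF measurable_delete_path_pair[OF c] measurable_snd]
    by (simp_all add: case_prod_unfold)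
  have ind: "list_measurable N (\<lambda>xs. indicator S (c xs) :: ennreal) borel"
    by (rule list_measurable_compose[OF c]) (use S in simp)
  have "emeasure (distr path_space K (\<lambda>((n, p), s). c (delete_path p (stake n s)))) S =
    (\<integral>\<^sup>+((n, p), s). indicator S (c (delete_path p (stake n s))) \<partial>path_space)"
    unfolding emeasure_distr_eq_nn_integral[OF T(1) S] by (simp add: case_prod_unfold)
  also have "\<dots> = (\<Sum>n. level n (\<lambda>xs. ennreal (exp (- m)) * chain (\<lambda>xs. indicator S (c xs)) xs))"
    unfolding chain_conv_path_mean
    by (rule nn_integral_path_space[OF list_measurable_delete_path[OF ind]])
  also have "\<dots> = (\<Sum>n. level n (\<lambda>xs. ennreal (C * g (mset xs)) * indicator S (c xs)))"
    by (rule chain_transports[OF ind]) (simp add: indicator_def)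
  finally show ?first .
  have "emeasure (distr path_space K (\<lambda>((n, p), s). c (stake n s))) S =
    (\<integral>\<^sup>+((n, p), s). indicator S (c (stake n s)) \<partial>path_space)"
    unfolding emeasure_distr_eq_nn_integral[OF T(2) S] by (simp add: case_prod_unfold)
  also have "\<dots> = (\<Sum>n. level n (\<lambda>xs. ennreal (exp (- m)) * path_mean (\<lambda>p xs. indicator S (c xs)) xs))"
    by (rule nn_integral_path_space[OF ind])
  also have "path_mean (\<lambda>p xs. indicator S (c xs)) = (\<lambda>xs. indicator S (c xs))"
  proof
    fix xs
    show "path_mean (\<lambda>p xs. indicator S (c xs)) xs = indicator S (c xs)"
      using chain_cmult_1[of "indicator S (c xs)" xs] by (simp add: path_mean_def chain_def)
  qed
  finally show ?second .
qed

end

text \<open>An expression free of any order of the points, hence a function of the multiset. The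
  subtracted diagonal removes only the interaction of a point with itself; two points at the same
  place still interact.\<close>

definition pair_energy :: "('a \<times> 'a \<Rightarrow> real) \<Rightarrow> 'a multiset \<Rightarrow> real" where
  "pair_energy \<Psi> \<phi> = ((\<Sum>y\<in>#\<phi>. \<Sum>z\<in>#\<phi>. \<Psi> (y, z)) - (\<Sum>y\<in>#\<phi>. \<Psi> (y, y))) / 2"

lemma pair_energy_add:
  assumes "\<And>x y. \<Psi> (x, y) = \<Psi> (y, x)"
  shows "pair_energy \<Psi> (add_mset y \<phi>) = pair_energy \<Psi> \<phi> + (\<Sum>z\<in>#\<phi>. \<Psi> (y, z))"
proof -
  have "(\<Sum>z\<in>#\<phi>. \<Psi> (z, y)) = (\<Sum>z\<in>#\<phi>. \<Psi> (y, z))"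
    by (intro arg_cong[where f=sum_mset] image_mset_cong assms)
  then show ?thesis
    by (simp add: pair_energy_def sum_mset.distrib field_simps)
qed

lemma pair_energy_nonneg:
  assumes "\<And>x y. \<Psi> (x, y) = \<Psi> (y, x)" "\<And>x y. 0 \<le> \<Psi> (x, y)"
  shows "0 \<le> pair_energy \<Psi> \<phi>"
proof (induction \<phi>)
  case (add y \<phi>)
  have "0 \<le> (\<Sum>z\<in>#\<phi>. \<Psi> (y, z))" by (induction \<phi>) (auto simp: assms(2))
  with add show ?case by (simp add: pair_energy_add[where \<Psi>=\<Psi>, OF assms(1)])
qed (simp add: pair_energy_def)

text \<open>Induction on the last point, which interacts with all earlier ones; symmetry brings its
  column of the double sum into the form of \<open>pair_energy_add\<close>.\<close>

lemma pair_energy_list: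
  assumes "\<And>x y. \<Psi> (x, y) = \<Psi> (y, x)"
  shows "(\<Sum>i=1..k - 1. \<Sum>j=i + 1..k. \<Psi> (x i, x j)) = pair_energy \<Psi> (mset (map x [1..<Suc k]))"
proof (induction k)
  case (Suc k)
  have "(\<Sum>i=1..k. \<Sum>j=i + 1..k. \<Psi> (x i, x j)) = (\<Sum>i=1..k - 1. \<Sum>j=i + 1..k. \<Psi> (x i, x j))"
    by (cases k) simp_all
  moreover have "(\<Sum>i=1..k. \<Sum>j=i + 1..Suc k. \<Psi> (x i, x j)) =
      (\<Sum>i=1..k. (\<Sum>j=i + 1..k. \<Psi> (x i, x j)) + \<Psi> (x i, x (Suc k)))"
    by (intro sum.cong) (auto simp: add.commute)
  moreover have "(\<Sum>z\<in>#mset (map x [1..<Suc k]). \<Psi> (x (Suc k), z)) = (\<Sum>i=1..k. \<Psi> (x i, x (Suc k)))"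
  proof -
    have "(\<Sum>z\<in>#mset (map x [1..<Suc k]). \<Psi> (x (Suc k), z)) = (\<Sum>i\<leftarrow>[1..<Suc k]. \<Psi> (x i, x (Suc k)))"
      unfolding assms[of "x (Suc k)" "_"] mset_map[symmetric] sum_mset_sum_list map_map o_def ..
    also have "\<dots> = (\<Sum>i\<in>set [1..<Suc k]. \<Psi> (x i, x (Suc k)))"
      by (subst sum_list_distinct_conv_sum_set) (simp_all del: upt_Suc)
    also have "set [1..<Suc k] = {1..k}" by auto
    finally show ?thesis .
  qed
  moreover have "mset (map x [1..<Suc (Suc k)]) = add_mset (x (Suc k)) (mset (map x [1..<Suc k]))"
    by simp
  ultimately show ?case
    using Suc by (simp only: pair_energy_add[where \<Psi>=\<Psi>, OF assms] diff_Suc_1 sum.distrib)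
qed (simp add: pair_energy_def)

lemma pair_energy_measurable:
  assumes \<Psi>: "\<Psi> \<in> borel_measurable (N \<Otimes>\<^sub>M N)"
  shows "list_measurable N (\<lambda>xs. pair_energy \<Psi> (mset xs)) borel"
  unfolding list_measurable_def
proof
  fix js
  have [measurable]: "(\<lambda>s. \<Psi> (s !! i, s !! j)) \<in> borel_measurable (stream_space N)" for i j
    by (rule measurable_compose[OF _ \<Psi>]) measurable
  have eq: "pair_energy \<Psi> (mset (map ((!!) s) js)) =
    ((\<Sum>i\<leftarrow>js. \<Sum>j\<leftarrow>js. \<Psi> (s !! i, s !! j)) - (\<Sum>i\<leftarrow>js. \<Psi> (s !! i, s !! i))) / 2" for s
    unfolding pair_energy_def mset_map[symmetric] sum_mset_sum_list map_map o_def ..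
  show "(\<lambda>s. pair_energy \<Psi> (mset (map ((!!) s) js))) \<in> borel_measurable (stream_space N)"
    unfolding eq
    by (intro borel_measurable_divide borel_measurable_diff borel_measurable_sum_list borel_measurable_const) simp_all
qed

text \<open>\<open>l\<close> is recovered from a finite measure by the real density 1 / \<rho>.
  Being Radon would not suffice: counting measure on an uncountable discrete space is Radon but not
  sigma-finite. The product measures in the Janossy expansion rest on this.\<close>

lemma sigma_finite_measure_of_finite_density:
  assumes \<rho>: "\<rho> \<in> borel_measurable l" and pos: "\<And>x. 0 < \<rho> x"
    and fin: "(\<integral>\<^sup>+x. ennreal (\<rho> x) \<partial>l) < \<infinity>"
  shows "sigma_finite_measure l" "finite_measure (density l \<rho>)"
proof -
  let ?M = "density l (\<lambda>x. ennreal (\<rho> x))"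
  show fin_M: "finite_measure ?M"
    using fin \<rho> by (intro finite_measureI) (simp add: emeasure_density cong: nn_integral_cong)
  then interpret finite_measure ?M .
  have "density ?M (\<lambda>x. ennreal (1 / \<rho> x)) = density l (\<lambda>x. ennreal (\<rho> x) * ennreal (1 / \<rho> x))"
    using \<rho> by (subst density_density_eq) simp_all
  also have "(\<lambda>x. ennreal (\<rho> x) * ennreal (1 / \<rho> x)) = (\<lambda>_. 1)"
  proof
    show "ennreal (\<rho> x) * ennreal (1 / \<rho> x) = 1" for x
      using pos[of x] by (simp add: ennreal_mult[symmetric])
  qed
  finally have l: "density ?M (\<lambda>x. ennreal (1 / \<rho> x)) = l"
    by (simp add: density_1)
  have "(\<lambda>x. ennreal (1 / \<rho> x)) \<in> borel_measurable ?M"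
    using \<rho> by simp
  from sigma_finite_iff_density_finite[OF this] show "sigma_finite_measure l"
    unfolding l by simp
qed

text \<open>Once the one-point factor \<open>r\<close> is absorbed into \<open>m\<close> times
  \<open>N\<close>, the remaining factor \<open>h\<close> is the Janossy density; the expansion is
  applied to indicators.\<close>

lemma emeasure_law_janossy:
  fixes l N :: "'a::metric_space measure" and r :: "'a \<Rightarrow> real"
  assumes \<Phi>: "\<Phi> \<in> measurable \<Omega> config_space" and j: "has_janossy_function \<Omega> \<Phi> l j"
    and N: "prob_space N" "sets N = sets borel" and l: "sigma_finite_measure l" "sets l = sets borel"
    and m: "0 \<le> m"
    and r: "r \<in> borel_measurable l" "\<And>y. 0 \<le> r y"
    and l_int: "\<And>f. f \<in> borel_measurable N \<Longrightarrow> (\<integral>\<^sup>+y. ennreal (r y) * f y \<partial>l) = ennreal m * (\<integral>\<^sup>+y. f y \<partial>N)"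
    and h: "list_measurable N h borel" "\<And>xs. 0 \<le> h xs"
    and j_eq: "\<And>k x. j (tuple_config k x) = (\<Prod>i\<in>{1..k}. r (x i)) * h (map x [1..<Suc k])"
    and S: "S \<in> sets config_space"
  shows "emeasure (law \<Omega> \<Phi>) S = (\<Sum>k. level_integral N m k (\<lambda>xs. ennreal (h xs) * indicator S (list_config xs)))"
proof -
  interpret N: prob_space N by fact
  have "list_measurable N (\<lambda>xs. indicator S (list_config xs) :: ennreal) borel"
    by (rule list_measurable_compose[OF list_measurable_list_config[OF N(2)]]) (use S in simp)
  from list_measurable_ennreal_mult[OF h(1) this]
  have meas: "list_measurable N (\<lambda>xs. ennreal (h xs) * indicator S (list_config xs)) borel" .
  have "emeasure (law \<Omega> \<Phi>) S = (\<integral>\<^sup>+\<omega>. ennreal (indicator S (\<Phi> \<omega>)) \<partial>\<Omega>)"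
    unfolding law_def emeasure_distr_eq_nn_integral[OF \<Phi> S] by (simp add: ennreal_indicator)
  also have "\<dots> = (\<Sum>k. ennreal (1 / fact k) * (\<integral>\<^sup>+x. ennreal (indicator S (tuple_config k x) *
      j (tuple_config k x)) \<partial>(\<Pi>\<^sub>M i\<in>{1..k}. l)))"
  proof -
    have "(indicator S :: 'a measure \<Rightarrow> real) \<in> borel_measurable (restrict_space config_space finite_configurations)"
      using S by (intro measurable_restrict_space1) simp
    then show ?thesis
      using j unfolding has_janossy_function_def by simp
  qed
  also have "\<dots> = (\<Sum>k. level_integral N m k (\<lambda>xs. ennreal (h xs) * indicator S (list_config xs)))"
  proof (intro suminf_cong)
    fix k
    have eq: "ennreal (indicator S (tuple_config k x) * j (tuple_config k x)) =
      (\<Prod>i\<in>{1..k}. ennreal (r (x i))) * (ennreal (h (map x [1..<Suc k])) * indicator S (list_config (map x [1..<Suc k])))" for x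
    proof -
      have "ennreal (j (tuple_config k x)) = (\<Prod>i\<in>{1..k}. ennreal (r (x i))) * ennreal (h (map x [1..<Suc k]))"
        unfolding j_eq by (subst ennreal_mult) (auto intro!: prod_nonneg simp: r h prod_ennreal simp del: upt_Suc)
      then show ?thesis
        unfolding tuple_config_conv_list_config[symmetric]
        by (cases "tuple_config k x \<in> S") (simp_all del: upt_Suc)
    qed
    have "(\<integral>\<^sup>+x. ennreal (indicator S (tuple_config k x) * j (tuple_config k x)) \<partial>(\<Pi>\<^sub>M i\<in>{1..k}. l)) =
      ennreal (m ^ k) * (\<integral>\<^sup>+s. ennreal (h (stake k s)) * indicator S (list_config (stake k s)) \<partial>stream_space N)"
      unfolding eq
      by (rule N.nn_integral_PiM_stream[where \<rho>="\<lambda>x. ennreal (r x)", OF l(1) _ _ m l_int meas])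
        (use r(1) in \<open>simp_all only: l N measurable_ennreal measurable_compose\<close>)
    moreover have "ennreal (1 / fact k) * ennreal (m ^ k) = ennreal (m ^ k / fact k)"
      using m by (simp add: ennreal_mult[symmetric])
    ultimately show "ennreal (1 / fact k) * (\<integral>\<^sup>+x. ennreal (indicator S (tuple_config k x) *
        j (tuple_config k x)) \<partial>(\<Pi>\<^sub>M i\<in>{1..k}. l)) =
      level_integral N m k (\<lambda>xs. ennreal (h xs) * indicator S (list_config xs))"
      unfolding level_integral_def by (simp only: mult.assoc[symmetric])
  qed
  finally show ?thesis .
qed

text \<open>Evaluated on the whole space, the Janossy expansion has mass one, and this fixes the
  value of the series.\<close>

lemma (in repulsive) I_sums_of_total_mass:
  assumes C: "0 < C" and total: "(\<Sum>k. level_integral N m k (\<lambda>xs. ennreal (C * g (mset xs)))) = 1"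
  shows "(\<lambda>k. I k {#} / fact k) sums (1 / C)"
proof -
  have "level_integral N m k (\<lambda>xs. ennreal (C * g (mset xs))) = ennreal (C * (I k {#} / fact k))" for k
  proof -
    have meas: "(\<lambda>s. ennreal (g (mset (stake k s)))) \<in> borel_measurable (stream_space N)"
      using list_measurable_stake[OF g_measurable] by (rule measurable_compose) simp
    have "ennreal (m ^ k / fact k) * ennreal C = ennreal (C / fact k) * ennreal (m ^ k)"
      using C m_nonneg by (simp add: ennreal_mult[symmetric] mult_ac)
    moreover have "(\<integral>\<^sup>+s. ennreal (C * g (mset (stake k s))) \<partial>stream_space N) =
      ennreal C * (\<integral>\<^sup>+s. ennreal (g (mset (stake k s))) \<partial>stream_space N)"
      using C by (simp only: ennreal_mult'[OF less_imp_le] nn_integral_cmult[OF meas])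
    ultimately have "level_integral N m k (\<lambda>xs. ennreal (C * g (mset xs))) =
      ennreal (C / fact k) * (ennreal (m ^ k) * (\<integral>\<^sup>+s. ennreal (g (mset (stake k s))) \<partial>stream_space N))"
      unfolding level_integral_def by (simp only: mult.assoc[symmetric])
    also have "\<dots> = ennreal (C / fact k * I k {#})"
      using nn_integral_g_stake[of k "{#}"] by (simp only: add_0_right ennreal_mult''[OF I_nonneg])
    finally show ?thesis by simp
  qed
  then have sum: "(\<Sum>k. ennreal (C * (I k {#} / fact k))) = 1" using total by (simp only:)
  have summable: "summable (\<lambda>k. I k {#} / fact k)"
    using summable_weighted_I[of "\<lambda>_. 1" "{#}"] by simp
  have "(\<Sum>k. ennreal (C * (I k {#} / fact k))) = ennreal (\<Sum>k. C * (I k {#} / fact k))"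
    using C by (intro suminf_ennreal2 summable_mult summable) (simp add: I_nonneg)
  then have "C * (\<Sum>k. I k {#} / fact k) = 1"
    unfolding sum suminf_mult[OF summable] by simp
  then have "(\<Sum>k. I k {#} / fact k) = 1 / C"
    using C by (simp add: field_simps)
  then show ?thesis
    using summable_sums[OF summable] by simp
qed

text \<open>\<open>law_\<zeta>\<close> is phrased as a uniqueness statement because the Poisson law
  is given through its counts; it is applied to the second marginal of \<open>Q\<close>.\<close>

lemma tv_transport_dist_le:
  fixes N :: "'a::metric_space measure" and m C \<delta> :: real
  assumes "normalized_repulsive N m g C" and sets_N: "sets N = sets borel"
    and law_\<Phi>: "\<And>S. S \<in> sets config_space \<Longrightarrow> emeasure (law \<Omega>1 \<Phi>) S =
      (\<Sum>k. level_integral N m k (\<lambda>xs. ennreal (C * g (mset xs)) * indicator S (list_config xs)))"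
    and law_\<zeta>: "\<And>\<mu>. sets \<mu> = sets config_space \<Longrightarrow> (\<And>S. S \<in> sets config_space \<Longrightarrow> emeasure \<mu> S =
      (\<Sum>k. level_integral N m k (\<lambda>xs. ennreal (exp (- m)) * indicator S (list_config xs)))) \<Longrightarrow> \<mu> = law \<Omega>2 \<zeta>"
    and g_dec: "\<And>y \<phi>. g \<phi> - g (add_mset y \<phi>) \<le> \<delta> * size \<phi> * g \<phi>" and \<delta>: "0 \<le> \<delta>"
  shows "tv_transport_dist \<Omega>1 \<Phi> \<Omega>2 \<zeta> \<le> ennreal (m\<^sup>2 * \<delta>)"
proof -
  interpret normalized_repulsive N m g C by fact
  \<comment> \<open>Gibbs side: the points left at the end of the path. Poisson side: all
    points.\<close>
  let ?T = "\<lambda>((n, p), s). (list_config (delete_path p (stake n s)), list_config (stake n s))"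
  define Q where "Q = distr path_space (config_space \<Otimes>\<^sub>M config_space) ?T"
  have T: "?T \<in> measurable path_space (config_space \<Otimes>\<^sub>M config_space)"
    by (rule measurable_delete_path_pair[OF list_measurable_list_config[OF sets_N]])
  have "Q \<in> couplings (law \<Omega>1 \<Phi>) (law \<Omega>2 \<zeta>)"
  proof -
    have sets_law: "sets (law \<Omega>1 \<Phi>) = sets config_space" "sets (law \<Omega>2 \<zeta>) = sets config_space"
      by (simp_all add: law_def)
    have fst: "distr Q (law \<Omega>1 \<Phi>) fst = distr path_space config_space (\<lambda>((n, p), s). list_config (delete_path p (stake n s)))"
      unfolding Q_def distr_cong[OF refl sets_law(1) refl]
      by (subst distr_distr[OF measurable_fst T]) (simp add: comp_def case_prod_unfold)
    have snd: "distr Q (law \<Omega>2 \<zeta>) snd = distr path_space config_space (\<lambda>((n, p), s). list_config (stake n s))"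
      unfolding Q_def distr_cong[OF refl sets_law(2) refl]
      by (subst distr_distr[OF measurable_snd T]) (simp add: comp_def case_prod_unfold)
    have "distr Q (law \<Omega>1 \<Phi>) fst = law \<Omega>1 \<Phi>"
    proof (rule measure_eqI)
      fix S assume "S \<in> sets (distr Q (law \<Omega>1 \<Phi>) fst)"
      then have S: "S \<in> sets config_space" by (simp add: sets_law)
      show "emeasure (distr Q (law \<Omega>1 \<Phi>) fst) S = emeasure (law \<Omega>1 \<Phi>) S"
        unfolding fst law_\<Phi>[OF S] by (rule emeasure_path_space_marginals(1)[OF list_measurable_list_config[OF sets_N] S])
    qed simp
    moreover have "distr Q (law \<Omega>2 \<zeta>) snd = law \<Omega>2 \<zeta>"
      unfolding snd
      by (rule law_\<zeta>) (simp_all add: emeasure_path_space_marginals(2)[OF list_measurable_list_config[OF sets_N]])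
    moreover have "sets Q = sets (law \<Omega>1 \<Phi> \<Otimes>\<^sub>M law \<Omega>2 \<zeta>)"
      unfolding Q_def sets_distr by (intro sets_pair_measure_cong) (simp_all add: sets_law)
    ultimately show ?thesis by (simp add: couplings_def)
  qed
  then have "tv_transport_dist \<Omega>1 \<Phi> \<Omega>2 \<zeta> \<le> (\<integral>\<^sup>+(\<omega>1, \<omega>2). tv_dist \<omega>1 \<omega>2 \<partial>Q)"
    unfolding tv_transport_dist_def by (rule INF_lower)
  also have "\<dots> \<le> (\<integral>\<^sup>+x. (case ?T x of (\<omega>1, \<omega>2) \<Rightarrow> tv_dist \<omega>1 \<omega>2) \<partial>path_space)"
    unfolding Q_def by (rule nn_integral_distr_le[OF T])
  \<comment> \<open>Almost every path is genuine, so the two configurations differ by its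
    \<open>length p\<close> deleted points.\<close>
  also have "\<dots> \<le> (\<integral>\<^sup>+((n, p), s). of_nat (length p) \<partial>path_space)"
  proof (rule nn_integral_mono_AE)
    show "AE x in path_space. (case ?T x of (\<omega>1, \<omega>2) \<Rightarrow> tv_dist \<omega>1 \<omega>2) \<le> (\<lambda>((n, p), s). of_nat (length p)) x"
      using AE_path_space
    proof eventually_elim
      case (elim x)
      obtain n p s where x: "x = ((n, p), s)" by (metis surj_pair)
      then have "path_weight p (stake n s) \<noteq> 0" using elim by simp
      then show ?case
        unfolding x by (simp add: tv_dist_list_config_le mset_delete_path_subset path_weight_length del: length_stake)
    qed
  qed
  also have "\<dots> = (\<Sum>n. level n (\<lambda>xs. ennreal (exp (- m)) * path_mean (\<lambda>p xs. of_nat (length p)) xs))"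
    by (rule nn_integral_path_space) (simp add: list_measurable_def)
  also have "\<dots> \<le> ennreal (m\<^sup>2 * \<delta>)"
    by (rule mean_path_length_le[OF g_dec \<delta>])
  finally show ?thesis .
qed

theorem theorem5p13:
  fixes l :: "'a::metric_space measure"
    and \<Omega>1 :: "'w measure" and \<Phi> :: "'w \<Rightarrow> 'a measure"
    and \<Omega>2 :: "'v measure" and \<zeta> :: "'v \<Rightarrow> 'a measure"
    and \<Psi>1 :: "'a \<Rightarrow> real" and \<Psi>2 :: "'a \<times> 'a \<Rightarrow> real"
    and U :: "'a measure \<Rightarrow> real" and M :: "'a measure"
    and \<epsilon> \<theta> C :: real
  assumes "locally compact (UNIV :: 'a set)"
    and "radon_measure l"
    and "\<Psi>1 \<in> borel_measurable borel" and "\<And>x. 0 \<le> \<Psi>1 x"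
    and "\<Psi>2 \<in> borel_measurable (borel \<Otimes>\<^sub>M borel)" and "\<And>x y. 0 \<le> \<Psi>2 (x, y)"
    and "\<And>x y. \<Psi>2 (x, y) = \<Psi>2 (y, x)"
    and "0 \<le> \<epsilon>" and "0 < \<theta>"
    and "\<And>k x. U (tuple_config k x) =
           (\<Sum>i=1..k. \<Psi>1 (x i)) + (\<Sum>i=1..k - 1. \<Sum>j=i + 1..k. \<Psi>2 (x i, x j))"
    and "gibbs_point_process \<Omega>1 \<Phi> l \<theta> U C"
    and "(\<integral>\<^sup>+x. ennreal (exp (- \<theta> * \<Psi>1 x)) \<partial>l) < \<infinity>"
    and "(SUP z. ennreal \<bar>\<Psi>2 z\<bar>) \<le> ennreal \<epsilon>"
    and "M = density l (\<lambda>x. ennreal (exp (- \<theta> * \<Psi>1 x)))"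
    and "poisson_point_process \<Omega>2 \<zeta> M"
  shows "tv_transport_dist \<Omega>1 \<Phi> \<Omega>2 \<zeta> \<le> (emeasure M UNIV)\<^sup>2 * ennreal \<theta> * ennreal \<epsilon>"
proof -
  define r where "r x = exp (- \<theta> * \<Psi>1 x)" for x
  have sets_l: "sets l = sets borel" using assms(2) by (simp add: radon_measure_def)
  have space_l: "space l = UNIV" using sets_eq_imp_space_eq[OF sets_l] by simp
  have r: "r \<in> borel_measurable l" "\<And>x. 0 < r x"
    using assms(3) by (simp_all add: r_def[abs_def] measurable_cong_sets[OF sets_l refl])
  have M: "M = density l (\<lambda>x. ennreal (r x))" unfolding assms(14) r_def ..
  have sets_M: "sets M = sets borel" and space_M: "space M = UNIV"
    by (simp_all add: M sets_l space_l)
  have "(\<integral>\<^sup>+x. ennreal (r x) \<partial>l) < \<infinity>" using assms(12) by (simp add: r_def)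
  from sigma_finite_measure_of_finite_density[OF r this]
  have sigma_l: "sigma_finite_measure l" and fin_M: "finite_measure M" by (simp_all add: M)
  interpret M: finite_measure M by fact
  define m where "m = measure M (space M)"
  have m: "0 \<le> m" by (simp add: m_def)
  obtain N where N: "prob_space N" "sets N = sets M"
    and N_int: "\<forall>h\<in>borel_measurable M. (\<integral>\<^sup>+y. h y \<partial>M) = ennreal m * (\<integral>\<^sup>+y. h y \<partial>N)"
    using normalize_finite_measure[OF fin_M, folded m_def] space_M by auto
  interpret N: prob_space N by fact
  have sets_N: "sets N = sets borel" using N(2) sets_M by simp
  have space_N: "space N = UNIV" using sets_eq_imp_space_eq[OF sets_N] by simp
  have l_int: "(\<integral>\<^sup>+y. ennreal (r y) * h y \<partial>l) = ennreal m * (\<integral>\<^sup>+y. h y \<partial>N)" if "h \<in> borel_measurable N" for h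
  proof -
    have "h \<in> borel_measurable M" "h \<in> borel_measurable l"
      using that by (simp_all only: measurable_cong_sets[OF sets_N refl] measurable_cong_sets[OF sets_M refl]
          measurable_cong_sets[OF sets_l refl])
    then show ?thesis
      using r(1) N_int[rule_format, of h] by (simp add: M nn_integral_density)
  qed
  have measure_M: "measure M A = m * measure N A" if "A \<in> sets borel" for A
  proof -
    have A: "A \<in> sets M" "A \<in> sets N" using that by (simp_all add: sets_M sets_N)
    have "emeasure M A = ennreal m * emeasure N A"
      using N_int[rule_format, OF borel_measurable_indicator[OF A(1)]] by (simp only: nn_integral_indicator A)
    then show ?thesis
      using m by (simp add: measure_def enn2real_mult)
  qed

  \<comment> \<open>The one-body energy is already contained in \<open>N\<close>; only the pair
    energy remains.\<close>
  define g where "g \<phi> = exp (- \<theta> * pair_energy \<Psi>2 \<phi>)" for \<phi>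
  note add = pair_energy_add[where \<Psi>=\<Psi>2, OF assms(7)]
  have "\<Psi>2 (y, z) \<le> \<epsilon>" for y z
  proof -
    have "ennreal \<bar>\<Psi>2 (y, z)\<bar> \<le> ennreal \<epsilon>"
      by (rule order_trans[OF SUP_upper[OF UNIV_I] assms(13)])
    then show ?thesis using assms(8) by (simp add: ennreal_le_iff)
  qed
  then have sum_le: "(\<Sum>z\<in>#\<phi>. \<Psi>2 (y, z)) \<le> \<epsilon> * size \<phi>" for y \<phi>
    by (induction \<phi>) (simp_all add: algebra_simps add_mono)
  have sum_nonneg: "0 \<le> (\<Sum>z\<in>#\<phi>. \<Psi>2 (y, z))" for y \<phi>
    by (induction \<phi>) (simp_all add: assms(6))
  have g_add: "g (add_mset y \<phi>) = g \<phi> * exp (- \<theta> * (\<Sum>z\<in>#\<phi>. \<Psi>2 (y, z)))" for y \<phi>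
    unfolding g_def add exp_add[symmetric] by (simp add: algebra_simps)
  interpret R: repulsive N m g
  proof
    show "g (add_mset y \<phi>) \<le> g \<phi>" for y \<phi>
      unfolding g_add using mult_nonneg_nonneg[OF less_imp_le[OF assms(9)] sum_nonneg] by (simp add: g_def)
    show "g \<phi> \<le> 1" for \<phi>
      using pair_energy_nonneg[where \<Psi>=\<Psi>2 and \<phi>=\<phi>, OF assms(7,6)] assms(9) by (simp add: g_def)
    have "\<Psi>2 \<in> borel_measurable (N \<Otimes>\<^sub>M N)"
      using assms(5) by (simp add: measurable_cong_sets[OF sets_pair_measure_cong[OF sets_N sets_N] refl])
    from list_measurable_compose[OF pair_energy_measurable[OF this], of "\<lambda>w. exp (- \<theta> * w)" borel]
    show "list_measurable N (\<lambda>xs. g (mset xs)) borel" unfolding g_def by simp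
  qed (simp_all add: space_N m g_def)

  have gibbs: "0 < C" "\<Phi> \<in> measurable \<Omega>1 config_space" "prob_space \<Omega>1"
    and janossy: "has_janossy_function \<Omega>1 \<Phi> l (\<lambda>\<phi>. C * exp (- \<theta> * U \<phi>))"
    using assms(11) unfolding gibbs_point_process_def finite_point_process_def point_process_def by simp_all
  interpret P1: prob_space \<Omega>1 by fact
  have law_\<Phi>: "emeasure (law \<Omega>1 \<Phi>) S =
      (\<Sum>k. level_integral N m k (\<lambda>xs. ennreal (C * g (mset xs)) * indicator S (list_config xs)))"
    if S: "S \<in> sets config_space" for S
  proof (rule emeasure_law_janossy[OF gibbs(2) janossy N(1) sets_N sigma_l sets_l m r(1) less_imp_le[OF r(2)] l_int _ _ _ S])
    show "list_measurable N (\<lambda>xs. C * g (mset xs)) borel"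
      by (rule list_measurable_compose[OF R.g_measurable]) simp
    show "0 \<le> C * g (mset xs)" for xs
      using gibbs(1) R.g_nonneg by simp
    show "C * exp (- \<theta> * U (tuple_config k x)) = (\<Prod>i\<in>{1..k}. r (x i)) * (C * g (mset (map x [1..<Suc k])))" for k x
    proof -
      have "exp (- \<theta> * U (tuple_config k x)) = (\<Prod>i\<in>{1..k}. r (x i)) * g (mset (map x [1..<Suc k]))"
        unfolding assms(10) pair_energy_list[where \<Psi>=\<Psi>2, OF assms(7)] g_def r_def
        by (simp only: distrib_left sum_distrib_left exp_add exp_sum finite_atLeastAtMost)
      then show ?thesis by (simp only: mult_ac)
    qed
  qed
  interpret G: normalized_repulsive N m g C
  proof
    show "0 < C" by fact
    have conf: "configurations \<in> sets config_space"
      using sets.top[of config_space] by (simp add: space_config_space)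
    have "emeasure (law \<Omega>1 \<Phi>) configurations = 1"
      using prob_space.emeasure_space_1[OF P1.prob_space_distr[OF gibbs(2)]]
      by (simp add: law_def space_config_space)
    then have "(\<Sum>k. level_integral N m k (\<lambda>xs. ennreal (C * g (mset xs)))) = 1"
      unfolding law_\<Phi>[OF conf] by (simp add: list_config_in)
    with gibbs(1) show "(\<lambda>k. R.I k {#} / fact k) sums (1 / C)"
      by (rule R.I_sums_of_total_mass)
  qed

  have "tv_transport_dist \<Omega>1 \<Phi> \<Omega>2 \<zeta> \<le> ennreal (m\<^sup>2 * (\<theta> * \<epsilon>))"
  proof (rule tv_transport_dist_le[OF G.normalized_repulsive_axioms sets_N law_\<Phi> poisson_law_eqI[OF assms(15) N(1) sets_N m measure_M]])
    \<comment> \<open>By 1 - exp (- x) \<le> x, with x at most \<theta> times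
      \<open>\<epsilon> * size \<phi>\<close>; this is the origin of the constant \<delta> =
      \<theta> \<epsilon>.\<close>
    show "g \<phi> - g (add_mset y \<phi>) \<le> \<theta> * \<epsilon> * size \<phi> * g \<phi>" for y \<phi>
    proof -
      let ?s = "\<Sum>z\<in>#\<phi>. \<Psi>2 (y, z)"
      have "g \<phi> - g (add_mset y \<phi>) = g \<phi> * (1 - exp (- \<theta> * ?s))" by (simp add: g_add algebra_simps)
      also have "\<dots> \<le> g \<phi> * (\<theta> * ?s)"
        using exp_ge_add_one_self[of "- \<theta> * ?s"] by (intro mult_left_mono R.g_nonneg) simp
      also have "\<dots> \<le> g \<phi> * (\<theta> * (\<epsilon> * size \<phi>))"
        using assms(9) by (intro mult_left_mono R.g_nonneg sum_le) simp_all
      finally show ?thesis by (simp only: mult_ac)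
    qed
    show "0 \<le> \<theta> * \<epsilon>" using assms(8,9) by simp
  qed
  also have "ennreal (m\<^sup>2 * (\<theta> * \<epsilon>)) = (emeasure M UNIV)\<^sup>2 * ennreal \<theta> * ennreal \<epsilon>"
    using assms(8,9) m unfolding M.emeasure_eq_measure m_def[unfolded space_M, symmetric]
    by (simp add: ennreal_mult ennreal_power mult.assoc)
  finally show ?thesis .
qed

end
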